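(* Let $(\Sigma,\mu)$ be a non-atomic $\sigma$-finite measure space with $\mu(\Sigma)>0$, let $\mathcal{B}$ be a Muckenhoupt basis, and let $\mathcal{F}$ be a family of extrapolation pairs. Let $u,v$ be $\mathcal{B}$-weights with $v(B)<\infty$ for every $B\in\mathcal{B}$, and let $\mathbb{X}_v$ be a Banach function space over $(\Sigma,v)$. Assume that there is $\mathcal{N}<\infty$ such that $$\|(M'_{\mathcal{B},v}h)u^{-1}\|_{\mathbb{X}_v'}\le\mathcal{N}\|hu^{-1}\|_{\mathbb{X}_v'},\qquad\forall h\in\mathbb{M}_\mu.$$ If for some $p_0\in(0,\infty)$ and for every $w\in A_{\infty,\mathcal{B}}$, $$\|f\|_{L^{p_0}(\Sigma,w)}\le\Psi([w]_{A_{\infty,\mathcal{B}}})\|g\|_{L^{p_0}(\Sigma,w)},\qquad(f,g)\in\mathcal{F},$$ where $\Psi:[1,\infty)\to[1,\infty)$ is non-decreasing, then for every $p\in(0,\infty)$ there is $C<\infty$ such that $$\|f^pu\|_{\mathbb{X}_v}\le C\|g^pu\|_{\mathbb{X}_v},\qquad(f,g)\in\mathcal{F},$$ and for all $p,q\in(0,\infty)$ there is $C<\infty$ such that $$\Big\|\Big(\sum_jf_j^q\Big)^{\frac pq}u\Big\|_{\mathbb{X}_v}\le C\Big\|\Big(\sum_jg_j^q\Big)^{\frac pq}u\Big\|_{\mathbb{X}_v},\qquad\{(f_j,g_j)\}_j\subset\mathcal{F}.$$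
   Context: Non-atomic: every measurable $F$ with $\mu(F)>0$ contains a measurable $F'$ with $0<\mu(F')<\mu(F)$. A basis $\mathcal{B}$ is a collection of $\mu$-measurable sets with $0<\mu(B)<\infty$ for all $B\in\mathcal{B}$; standing assumption: $\mu(\Sigma\setminus\Sigma_{\mathcal{B}})=0$, $\Sigma_{\mathcal{B}}=\bigcup_{B\in\mathcal{B}}B$. $\mathbb{M}_\mu$: $\mu$-measurable functions. $M_{\mathcal{B}}f(x)=\sup_{x\in B\in\mathcal{B}}\frac1{\mu(B)}\int_B|f|\,d\mu$ for $x\in\Sigma_{\mathcal{B}}$, $0$ otherwise; $M'_{\mathcal{B},v}h=M_{\mathcal{B}}(hv)/v$. A $\mathcal{B}$-weight is a $\mu$-measurable $w$ with $0<w<\infty$ $\mu$-a.e.; $v$ is identified with the measure $dv=v\,d\mu$; $L^p(\Sigma,w)=L^p(\Sigma,w\,d\mu)$. For $1<p<\infty$, $w\in A_{p,\mathcal{B}}$ iff $[w]_{A_{p,\mathcal{B}}}=\sup_{B}\big(\frac1{\mu(B)}\int_Bw\,d\mu\big)\big(\frac1{\mu(B)}\int_Bw^{1-p'}d\mu\big)^{p-1}<\infty$; $w\in A_{1,\mathcal{B}}$ iff $[w]_{A_{1,\mathcal{B}}}=\|(M_{\mathcal{B}}w)w^{-1}\|_{L^\infty(\Sigma,\mu)}<\infty$; $A_{\infty,\mathcal{B}}=\bigcup_{p\ge1}A_{p,\mathcal{B}}$ and $[w]_{A_{\infty,\mathcal{B}}}=\inf_{p:\,w\in A_{p,\mathcal{B}}}[w]_{A_{p,\mathcal{B}}}$.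 $\mathcal{B}$ is a Muckenhoupt basis if for all $p\in(1,\infty)$ and $w\in A_{p,\mathcal{B}}$, $\|M_{\mathcal{B}}f\|_{L^p(\Sigma,w)}\le C\|f\|_{L^p(\Sigma,w)}$. Function norm over $(\Sigma,\nu)$ (here $\nu=v$): a map $\|\cdot\|$ from $\nu$-measurable functions to $[0,\infty]$ with: (i) $\|f\|=\||f|\|$, and $\|f\|=0$ iff $f=0$ $\nu$-a.e.; (ii) $\|f+g\|\le\|f\|+\|g\|$; (iii) $\|\lambda f\|=|\lambda|\|f\|$; (iv) $|f|\le|g|$ $\nu$-a.e. implies $\|f\|\le\|g\|$; (v) $|f_j|\uparrow|f|$ $\nu$-a.e. implies $\|f_j\|\uparrow\|f\|$; (vi) if $\nu(E)<\infty$ then $\|\mathbf{1}_E\|<\infty$ and $\int_E|f|d\nu\le C_E\|f\|$ with $C_E\in(0,\infty)$ independent of $f$. $\mathbb{X}=\{f:\|f\|<\infty\}$ is a Banach function space over $(\Sigma,\nu)$; its associate space has norm $\|f\|_{\mathbb{X}'}=\sup\{\int_\Sigma|fg|\,d\nu:\|g\|_{\mathbb{X}}\le1\}$. Norms extend to $[0,\infty]$-valued functions through (v). A family of extrapolation pairs $\mathcal{F}$ is a collection of pairs $(f,g)$ of nonnegative measurable functions. *)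

theory Defs
  imports "HOL-Analysis.Analysis" "HOL-Probability.Essential_Supremum"
begin

text \<open>
  A measure space with \<open>\<Sigma> = space M\<close> and \<open>\<mu> = emeasure M\<close>; a weight \<open>w\<close> is identified with
  the measure \<open>density M w\<close>. Weights, extrapolation pairs and all quantities built from them take
  values in \<open>[0,\<infinity>]\<close> (type \<open>ennreal\<close>), with \<open>0 * \<infinity> = 0\<close>. The functions \<open>h\<close>, \<open>f\<close>, \<open>g\<close> on which
  function norms act are real-valued.
\<close>

definition ennpowr :: "ennreal \<Rightarrow> real \<Rightarrow> ennreal"  (infixr "epowr" 80) where
  "x epowr a =
    (if a = 0 then 1
     else if x = \<infinity> \<and> a > 0 \<or> x = 0 \<and> a < 0 then \<infinity>
     else ennreal (enn2real x powr a))"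

definition nonatomic :: "'a measure \<Rightarrow> bool" where
  "nonatomic M \<longleftrightarrow>
    (\<forall>F\<in>sets M. emeasure M F > 0 \<longrightarrow>
      (\<exists>F'\<in>sets M. F' \<subseteq> F \<and> 0 < emeasure M F' \<and> emeasure M F' < emeasure M F))"

text \<open>The union \<open>\<Union>\<B>\<close> may be uncountable, so that \<open>\<mu>(\<Sigma> - \<Union>\<B>) = 0\<close> is expressed by \<open>AE\<close>
  (\<open>emeasure\<close> would be \<open>0\<close> by default on a non-measurable set).\<close>

definition mbasis :: "'a measure \<Rightarrow> 'a set set \<Rightarrow> bool" where
  "mbasis M \<B> \<longleftrightarrow>
    (\<forall>B\<in>\<B>. B \<in> sets M \<and> 0 < emeasure M B \<and> emeasure M B < \<infinity>) \<and>
    (AE x in M. x \<in> \<Union>\<B>)"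

definition avg :: "'a measure \<Rightarrow> 'a set \<Rightarrow> ('a \<Rightarrow> ennreal) \<Rightarrow> ennreal" where
  "avg M B F = (\<integral>\<^sup>+x\<in>B. F x \<partial>M) / emeasure M B"

text \<open>The maximal function of \<open>f\<close> with \<open>F = \<bar>f\<bar>\<close>. Outside \<open>\<Union>\<B>\<close> the supremum is over the empty
  set, hence \<open>0\<close>.\<close>

definition maximal :: "'a measure \<Rightarrow> 'a set set \<Rightarrow> ('a \<Rightarrow> ennreal) \<Rightarrow> 'a \<Rightarrow> ennreal" where
  "maximal M \<B> F x = (SUP B\<in>{B\<in>\<B>. x \<in> B}. avg M B F)"

definition dual_maximal ::
    "'a measure \<Rightarrow> 'a set set \<Rightarrow> ('a \<Rightarrow> ennreal) \<Rightarrow> ('a \<Rightarrow> real) \<Rightarrow> 'a \<Rightarrow> ennreal" where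
  "dual_maximal M \<B> v h x = maximal M \<B> (\<lambda>y. ennreal \<bar>h y\<bar> * v y) x / v x"

text \<open>
  For an arbitrary basis the maximal function need not be measurable. A norm \<open>\<rho>\<close> of a maximal
  function is therefore always read as the infimum of \<open>\<rho>\<close> over the measurable majorants, which is
  \<open>\<rho>\<close> itself on measurable functions (see \<open>outer_norm_measurable\<close>).
\<close>

definition outer_norm ::
    "'a measure \<Rightarrow> (('a \<Rightarrow> ennreal) \<Rightarrow> ennreal) \<Rightarrow> ('a \<Rightarrow> ennreal) \<Rightarrow> ennreal" where
  "outer_norm M \<rho> F = (INF G\<in>{G \<in> borel_measurable M. AE x in M. F x \<le> G x}. \<rho> G)"

lemma outer_norm_measurable:
  assumes "F \<in> borel_measurable M"
    and "\<And>G. G \<in> borel_measurable M \<Longrightarrow> AE x in M. F x \<le> G x \<Longrightarrow> \<rho> F \<le> \<rho> G"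
  shows "outer_norm M \<rho> F = \<rho> F"
  unfolding outer_norm_def
  by (rule antisym) (use assms in \<open>auto intro!: INF_lower INF_greatest\<close>)

definition Lp_norm :: "real \<Rightarrow> 'a measure \<Rightarrow> ('a \<Rightarrow> ennreal) \<Rightarrow> ennreal" where
  "Lp_norm p \<nu> F = (\<integral>\<^sup>+x. F x epowr p \<partial>\<nu>) epowr (1 / p)"

definition weight :: "'a measure \<Rightarrow> ('a \<Rightarrow> ennreal) \<Rightarrow> bool" where
  "weight M w \<longleftrightarrow> w \<in> borel_measurable M \<and> (AE x in M. 0 < w x \<and> w x < \<infinity>)"

definition conj_exp :: "real \<Rightarrow> real" where
  "conj_exp p = p / (p - 1)"

definition A_const :: "'a measure \<Rightarrow> 'a set set \<Rightarrow> real \<Rightarrow> ('a \<Rightarrow> ennreal) \<Rightarrow> ennreal" where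
  "A_const M \<B> p w =
    (if p = 1 then outer_norm M (esssup M) (\<lambda>x. maximal M \<B> w x / w x)
     else (SUP B\<in>\<B>. avg M B w * avg M B (\<lambda>x. w x epowr (1 - conj_exp p)) epowr (p - 1)))"

definition A_class :: "'a measure \<Rightarrow> 'a set set \<Rightarrow> real \<Rightarrow> ('a \<Rightarrow> ennreal) set" where
  "A_class M \<B> p = {w. weight M w \<and> A_const M \<B> p w < \<infinity>}"

definition A_inf :: "'a measure \<Rightarrow> 'a set set \<Rightarrow> ('a \<Rightarrow> ennreal) set" where
  "A_inf M \<B> = (\<Union>p\<in>{1..}. A_class M \<B> p)"

definition A_inf_const :: "'a measure \<Rightarrow> 'a set set \<Rightarrow> ('a \<Rightarrow> ennreal) \<Rightarrow> ennreal" where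
  "A_inf_const M \<B> w = (INF p\<in>{p. 1 \<le> p \<and> w \<in> A_class M \<B> p}. A_const M \<B> p w)"

definition muckenhoupt_basis :: "'a measure \<Rightarrow> 'a set set \<Rightarrow> bool" where
  "muckenhoupt_basis M \<B> \<longleftrightarrow>
    mbasis M \<B> \<and>
    (\<forall>p>1. \<forall>w\<in>A_class M \<B> p. \<exists>C::real. \<forall>f\<in>borel_measurable M.
      outer_norm M (Lp_norm p (density M w)) (maximal M \<B> (\<lambda>x. ennreal \<bar>f x\<bar>))
        \<le> ennreal C * Lp_norm p (density M w) (\<lambda>x. ennreal \<bar>f x :: real\<bar>))"

text \<open>The Banach function space given by \<open>\<rho>\<close> is \<open>{f \<in> borel_measurable \<nu>. \<rho> f < \<infinity>}\<close>.\<close>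

definition function_norm :: "'a measure \<Rightarrow> (('a \<Rightarrow> real) \<Rightarrow> ennreal) \<Rightarrow> bool" where
  "function_norm \<nu> \<rho> \<longleftrightarrow>
    (\<forall>f\<in>borel_measurable \<nu>.
      \<rho> f = \<rho> (\<lambda>x. \<bar>f x\<bar>) \<and> (\<rho> f = 0 \<longleftrightarrow> (AE x in \<nu>. f x = 0))) \<and>
    (\<forall>f\<in>borel_measurable \<nu>. \<forall>g\<in>borel_measurable \<nu>. \<rho> (\<lambda>x. f x + g x) \<le> \<rho> f + \<rho> g) \<and>
    (\<forall>c. \<forall>f\<in>borel_measurable \<nu>. \<rho> (\<lambda>x. c * f x) = ennreal \<bar>c\<bar> * \<rho> f) \<and>
    (\<forall>f\<in>borel_measurable \<nu>. \<forall>g\<in>borel_measurable \<nu>.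
      (AE x in \<nu>. \<bar>f x\<bar> \<le> \<bar>g x\<bar>) \<longrightarrow> \<rho> f \<le> \<rho> g) \<and>
    (\<forall>f F. (\<forall>j::nat. f j \<in> borel_measurable \<nu>) \<longrightarrow> F \<in> borel_measurable \<nu> \<longrightarrow>
      (AE x in \<nu>. incseq (\<lambda>j. \<bar>f j x\<bar>) \<and> (\<lambda>j. \<bar>f j x\<bar>) \<longlonglongrightarrow> \<bar>F x\<bar>) \<longrightarrow>
      incseq (\<lambda>j. \<rho> (f j)) \<and> (\<lambda>j. \<rho> (f j)) \<longlonglongrightarrow> \<rho> F) \<and>
    (\<forall>E\<in>sets \<nu>. emeasure \<nu> E < \<infinity> \<longrightarrow>
      \<rho> (indicator E) < \<infinity> \<and>
      (\<exists>C>0. \<forall>f\<in>borel_measurable \<nu>. (\<integral>\<^sup>+x\<in>E. ennreal \<bar>f x\<bar> \<partial>\<nu>) \<le> ennreal C * \<rho> f))"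

definition assoc_norm ::
    "'a measure \<Rightarrow> (('a \<Rightarrow> real) \<Rightarrow> ennreal) \<Rightarrow> ('a \<Rightarrow> real) \<Rightarrow> ennreal" where
  "assoc_norm \<nu> \<rho> f =
    (SUP g\<in>{g \<in> borel_measurable \<nu>. \<rho> g \<le> 1}. \<integral>\<^sup>+x. ennreal \<bar>f x * g x\<bar> \<partial>\<nu>)"

text \<open>Extension of a function norm to \<open>[0,\<infinity>]\<close>-valued functions by the monotone convergence
  axiom, along the truncations \<open>min F n\<close>, which increase to \<open>F\<close>.\<close>

definition ext_norm :: "(('a \<Rightarrow> real) \<Rightarrow> ennreal) \<Rightarrow> ('a \<Rightarrow> ennreal) \<Rightarrow> ennreal" where
  "ext_norm \<rho> F = (SUP n::nat. \<rho> (\<lambda>x. enn2real (min (F x) (of_nat n))))"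

definition extrapolation_family ::
    "'a measure \<Rightarrow> (('a \<Rightarrow> ennreal) \<times> ('a \<Rightarrow> ennreal)) set \<Rightarrow> bool" where
  "extrapolation_family M \<F> \<longleftrightarrow>
    (\<forall>(f, g)\<in>\<F>. f \<in> borel_measurable M \<and> g \<in> borel_measurable M)"

end

theory Submission
  imports Defs
begin

text \<open>
  Write \<open>\<nu> = v \<mu>\<close> and \<open>X'\<close> for the associate norm. By the Lorentz--Luxemburg theorem
  (\<open>Lorentz_Luxemburg\<close>) the norm of \<open>f\<^sup>p u\<close> is the supremum of \<open>\<integral> f\<^sup>p h v d\<mu>\<close> over all \<open>h \<ge> 0\<close> with
  \<open>X'(h u\<^bsup>-1\<^esup>) \<le> 1\<close>. The hypothesis on the dual maximal operator lets the Rubio de Francia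
  algorithm (\<open>rubio_de_francia\<close>) majorize \<open>h\<close> by a function \<open>H\<close> such that \<open>X'(H u\<^bsup>-1\<^esup>)\<close> is finite
  and \<open>w = H v\<close> is an \<open>A\<^sub>1\<close> weight. An inequality \<open>\<integral> f\<^sup>p w \<le> C \<integral> g\<^sup>p w\<close> then gives
  \<open>\<integral> f\<^sup>p h v \<le> C \<integral> (g\<^sup>p u) (H u\<^bsup>-1\<^esup>) d\<nu> \<le> C X(g\<^sup>p u) X'(H u\<^bsup>-1\<^esup>)\<close>.

  So the weighted inequality has to be carried from the exponent \<open>p\<^sub>0\<close> to every exponent \<open>p\<close>. For
  \<open>p < p\<^sub>0\<close> the algorithm is run in \<open>L\<^sup>q(w)\<close>, where \<open>w \<in> A\<^sub>q\<close>, on the function \<open>g\<^bsup>p/q\<^esup>\<close>; Hoelder's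
  inequality and the weight \<open>w H\<^bsup>-t\<^esup> \<in> A\<^bsub>q+t\<^esub>\<close> connect the two exponents
  (\<open>weighted_bound_decrease\<close>). For \<open>p > p\<^sub>1\<close> and \<open>w \<in> A\<^bsub>p/p\<^sub>1\<^esub>\<close> the argument of the previous paragraph
  applies to \<open>X = L\<^bsup>p/p\<^sub>1\<^esup>(w)\<close> (\<open>weighted_bound_increase\<close>). Going first far below \<open>p\<^sub>0\<close> and then up
  reaches every \<open>p\<close> and every weight.

  The weight \<open>w = H v\<close> depends on \<open>h\<close>, and so does the constant that it brings. That one constant
  serves all \<open>h\<close> is a gliding hump argument (\<open>gliding_hump\<close>): test functions \<open>h\<^sub>k\<close> that violate the
  claim with ever larger constants could be superposed to \<open>\<Sum>\<^sub>k 2\<^bsup>-k\<^esup> h\<^sub>k\<close>, and the single weight built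
  from this function would violate the weighted inequality. It is used in all three places where
  the algorithm is applied.

  For the vector-valued inequality, \<open>\<integral> f\<^sub>j\<^sup>q w \<le> C \<integral> g\<^sub>j\<^sup>q w\<close> is summed over \<open>j\<close>. The pairs
  \<open>((\<Sum>\<^sub>j f\<^sub>j\<^sup>q)\<^bsup>1/q\<^esup>, (\<Sum>\<^sub>j g\<^sub>j\<^sup>q)\<^bsup>1/q\<^esup>)\<close> therefore satisfy the weighted inequality with exponent \<open>q\<close>, hence with
  every exponent, and the scalar result applies to them.
\<close>

section \<open>Powers in \<open>[0,\<infinity>]\<close> and Hoelder's inequality\<close>

lemma ennreal_zero_pos_top_cases:
  fixes x :: ennreal
  obtains (zero) "x = 0" | (top) "x = \<infinity>" | (pos) r where "r > 0" "x = ennreal r"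
proof (cases x)
  case (real r)
  then show ?thesis using that(1) that(3)[of r] by (cases "r = 0") auto
qed (use that in auto)

lemma epowr_zero_right [simp]: "x epowr 0 = 1"
  by (simp add: ennpowr_def)

lemma epowr_zero_left: "a \<noteq> 0 \<Longrightarrow> 0 epowr a = (if a > 0 then 0 else \<infinity>)"
  by (auto simp: ennpowr_def)

lemma epowr_top_left: "a \<noteq> 0 \<Longrightarrow> top epowr a = (if a > 0 then top else 0)"
  by (auto simp: ennpowr_def)

lemma epowr_ennreal: "r > 0 \<Longrightarrow> ennreal r epowr a = ennreal (r powr a)"
  by (auto simp: ennpowr_def)

lemma epowr_one_right [simp]: "x epowr 1 = x"
  by (cases x rule: ennreal_zero_pos_top_cases)
     (auto simp: epowr_zero_left epowr_top_left epowr_ennreal)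

lemma epowr_one_left [simp]: "1 epowr a = 1"
  using epowr_ennreal[of 1 a] by simp

lemma epowr_epowr: "(x epowr a) epowr b = x epowr (a * b)"
proof (cases "a = 0 \<or> b = 0")
  case False
  then show ?thesis
    by (cases x rule: ennreal_zero_pos_top_cases)
      (auto simp: epowr_zero_left epowr_top_left epowr_ennreal powr_powr zero_less_mult_iff
        mult_less_0_iff)
qed auto

lemma epowr_mono:
  assumes "0 \<le> a" "x \<le> y"
  shows "x epowr a \<le> y epowr a"
proof (cases "a = 0")
  case False
  then show ?thesis using assms
    by (cases x rule: ennreal_zero_pos_top_cases; cases y rule: ennreal_zero_pos_top_cases)
      (auto simp: epowr_zero_left epowr_top_left epowr_ennreal top_unique powr_mono2)
qed auto

text \<open>For nonnegative exponents the rule survives at \<open>0 * \<infinity> = 0\<close>; for negative ones both factors have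
  to be positive and finite, as in \<open>epowr_mult_distrib_pos_finite\<close>.\<close>
lemma epowr_mult_distrib:
  assumes "0 \<le> a"
  shows "(x * y) epowr a = x epowr a * y epowr a"
proof (cases "a = 0")
  case False
  then show ?thesis using assms
    by (cases x rule: ennreal_zero_pos_top_cases; cases y rule: ennreal_zero_pos_top_cases)
      (auto simp: epowr_zero_left epowr_top_left epowr_ennreal ennreal_mult_top ennreal_top_mult
        powr_mult simp flip: ennreal_mult)
qed auto

text \<open>At \<open>0\<close> and \<open>\<infinity>\<close> the rule fails for exponents of opposite signs.\<close>
lemma epowr_add:
  assumes "0 < x" "x < \<infinity>"
  shows "x epowr (a + b) = x epowr a * x epowr b"
  using assms by (cases x rule: ennreal_zero_pos_top_cases)
    (auto simp: epowr_ennreal powr_add simp flip: ennreal_mult)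

lemma epowr_add_same_sign:
  assumes "0 < a" "0 < b"
  shows "x epowr (a + b) = x epowr a * x epowr b"
  using assms by (cases x rule: ennreal_zero_pos_top_cases)
    (auto simp: epowr_ennreal epowr_zero_left epowr_top_left powr_add
       simp flip: ennreal_mult)

lemma epowr_eq_0_iff: "0 < a \<Longrightarrow> x epowr a = 0 \<longleftrightarrow> x = 0"
  by (cases x rule: ennreal_zero_pos_top_cases)
    (auto simp: epowr_ennreal epowr_zero_left epowr_top_left)

lemma epowr_eq_top_iff: "0 < a \<Longrightarrow> x epowr a = \<infinity> \<longleftrightarrow> x = \<infinity>"
  by (cases x rule: ennreal_zero_pos_top_cases)
    (auto simp: epowr_ennreal epowr_zero_left epowr_top_left)

lemma epowr_less_top_iff: "0 < a \<Longrightarrow> x epowr a < \<infinity> \<longleftrightarrow> x < \<infinity>"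
  using epowr_eq_top_iff[of a x] by (simp add: less_top[symmetric])

lemma epowr_pos_finite: "0 < x \<Longrightarrow> x < \<infinity> \<Longrightarrow> 0 < x epowr a \<and> x epowr a < \<infinity>"
  by (cases x rule: ennreal_zero_pos_top_cases) (auto simp: epowr_ennreal)

lemma epowr_mult_distrib_pos_finite:
  assumes "0 < x" "x < \<infinity>" "0 < y" "y < \<infinity>"
  shows "(x * y) epowr a = x epowr a * y epowr a"
  using assms
  by (cases x rule: ennreal_zero_pos_top_cases; cases y rule: ennreal_zero_pos_top_cases)
    (auto simp: epowr_ennreal powr_mult simp flip: ennreal_mult)

lemma borel_measurable_epowr [measurable]:
  assumes [measurable]: "F \<in> borel_measurable M"
  shows "(\<lambda>x. F x epowr a) \<in> borel_measurable M"
  unfolding ennpowr_def by measurable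

lemma Young_epowr:
  assumes "0 < \<theta>" "\<theta> < 1"
  shows "x epowr \<theta> * y epowr (1 - \<theta>) \<le> ennreal \<theta> * x + ennreal (1 - \<theta>) * y"
  using assms
proof (cases x rule: ennreal_zero_pos_top_cases; cases y rule: ennreal_zero_pos_top_cases)
  fix r s assume "r > 0" "x = ennreal r" "s > 0" "y = ennreal s"
  then show ?thesis
    using assms Youngs_inequality_0[of \<theta> "1 - \<theta>" r s]
    by (auto simp: epowr_ennreal simp flip: ennreal_mult ennreal_plus intro!: ennreal_leI)
qed (auto simp: epowr_zero_left epowr_top_left ennreal_mult_top)

text \<open>Young's inequality is integrated for \<open>F\<close> and \<open>G\<close> divided by their integrals. The degenerate
  cases, where an integral is \<open>0\<close> or \<open>\<infinity>\<close>, are treated first.\<close>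
lemma nn_integral_Hoelder:
  assumes [measurable]: "F \<in> borel_measurable M" "G \<in> borel_measurable M"
    and \<theta>: "0 < \<theta>" "\<theta> < 1"
  shows "(\<integral>\<^sup>+x. F x epowr \<theta> * G x epowr (1 - \<theta>) \<partial>M)
    \<le> (\<integral>\<^sup>+x. F x \<partial>M) epowr \<theta> * (\<integral>\<^sup>+x. G x \<partial>M) epowr (1 - \<theta>)"
proof -
  let ?a = "\<integral>\<^sup>+x. F x \<partial>M" and ?b = "\<integral>\<^sup>+x. G x \<partial>M"
  consider (zero) "?a = 0 \<or> ?b = 0" | (top) "?a \<noteq> 0" "?b \<noteq> 0" "?a = \<infinity> \<or> ?b = \<infinity>"
    | (pos) "0 < ?a" "?a < \<infinity>" "0 < ?b" "?b < \<infinity>"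
    using not_gr_zero less_top by (metis infinity_ennreal_def)
  then show ?thesis
  proof cases
    case zero
    then have "AE x in M. F x epowr \<theta> * G x epowr (1 - \<theta>) = 0"
      using \<theta> by (auto simp: nn_integral_0_iff_AE epowr_eq_0_iff elim: AE_mp)
    then have "(\<integral>\<^sup>+x. F x epowr \<theta> * G x epowr (1 - \<theta>) \<partial>M) = 0"
      by (subst nn_integral_0_iff_AE) auto
    then show ?thesis by simp
  next
    case top
    then have "?a epowr \<theta> * ?b epowr (1 - \<theta>) = \<infinity>"
      using \<theta> by (auto simp: epowr_eq_top_iff epowr_eq_0_iff epowr_top_left ennreal_mult_eq_top_iff)
    then show ?thesis by simp
  next
    case pos
    have "(\<integral>\<^sup>+x. F x epowr \<theta> * G x epowr (1 - \<theta>) \<partial>M)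
       = (?a epowr \<theta> * ?b epowr (1 - \<theta>)) *
         (\<integral>\<^sup>+x. (inverse ?a * F x) epowr \<theta> * (inverse ?b * G x) epowr (1 - \<theta>) \<partial>M)"
    proof (subst nn_integral_cmult[symmetric], measurable, rule nn_integral_cong)
      fix x
      have "?a * inverse ?a = 1" "?b * inverse ?b = 1"
        using pos by (auto simp: ennreal_mult_divide_eq divide_ennreal_def[symmetric])
      then have "F x = ?a * (inverse ?a * F x)" "G x = ?b * (inverse ?b * G x)"
        by (simp_all flip: mult.assoc)
      then have "F x epowr \<theta> = ?a epowr \<theta> * (inverse ?a * F x) epowr \<theta>"
        "G x epowr (1 - \<theta>) = ?b epowr (1 - \<theta>) * (inverse ?b * G x) epowr (1 - \<theta>)"
        using \<theta> by (simp_all flip: epowr_mult_distrib)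
      then show "F x epowr \<theta> * G x epowr (1 - \<theta>) = ?a epowr \<theta> * ?b epowr (1 - \<theta>) *
         ((inverse ?a * F x) epowr \<theta> * (inverse ?b * G x) epowr (1 - \<theta>))"
        by (simp add: mult.assoc mult.left_commute)
    qed
    also have "(\<integral>\<^sup>+x. (inverse ?a * F x) epowr \<theta> * (inverse ?b * G x) epowr (1 - \<theta>) \<partial>M)
       \<le> (\<integral>\<^sup>+x. ennreal \<theta> * (inverse ?a * F x) + ennreal (1 - \<theta>) * (inverse ?b * G x) \<partial>M)"
      by (intro nn_integral_mono Young_epowr \<theta>)
    also have "\<dots> = ennreal \<theta> * (inverse ?a * ?a) + ennreal (1 - \<theta>) * (inverse ?b * ?b)"
      by (simp add: nn_integral_add nn_integral_cmult)
    also have "\<dots> = 1"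
      using pos \<theta> by (simp add: ennreal_mult_divide_eq divide_ennreal_def[symmetric] mult.commute
         flip: ennreal_plus)
    finally show ?thesis by (simp add: mult_left_mono)
  qed
qed

section \<open>Duality of weighted Lebesgue spaces\<close>

text \<open>A supremum of integrals against test functions is countably subadditive for free. Both the norms
  of \<open>L\<^sup>r\<close> and the associate norms are handled in this form, which also spares Minkowski's
  inequality.\<close>
definition dual_norm :: "'a measure \<Rightarrow> ('a \<Rightarrow> ennreal) set \<Rightarrow> ('a \<Rightarrow> ennreal) \<Rightarrow> ennreal" where
  "dual_norm \<nu> K F = (SUP k\<in>K. \<integral>\<^sup>+x. F x * k x \<partial>\<nu>)"

text \<open>For an exhaustion \<open>E\<close> by sets of finite measure these functions are integrable and increase
  to \<open>F\<close>.\<close>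
definition truncate :: "(nat \<Rightarrow> 'a set) \<Rightarrow> nat \<Rightarrow> ('a \<Rightarrow> ennreal) \<Rightarrow> 'a \<Rightarrow> ennreal" where
  "truncate E n F x = min (F x) (of_nat n) * indicator (E n) x"

lemma truncate_le: "truncate E n F x \<le> F x"
  by (auto simp: truncate_def indicator_def)

lemma truncate_le_of_nat: "truncate E n F x \<le> of_nat n * indicator (E n) x"
  by (auto simp: truncate_def indicator_def)

lemma measurable_truncate:
  assumes "F \<in> borel_measurable M" "E n \<in> sets M"
  shows "truncate E n F \<in> borel_measurable M"
  unfolding truncate_def using assms by measurable

lemma incseq_truncate:
  assumes "incseq E"
  shows "incseq (\<lambda>n. truncate E n F x)"
proof (rule incseq_SucI)
  fix n
  have "(of_nat n :: ennreal) \<le> of_nat (Suc n)"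
    using of_nat_mono[of n "Suc n", where 'a=ennreal] by simp
  moreover have "E n \<subseteq> E (Suc n)" using assms by (auto simp: incseq_Suc_iff)
  ultimately show "truncate E n F x \<le> truncate E (Suc n) F x"
    unfolding truncate_def
    by (auto simp: indicator_def min.coboundedI2 simp del: of_nat_Suc)
qed

lemma SUP_truncate:
  assumes "incseq E" "x \<in> (\<Union>n. E n)"
  shows "(SUP n. truncate E n F x) = F x"
proof (rule antisym)
  show "(SUP n. truncate E n F x) \<le> F x"
    by (intro SUP_least truncate_le)
  obtain m where m: "x \<in> E m" using assms(2) by auto
  show "F x \<le> (SUP n. truncate E n F x)"
  proof (rule dense_le)
    fix y assume y: "y < F x"
    then have "y < top" using less_le_trans top_greatest by blast
    then obtain n where n: "y < of_nat n" using ennreal_Ex_less_of_nat by auto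
    have "x \<in> E (max n m)" using assms(1) m by (meson incseq_def max.cobounded2 subsetD)
    then have "truncate E (max n m) F x = min (F x) (of_nat (max n m))"
      by (simp add: truncate_def)
    moreover have "(of_nat n :: ennreal) \<le> of_nat (max n m)" by (intro of_nat_mono) simp
    then have "y \<le> of_nat (max n m)" using n by (meson less_imp_le order_trans)
    ultimately have "y \<le> truncate E (max n m) F x" using y by auto
    then show "y \<le> (SUP n. truncate E n F x)" by (rule SUP_upper2[rotated]) simp
  qed
qed

lemma (in sigma_finite_measure) finite_exhaustion:
  obtains E :: "nat \<Rightarrow> 'a set" where "incseq E" "\<And>n. E n \<in> sets M" "(\<Union>n. E n) = space M"
    "\<And>n. emeasure M (E n) < \<infinity>"
  using sigma_finite_incseq by (metis infinity_ennreal_def less_top range_subsetD)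

lemma nn_integral_SUP_truncate:
  assumes E: "incseq E" "\<And>n. E n \<in> sets M" "(\<Union>n. E n) = space M"
    and [measurable]: "F \<in> borel_measurable M" "K \<in> borel_measurable M"
  shows "(\<integral>\<^sup>+x. F x * K x \<partial>M) = (SUP n. \<integral>\<^sup>+x. truncate E n F x * K x \<partial>M)"
proof -
  have "(SUP n. \<integral>\<^sup>+x. truncate E n F x * K x \<partial>M) = (\<integral>\<^sup>+x. (SUP n. truncate E n F x * K x) \<partial>M)"
  proof (rule nn_integral_monotone_convergence_SUP[symmetric])
    show "incseq (\<lambda>n x. truncate E n F x * K x)"
      using incseq_truncate[OF E(1), of F] by (auto simp: incseq_def le_fun_def intro: mult_right_mono)
    show "(\<lambda>x. truncate E n F x * K x) \<in> borel_measurable M" for n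
      using measurable_truncate[of F M E n] E by measurable
  qed
  also have "\<dots> = (\<integral>\<^sup>+x. F x * K x \<partial>M)"
    by (intro nn_integral_cong) (simp add: SUP_mult_right_ennreal[symmetric] SUP_truncate E)
  finally show ?thesis by simp
qed

lemma nn_integral_truncate_finite:
  assumes "E n \<in> sets M" "emeasure M (E n) < \<infinity>"
  shows "(\<integral>\<^sup>+x. truncate E n F x \<partial>M) < \<infinity>"
proof -
  have "(\<integral>\<^sup>+x. truncate E n F x \<partial>M) \<le> (\<integral>\<^sup>+x. of_nat n * indicator (E n) x \<partial>M)"
    by (intro nn_integral_mono truncate_le_of_nat)
  also have "\<dots> = of_nat n * emeasure M (E n)"
    using assms by (simp add: nn_integral_cmult)
  also have "\<dots> < \<infinity>" using assms(2) by (simp add: ennreal_mult_less_top of_nat_less_top)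
  finally show ?thesis .
qed

lemma conj_exp_gt_1: "1 < r \<Longrightarrow> 1 < conj_exp r"
  by (simp add: conj_exp_def)

lemma conj_exp_inverse: "1 < r \<Longrightarrow> 1 / conj_exp r = 1 - 1 / r"
  by (simp add: conj_exp_def field_simps)

lemma Lp_norm_Hoelder:
  assumes "1 < r" and [measurable]: "F \<in> borel_measurable M" "K \<in> borel_measurable M"
  shows "(\<integral>\<^sup>+x. F x * K x \<partial>M) \<le> Lp_norm r M F * Lp_norm (conj_exp r) M K"
proof -
  have "F x * K x = (F x epowr r) epowr (1/r) * (K x epowr conj_exp r) epowr (1 - 1/r)" for x
    using assms(1) conj_exp_gt_1[of r] by (simp add: epowr_epowr flip: conj_exp_inverse)
  then show ?thesis
    using nn_integral_Hoelder[of "\<lambda>x. F x epowr r" M "\<lambda>x. K x epowr conj_exp r" "1/r"] assms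
    by (simp add: Lp_norm_def conj_exp_inverse)
qed

text \<open>The supremum over the dual ball is attained, in the limit, by the test functions
  \<open>k = G\<^bsup>1/r'\<^esup> / (\<integral> G)\<^bsup>1/r'\<^esup>\<close>, where \<open>G\<close> runs through integrable truncations of \<open>F\<^sup>r\<close>.\<close>
lemma (in sigma_finite_measure) Lp_norm_eq_dual_norm:
  assumes r: "1 < r" and [measurable]: "F \<in> borel_measurable M"
  shows "Lp_norm r M F = dual_norm M {k \<in> borel_measurable M. Lp_norm (conj_exp r) M k \<le> 1} F"
proof (rule antisym)
  let ?r' = "conj_exp r"
  let ?N = "dual_norm M {k \<in> borel_measurable M. Lp_norm ?r' M k \<le> 1} F"
  show "?N \<le> Lp_norm r M F"
    unfolding dual_norm_def
  proof (intro SUP_least)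
    fix k assume "k \<in> {k \<in> borel_measurable M. Lp_norm ?r' M k \<le> 1}"
    then have k: "k \<in> borel_measurable M" "Lp_norm ?r' M k \<le> 1" by auto
    have "(\<integral>\<^sup>+x. F x * k x \<partial>M) \<le> Lp_norm r M F * Lp_norm ?r' M k"
      using k by (intro Lp_norm_Hoelder r) auto
    also have "\<dots> \<le> Lp_norm r M F" using k(2) mult_left_mono[of _ 1 "Lp_norm r M F"] by simp
    finally show "(\<integral>\<^sup>+x. F x * k x \<partial>M) \<le> Lp_norm r M F" .
  qed
  obtain E where E: "incseq E" "\<And>n. E n \<in> sets M" "(\<Union>n. E n) = space M"
    "\<And>n. emeasure M (E n) < \<infinity>" using finite_exhaustion by blast
  define G where "G n = truncate E n (\<lambda>x. F x epowr r)" for n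
  have [measurable]: "G n \<in> borel_measurable M" for n
    unfolding G_def using E by (intro measurable_truncate) auto
  have r': "1 < ?r'" using r by (rule conj_exp_gt_1)
  have bound: "(\<integral>\<^sup>+x. G n x \<partial>M) epowr (1/r) \<le> ?N" for n
  proof (cases "(\<integral>\<^sup>+x. G n x \<partial>M) = 0")
    case True then show ?thesis using r by (simp add: epowr_zero_left)
  next
    case False
    define I where "I = (\<integral>\<^sup>+x. G n x \<partial>M)"
    have "I < \<infinity>" unfolding I_def G_def using E by (intro nn_integral_truncate_finite) auto
    with False have I: "0 < I" "I < \<infinity>" by (auto simp: I_def zero_less_iff_neq_zero)
    define k where "k x = G n x epowr (1/?r') * I epowr (- (1/?r'))" for x
    have [measurable]: "k \<in> borel_measurable M" unfolding k_def by measurable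
    have "(\<integral>\<^sup>+x. k x epowr ?r' \<partial>M) = (\<integral>\<^sup>+x. G n x * I epowr (-1) \<partial>M)"
      unfolding k_def using r' by (simp add: epowr_mult_distrib epowr_epowr)
    also have "\<dots> = I * I epowr (-1)" by (simp add: nn_integral_multc I_def)
    also have "\<dots> = 1" using epowr_add[OF I, of 1 "-1"] by simp
    finally have "Lp_norm ?r' M k \<le> 1" by (simp add: Lp_norm_def)
    then have "(\<integral>\<^sup>+x. F x * k x \<partial>M) \<le> ?N"
      unfolding dual_norm_def by (intro SUP_upper) auto
    moreover have "(\<integral>\<^sup>+x. G n x * I epowr (- (1/?r')) \<partial>M) \<le> (\<integral>\<^sup>+x. F x * k x \<partial>M)"
    proof (rule nn_integral_mono)
      fix x
      have "G n x = G n x epowr (1/r + 1/?r')" using r by (simp add: conj_exp_inverse)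
      also have "\<dots> = G n x epowr (1/r) * G n x epowr (1/?r')"
        using r r' by (intro epowr_add_same_sign) auto
      also have "G n x epowr (1/r) \<le> (F x epowr r) epowr (1/r)"
        using r truncate_le[of E n "\<lambda>x. F x epowr r" x] by (intro epowr_mono) (auto simp: G_def)
      also have "\<dots> = F x" using r by (simp add: epowr_epowr)
      finally show "G n x * I epowr (- (1/?r')) \<le> F x * k x"
        by (simp add: k_def mult_right_mono mult.assoc[symmetric])
    qed
    moreover have "(\<integral>\<^sup>+x. G n x * I epowr (- (1/?r')) \<partial>M) = I epowr (1/r)"
      using epowr_add[OF I, of 1 "- (1/?r')"] r
      by (simp add: nn_integral_multc I_def[symmetric] conj_exp_inverse)
    ultimately show ?thesis by (simp add: I_def)
  qed
  have "(\<integral>\<^sup>+x. F x epowr r \<partial>M) = (SUP n. \<integral>\<^sup>+x. G n x \<partial>M)"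
    using nn_integral_SUP_truncate[OF E(1-3), of "\<lambda>x. F x epowr r" "\<lambda>_. 1"] by (simp add: G_def)
  also have "\<dots> \<le> ?N epowr r"
  proof (rule SUP_least)
    fix n
    have "((\<integral>\<^sup>+x. G n x \<partial>M) epowr (1/r)) epowr r \<le> ?N epowr r"
      using r by (intro epowr_mono bound) auto
    then show "(\<integral>\<^sup>+x. G n x \<partial>M) \<le> ?N epowr r" using r by (simp add: epowr_epowr)
  qed
  finally have "(\<integral>\<^sup>+x. F x epowr r \<partial>M) epowr (1/r) \<le> (?N epowr r) epowr (1/r)"
    using r by (intro epowr_mono) auto
  then show "Lp_norm r M F \<le> ?N" using r by (simp add: epowr_epowr Lp_norm_def)
qed

section \<open>The Rubio de Francia algorithm and the gliding hump\<close>

lemma suminf_shift_le_ennreal: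
  fixes a :: "nat \<Rightarrow> ennreal"
  shows "(\<Sum>k. a (Suc k)) \<le> (\<Sum>k. a k)"
proof (rule suminf_le_const)
  fix n
  have "(\<Sum>k<n. a (Suc k)) \<le> (\<Sum>k<Suc n. a k)"
    by (simp only: sum.lessThan_Suc_shift le_add_same_cancel2 zero_le add_increasing order_refl)
  also have "\<dots> \<le> (\<Sum>k. a k)" by (rule sum_le_suminf) auto
  finally show "(\<Sum>k<n. a (Suc k)) \<le> (\<Sum>k. a k)" .
qed auto

lemma term_le_suminf_ennreal:
  fixes a :: "nat \<Rightarrow> ennreal"
  shows "a k \<le> (\<Sum>k. a k)"
  using sum_le_suminf[of a "{k}"] by simp

lemma avg_mono_AE:
  assumes "AE x in M. x \<in> B \<longrightarrow> F x \<le> G x"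
  shows "avg M B F \<le> avg M B G"
  unfolding avg_def using assms
  by (intro divide_right_mono_ennreal nn_integral_mono_AE) (auto simp: indicator_def elim: AE_mp)

lemma avg_cmult:
  assumes "F \<in> borel_measurable M" "B \<in> sets M"
  shows "avg M B (\<lambda>x. c * F x) = c * avg M B F"
  using assms unfolding avg_def
  by (simp add: nn_integral_cmult mult.assoc ennreal_times_divide)

lemma avg_suminf:
  assumes [measurable]: "\<And>i. F i \<in> borel_measurable M" "B \<in> sets M"
  shows "avg M B (\<lambda>x. \<Sum>i. F i x) = (\<Sum>i. avg M B (F i))"
  unfolding avg_def divide_ennreal_def
  by (simp add: nn_integral_suminf flip: ennreal_suminf_multc)

lemma avg_le_maximal: "B \<in> \<B> \<Longrightarrow> x \<in> B \<Longrightarrow> avg M B F \<le> maximal M \<B> F x"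
  unfolding maximal_def by (intro SUP_upper) auto

lemma maximal_mono_AE:
  assumes "AE x in M. F x \<le> G x"
  shows "maximal M \<B> F x \<le> maximal M \<B> G x"
  unfolding maximal_def by (intro SUP_mono) (use assms in \<open>auto intro!: avg_mono_AE\<close>)

lemma maximal_suminf_le:
  assumes "\<And>i. F i \<in> borel_measurable M" "\<And>B. B \<in> \<B> \<Longrightarrow> B \<in> sets M"
  shows "maximal M \<B> (\<lambda>x. \<Sum>i. c i * F i x) x \<le> (\<Sum>i. c i * maximal M \<B> (F i) x)"
  unfolding maximal_def[of _ _ "\<lambda>x. \<Sum>i. c i * F i x"]
proof (rule SUP_least)
  fix B assume B: "B \<in> {B \<in> \<B>. x \<in> B}"
  then have "avg M B (\<lambda>x. \<Sum>i. c i * F i x) = (\<Sum>i. c i * avg M B (F i))"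
    using assms by (simp add: avg_suminf avg_cmult)
  also have "\<dots> \<le> (\<Sum>i. c i * maximal M \<B> (F i) x)"
    using B by (intro suminf_le mult_left_mono avg_le_maximal) auto
  finally show "avg M B (\<lambda>x. \<Sum>i. c i * F i x) \<le> (\<Sum>i. c i * maximal M \<B> (F i) x)" .
qed

text \<open>The \<open>A\<^sub>1\<close> condition as a pointwise bound, the form that the Rubio de Francia series produces.\<close>
definition A1_weight :: "'a measure \<Rightarrow> 'a set set \<Rightarrow> ('a \<Rightarrow> ennreal) \<Rightarrow> bool" where
  "A1_weight M \<B> w \<longleftrightarrow>
    weight M w \<and> (\<exists>c<\<infinity>. AE x in M. maximal M \<B> w x \<le> c * w x)"

text \<open>The properties of a norm that the Rubio de Francia algorithm and the gliding hump use. The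
  functional acts on \<open>[0,\<infinity>]\<close>-valued functions, where series always converge; \<open>positive\<close> and
  \<open>finite_AE\<close> ensure that the functions constructed are weights.\<close>
locale gauge =
  fixes M :: "'a measure" and N :: "('a \<Rightarrow> ennreal) \<Rightarrow> ennreal"
  assumes mono: "\<And>F G. F \<in> borel_measurable M \<Longrightarrow> G \<in> borel_measurable M \<Longrightarrow>
      AE x in M. F x \<le> G x \<Longrightarrow> N F \<le> N G"
    and cmult: "\<And>F c. F \<in> borel_measurable M \<Longrightarrow> N (\<lambda>x. c * F x) \<le> c * N F"
    and suminf: "\<And>F :: nat \<Rightarrow> 'a \<Rightarrow> ennreal. (\<And>i. F i \<in> borel_measurable M) \<Longrightarrow>
      N (\<lambda>x. \<Sum>i. F i x) \<le> (\<Sum>i. N (F i))"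
    and finite_AE: "\<And>F. F \<in> borel_measurable M \<Longrightarrow> N F < \<infinity> \<Longrightarrow> AE x in M. F x < \<infinity>"
    and positive: "\<exists>h\<in>borel_measurable M. (AE x in M. 0 < h x) \<and> N h < \<infinity>"
begin

lemma N_zero: "N (\<lambda>x. 0) = 0"
  using cmult[of "\<lambda>x. 0" 0] by simp

lemma add:
  assumes [measurable]: "F \<in> borel_measurable M" "G \<in> borel_measurable M"
  shows "N (\<lambda>x. F x + G x) \<le> N F + N G"
proof -
  define S where "S i = (if i = 0 then F else if i = 1 then G else (\<lambda>x. 0))" for i :: nat
  have "(\<Sum>i. S i x) = F x + G x" for x
    by (subst suminf_finite[of "{0,1}"]) (auto simp: S_def)
  moreover have "(\<Sum>i. N (S i)) = N F + N G"
    by (subst suminf_finite[of "{0,1}"]) (auto simp: S_def N_zero)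
  moreover have "S i \<in> borel_measurable M" for i by (auto simp: S_def)
  ultimately show ?thesis using suminf[of S] by simp
qed

text \<open>Both series of this development are of this form: the Rubio de Francia series, whose terms may
  grow like \<open>K\<^sup>i\<close>, and, with \<open>K = 1\<close>, the gliding hump.\<close>
lemma superposition_finite:
  fixes K :: real
  assumes [measurable]: "\<And>i. F i \<in> borel_measurable M"
    and bound: "\<And>i::nat. N (F i) \<le> ennreal (K ^ i) * a" and "a < \<infinity>" "0 < K"
  shows "N (\<lambda>x. \<Sum>i. ennreal ((1 / (2 * K)) ^ i) * F i x) < \<infinity>"
proof -
  have "N (\<lambda>x. \<Sum>i. ennreal ((1 / (2 * K)) ^ i) * F i x)
      \<le> (\<Sum>i. N (\<lambda>x. ennreal ((1 / (2 * K)) ^ i) * F i x))"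
    by (intro suminf) measurable
  also have "\<dots> \<le> (\<Sum>i. ennreal ((1/2) ^ i) * a)"
  proof (intro suminf_le)
    fix i
    have "N (\<lambda>x. ennreal ((1 / (2 * K)) ^ i) * F i x) \<le> ennreal ((1 / (2 * K)) ^ i) * N (F i)"
      by (intro cmult) measurable
    also have "\<dots> \<le> ennreal ((1 / (2 * K)) ^ i) * (ennreal (K ^ i) * a)"
      by (intro mult_left_mono bound) auto
    also have "\<dots> = ennreal ((1/2) ^ i) * a"
      using \<open>0 < K\<close> by (simp add: mult.assoc[symmetric] power_divide power_mult_distrib flip: ennreal_mult)
    finally show "N (\<lambda>x. ennreal ((1 / (2 * K)) ^ i) * F i x) \<le> ennreal ((1/2) ^ i) * a" .
  qed auto
  also have "\<dots> = ennreal 2 * a"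
    by (subst ennreal_suminf_multc, subst suminf_ennreal2) (auto simp: suminf_geometric)
  also have "\<dots> < \<infinity>" using \<open>a < \<infinity>\<close> by (simp add: ennreal_mult_less_top)
  finally show ?thesis .
qed

text \<open>The Rubio de Francia algorithm: \<open>H = \<Sum>\<^sub>k (2K)\<^bsup>-k\<^esup> h\<^sub>k\<close>, where \<open>h\<^sub>0\<close> is \<open>h\<close> plus a positive
  function and \<open>h\<^sub>k\<^sub>+\<^sub>1\<close> is a measurable majorant of \<open>M(h\<^sub>k v) / v\<close>. The maximal operator moves each
  term of the series to a multiple of the next one, so that \<open>M(H v) \<le> 2 K H v\<close>. Enlarging \<open>K\<close> to at
  least \<open>1\<close> keeps the coefficients meaningful.\<close>
lemma rubio_de_francia:
  assumes \<B>: "\<And>B. B \<in> \<B> \<Longrightarrow> B \<in> sets M" and v: "weight M v"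
    and maj: "\<And>h. h \<in> borel_measurable M \<Longrightarrow> N h < \<infinity> \<Longrightarrow>
      \<exists>G\<in>borel_measurable M. N G \<le> ennreal K * N h \<and>
        (AE x in M. maximal M \<B> (\<lambda>y. h y * v y) x \<le> G x * v x)"
    and h: "h \<in> borel_measurable M" "N h < \<infinity>"
  obtains H where "H \<in> borel_measurable M" "N H < \<infinity>" "\<And>x. h x \<le> H x"
    "AE x in M. 0 < H x \<and> H x < \<infinity>" "A1_weight M \<B> (\<lambda>x. H x * v x)"
proof -
  define L where "L = max 1 K"
  have L: "0 < L" "K \<le> L" by (auto simp: L_def)
  have [measurable]: "v \<in> borel_measurable M" using v by (simp add: weight_def)
  obtain h0 where h0: "h0 \<in> borel_measurable M" "AE x in M. 0 < h0 x" "N h0 < \<infinity>"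
    using positive by auto
  define T where "T h = (SOME G. G \<in> borel_measurable M \<and> N G \<le> ennreal K * N h \<and>
      (AE x in M. maximal M \<B> (\<lambda>y. h y * v y) x \<le> G x * v x))" for h
  have T: "T h \<in> borel_measurable M \<and> N (T h) \<le> ennreal K * N h \<and>
      (AE x in M. maximal M \<B> (\<lambda>y. h y * v y) x \<le> T h x * v x)"
    if "h \<in> borel_measurable M" "N h < \<infinity>" for h
    using someI_ex[OF maj[OF that, unfolded Bex_def]] unfolding T_def by simp
  \<comment> \<open>\<open>h0\<close> makes the result positive a.e., as a weight has to be\<close>
  define h1 where "h1 x = h x + h0 x" for x
  have h1: "h1 \<in> borel_measurable M" "N h1 < \<infinity>"
    using h h0 add[of h h0] unfolding h1_def
    by (auto simp: ennreal_add_eq_top intro: le_less_trans)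
  define F where "F k = (T ^^ k) h1" for k
  have F: "F k \<in> borel_measurable M \<and> N (F k) \<le> ennreal (L ^ k) * N h1" for k
  proof (induction k)
    case 0 show ?case using h1 by (simp add: F_def)
  next
    case (Suc k)
    then have "N (F k) < \<infinity>" using h1(2)
      by (auto intro: le_less_trans simp: ennreal_mult_less_top)
    with Suc T have *: "F (Suc k) \<in> borel_measurable M" "N (F (Suc k)) \<le> ennreal K * N (F k)"
      by (auto simp: F_def)
    note *(2)
    also have "ennreal K * N (F k) \<le> ennreal L * (ennreal (L ^ k) * N h1)"
      using L Suc by (intro mult_mono ennreal_leI) auto
    also have "\<dots> = ennreal (L ^ Suc k) * N h1"
      using L by (simp add: mult.assoc[symmetric] flip: ennreal_mult)
    finally show ?case using *(1) by simp
  qed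
  have [measurable]: "F k \<in> borel_measurable M" for k using F by blast
  have F_finite: "N (F k) < \<infinity>" for k
    using F[of k] h1(2) by (auto intro: le_less_trans simp: ennreal_mult_less_top)
  define c where "c k = ennreal ((1 / (2 * L)) ^ k)" for k
  define H where "H x = (\<Sum>k. c k * F k x)" for x
  have H [measurable]: "H \<in> borel_measurable M" unfolding H_def by measurable
  have NH: "N H < \<infinity>"
    unfolding H_def c_def using F h1(2) L by (intro superposition_finite) auto
  have h1H: "h1 x \<le> H x" for x
    using term_le_suminf_ennreal[of "\<lambda>k. c k * F k x" 0] by (simp add: H_def c_def F_def)
  have hH: "h x \<le> H x" for x using h1H[of x] by (simp add: h1_def) (meson le_iff_add order_trans)
  have pos: "AE x in M. 0 < H x \<and> H x < \<infinity>"
    using finite_AE[OF H NH] h0(2)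
  proof eventually_elim
    case (elim x)
    then have "0 < h1 x" by (simp add: h1_def add_pos_nonneg zero_less_iff_neq_zero)
    then show ?case using elim h1H[of x] by (auto intro: less_le_trans)
  qed
  have "AE x in M. maximal M \<B> (\<lambda>y. F k y * v y) x \<le> F (Suc k) x * v x" for k
    using T[of "F k"] F F_finite by (simp add: F_def)
  then have "AE x in M. \<forall>k. maximal M \<B> (\<lambda>y. F k y * v y) x \<le> F (Suc k) x * v x"
    by (simp add: AE_all_countable)
  then have "AE x in M. maximal M \<B> (\<lambda>y. H y * v y) x \<le> ennreal (2 * L) * (H x * v x)"
  proof eventually_elim
    case (elim x)
    have "maximal M \<B> (\<lambda>y. H y * v y) x = maximal M \<B> (\<lambda>y. \<Sum>k. c k * (F k y * v y)) x"
      by (simp add: H_def mult.assoc[symmetric])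
    also have "\<dots> \<le> (\<Sum>k. c k * maximal M \<B> (\<lambda>y. F k y * v y) x)"
      using \<B> by (intro maximal_suminf_le) auto
    also have "\<dots> \<le> (\<Sum>k. c k * (F (Suc k) x * v x))"
      using elim by (intro suminf_le mult_left_mono) auto
    also have "\<dots> = (\<Sum>k. ennreal (2 * L) * v x * (c (Suc k) * F (Suc k) x))"
    proof (rule arg_cong[where f=suminf], rule ext)
      fix k
      have "c k = ennreal (2 * L) * c (Suc k)"
        using L by (simp add: c_def flip: ennreal_mult)
      then show "c k * (F (Suc k) x * v x) = ennreal (2 * L) * v x * (c (Suc k) * F (Suc k) x)"
        by (simp add: ac_simps)
    qed
    also have "\<dots> = ennreal (2 * L) * v x * (\<Sum>k. c (Suc k) * F (Suc k) x)" by simp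
    also have "\<dots> \<le> ennreal (2 * L) * v x * (\<Sum>k. c k * F k x)"
      by (intro mult_left_mono suminf_shift_le_ennreal) auto
    finally show ?case by (simp add: H_def ac_simps)
  qed
  moreover have "weight M (\<lambda>x. H x * v x)"
  proof -
    have "AE x in M. 0 < H x * v x \<and> H x * v x < \<infinity>"
      using pos v unfolding weight_def
      by (auto simp: ennreal_zero_less_mult_iff ennreal_mult_less_top elim!: AE_mp)
    then show ?thesis by (simp add: weight_def)
  qed
  ultimately have "A1_weight M \<B> (\<lambda>x. H x * v x)"
    unfolding A1_weight_def by (auto intro!: exI[of _ "ennreal (2 * L)"])
  then show ?thesis by (rule that[OF H NH hH pos])
qed

text \<open>If no constant works, choose \<open>i\<^sub>k\<close> for which the constant \<open>k D\<^sup>k\<close> fails and put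
  \<open>H = \<Sum>\<^sub>k 2\<^bsup>-k\<^esup> h\<^bsub>i\<^sub>k\<^esub>\<close>. Then \<open>h\<^bsub>i\<^sub>k\<^esub> \<le> 2\<^sup>k H\<close>, so that the bound available for this one \<open>H\<close> contradicts
  the choice of \<open>i\<^sub>k\<close> as soon as \<open>k\<close> exceeds \<open>C\<close>. An inequality homogeneous of degree
  \<open>d\<close> in \<open>h\<close> has \<open>D = 2\<^sup>d\<close>.\<close>
lemma gliding_hump:
  fixes h :: "'i \<Rightarrow> 'a \<Rightarrow> ennreal" and a b :: "'i \<Rightarrow> ennreal" and D :: ennreal
  assumes h: "\<And>i. i \<in> S \<Longrightarrow> h i \<in> borel_measurable M" "\<And>i. i \<in> S \<Longrightarrow> N (h i) \<le> 1"
    and D: "D < \<infinity>"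
    and bound: "\<And>H. H \<in> borel_measurable M \<Longrightarrow> N H < \<infinity> \<Longrightarrow>
      \<exists>C<\<infinity>. \<forall>i\<in>S. \<forall>k::nat. (\<forall>x. h i x \<le> ennreal (2 ^ k) * H x) \<longrightarrow> a i \<le> C * D ^ k * b i"
  shows "\<exists>C<\<infinity>. \<forall>i\<in>S. a i \<le> C * b i"
proof (rule ccontr)
  assume neg: "\<not> ?thesis"
  have "\<exists>i\<in>S. \<not> a i \<le> of_nat k * D ^ k * b i" for k :: nat
    using neg D by (metis ennreal_mult_less_top infinity_ennreal_def of_nat_less_top power_less_top_ennreal)
  then obtain s where s: "\<And>k. s k \<in> S" "\<And>k. \<not> a (s k) \<le> of_nat k * D ^ k * b (s k)" by metis
  define H where "H x = (\<Sum>k. ennreal ((1 / (2 * 1)) ^ k) * h (s k) x)" for x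
  have [measurable]: "h (s k) \<in> borel_measurable M" for k using h s by auto
  have H: "H \<in> borel_measurable M" unfolding H_def by measurable
  have "N H < \<infinity>" unfolding H_def
    by (rule superposition_finite[where a=1]) (use h s in auto)
  from bound[OF H this] obtain C where C: "C < \<infinity>"
    "\<And>i k. i \<in> S \<Longrightarrow> \<forall>x. h i x \<le> ennreal (2 ^ k) * H x \<Longrightarrow> a i \<le> C * D ^ k * b i" by blast
  obtain k where k: "C < of_nat k" using C(1) ennreal_Ex_less_of_nat by auto
  have "h (s k) x \<le> ennreal (2 ^ k) * H x" for x
  proof -
    have "h (s k) x = ennreal (2 ^ k) * (ennreal ((1 / (2 * 1)) ^ k) * h (s k) x)"
      by (simp add: mult.assoc[symmetric] power_divide flip: ennreal_mult)
    also have "\<dots> \<le> ennreal (2 ^ k) * H x"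
      unfolding H_def by (intro mult_left_mono term_le_suminf_ennreal) auto
    finally show ?thesis .
  qed
  then have "a (s k) \<le> C * D ^ k * b (s k)" using C(2) s by blast
  also have "\<dots> \<le> of_nat k * D ^ k * b (s k)" using k by (intro mult_right_mono) auto
  finally show False using s(2) by blast
qed

text \<open>Extrapolation tested against functions of the unit ball of \<open>N\<close>: for \<open>h \<le> H\<close> with \<open>H v \<in> A\<^sub>1\<close>,
  \<open>\<integral> f h v \<le> \<integral> f H v \<le> C \<integral> g H v \<le> C N'(g) N(H)\<close>. Here \<open>C\<close> depends on \<open>H\<close>, and the gliding hump
  removes the dependence. With \<open>N\<close> the dual norm of \<open>L\<^sup>s(w)\<close> this changes exponents, with \<open>N\<close> an
  associate norm it gives the function space inequality.\<close>
lemma A1_bound_imp_test_bound: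
  fixes P :: "(('a \<Rightarrow> ennreal) \<times> ('a \<Rightarrow> ennreal)) set" and N' :: "('a \<Rightarrow> ennreal) \<Rightarrow> ennreal"
  assumes \<B>: "\<And>B. B \<in> \<B> \<Longrightarrow> B \<in> sets M" and v: "weight M v"
    and maj: "\<And>h. h \<in> borel_measurable M \<Longrightarrow> N h < \<infinity> \<Longrightarrow>
      \<exists>G\<in>borel_measurable M. N G \<le> ennreal K * N h \<and>
        (AE x in M. maximal M \<B> (\<lambda>y. h y * v y) x \<le> G x * v x)"
    and P: "\<And>f g. (f, g) \<in> P \<Longrightarrow> f \<in> borel_measurable M"
    and A1: "\<And>w. A1_weight M \<B> w \<Longrightarrow>
      \<exists>C<\<infinity>. \<forall>(f,g)\<in>P. (\<integral>\<^sup>+x. f x * w x \<partial>M) \<le> C * (\<integral>\<^sup>+x. g x * w x \<partial>M)"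
    and dual: "\<And>f g H. (f, g) \<in> P \<Longrightarrow> H \<in> borel_measurable M \<Longrightarrow> N H < \<infinity> \<Longrightarrow>
      (\<integral>\<^sup>+x. g x * (H x * v x) \<partial>M) \<le> N' g * N H"
  shows "\<exists>C<\<infinity>. \<forall>(f,g)\<in>P. \<forall>h\<in>borel_measurable M.
    N h \<le> 1 \<longrightarrow> (\<integral>\<^sup>+x. f x * (h x * v x) \<partial>M) \<le> C * N' g"
proof -
  define S where "S = {(p, h). p \<in> P \<and> h \<in> borel_measurable M \<and> N h \<le> 1}"
  have [measurable]: "v \<in> borel_measurable M" using v by (simp add: weight_def)
  have "\<exists>C<\<infinity>. \<forall>i\<in>S. (case i of ((f, g), h) \<Rightarrow> \<integral>\<^sup>+x. f x * (h x * v x) \<partial>M)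
      \<le> C * (case i of ((f, g), h) \<Rightarrow> N' g)"
  proof (rule gliding_hump[where h=snd and D=2])
    fix H0 assume H0: "H0 \<in> borel_measurable M" "N H0 < \<infinity>"
    obtain H where H: "H \<in> borel_measurable M" "N H < \<infinity>" "\<And>x. H0 x \<le> H x"
      "AE x in M. 0 < H x \<and> H x < \<infinity>" "A1_weight M \<B> (\<lambda>x. H x * v x)"
      using rubio_de_francia[OF \<B> v maj H0] by blast
    note H(1)[measurable]
    obtain C where C: "C < \<infinity>" "\<And>f g. (f, g) \<in> P \<Longrightarrow>
      (\<integral>\<^sup>+x. f x * (H x * v x) \<partial>M) \<le> C * (\<integral>\<^sup>+x. g x * (H x * v x) \<partial>M)"
      using A1[OF H(5)] by blast
    have "(\<integral>\<^sup>+x. f x * (h x * v x) \<partial>M) \<le> (C * N H) * 2 ^ k * N' g"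
      if S: "((f, g), h) \<in> S" and le: "\<forall>x. h x \<le> ennreal (2 ^ k) * H0 x" for f g h and k :: nat
    proof -
      have fg: "(f, g) \<in> P" using S by (simp add: S_def)
      have [measurable]: "f \<in> borel_measurable M" using P fg by blast
      have "(\<integral>\<^sup>+x. f x * (h x * v x) \<partial>M) \<le> (\<integral>\<^sup>+x. 2 ^ k * (f x * (H x * v x)) \<partial>M)"
      proof (rule nn_integral_mono)
        fix x
        have "h x \<le> ennreal (2 ^ k) * H0 x" using le by blast
        also have "\<dots> \<le> ennreal (2 ^ k) * H x" by (intro mult_left_mono H) auto
        finally have "h x \<le> 2 ^ k * H x" by (simp flip: ennreal_power)
        then have "f x * (h x * v x) \<le> f x * (2 ^ k * H x * v x)"
          by (intro mult_left_mono mult_right_mono) auto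
        then show "f x * (h x * v x) \<le> 2 ^ k * (f x * (H x * v x))" by (simp add: ac_simps)
      qed
      also have "\<dots> = 2 ^ k * (\<integral>\<^sup>+x. f x * (H x * v x) \<partial>M)" by (simp add: nn_integral_cmult)
      also have "\<dots> \<le> 2 ^ k * (C * (N' g * N H))"
        by (intro mult_left_mono order_trans[OF C(2)[OF fg]] dual[OF fg H(1,2)]) auto
      finally show ?thesis by (simp add: ac_simps)
    qed
    moreover have "C * N H < \<infinity>" using C H by (simp add: ennreal_mult_less_top)
    ultimately show "\<exists>C<\<infinity>. \<forall>i\<in>S. \<forall>k::nat. (\<forall>x. snd i x \<le> ennreal (2 ^ k) * H0 x) \<longrightarrow>
      (case i of ((f, g), h) \<Rightarrow> \<integral>\<^sup>+x. f x * (h x * v x) \<partial>M)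
        \<le> C * 2 ^ k * (case i of ((f, g), h) \<Rightarrow> N' g)"
      by (intro exI[of _ "C * N H"]) auto
  qed (auto simp: S_def)
  then obtain C where "C < \<infinity>" "\<And>f g h. (f, g) \<in> P \<Longrightarrow> h \<in> borel_measurable M \<Longrightarrow> N h \<le> 1 \<Longrightarrow>
    (\<integral>\<^sup>+x. f x * (h x * v x) \<partial>M) \<le> C * N' g"
    unfolding S_def by fastforce
  then show ?thesis by (intro exI[of _ C]) auto
qed

end

section \<open>Weighted Lebesgue norms and the maximal operator\<close>

lemma gauge_dual_norm:
  assumes "sets \<nu> = sets M" and AE: "\<And>P. AE x in M. P x \<Longrightarrow> AE x in \<nu>. P x"
    and K: "\<And>k. k \<in> K \<Longrightarrow> k \<in> borel_measurable M"
    and "\<And>F. F \<in> borel_measurable M \<Longrightarrow> dual_norm \<nu> K F < \<infinity> \<Longrightarrow> AE x in M. F x < \<infinity>"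
    and "\<exists>h\<in>borel_measurable M. (AE x in M. 0 < h x) \<and> dual_norm \<nu> K h < \<infinity>"
  shows "gauge M (dual_norm \<nu> K)"
proof
  have [measurable_cong]: "sets \<nu> = sets M" by fact
  fix F G :: "'a \<Rightarrow> ennreal" and c
  assume [measurable]: "F \<in> borel_measurable M"
  show "dual_norm \<nu> K (\<lambda>x. c * F x) \<le> c * dual_norm \<nu> K F"
    unfolding dual_norm_def
  proof (rule SUP_least)
    fix k assume k: "k \<in> K"
    note K[OF k, measurable]
    have "(\<integral>\<^sup>+x. c * F x * k x \<partial>\<nu>) = c * (\<integral>\<^sup>+x. F x * k x \<partial>\<nu>)"
      by (simp add: nn_integral_cmult mult.assoc)
    also have "\<dots> \<le> c * (SUP k\<in>K. \<integral>\<^sup>+x. F x * k x \<partial>\<nu>)"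
      using k by (intro mult_left_mono SUP_upper) auto
    finally show "(\<integral>\<^sup>+x. c * F x * k x \<partial>\<nu>) \<le> c * (SUP k\<in>K. \<integral>\<^sup>+x. F x * k x \<partial>\<nu>)" .
  qed
  assume "AE x in M. F x \<le> G x"
  from AE[OF this] show "dual_norm \<nu> K F \<le> dual_norm \<nu> K G"
    unfolding dual_norm_def
    by (intro SUP_mono bexI nn_integral_mono_AE) (auto intro!: mult_right_mono elim: AE_mp)
next
  have [measurable_cong]: "sets \<nu> = sets M" by fact
  fix F :: "nat \<Rightarrow> 'a \<Rightarrow> ennreal" assume [measurable]: "\<And>i. F i \<in> borel_measurable M"
  show "dual_norm \<nu> K (\<lambda>x. \<Sum>i. F i x) \<le> (\<Sum>i. dual_norm \<nu> K (F i))"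
    unfolding dual_norm_def
  proof (rule SUP_least)
    fix k assume k: "k \<in> K"
    note K[OF k, measurable]
    have "(\<integral>\<^sup>+x. (\<Sum>i. F i x) * k x \<partial>\<nu>) = (\<integral>\<^sup>+x. (\<Sum>i. F i x * k x) \<partial>\<nu>)" by simp
    also have "\<dots> = (\<Sum>i. \<integral>\<^sup>+x. F i x * k x \<partial>\<nu>)" by (intro nn_integral_suminf) measurable
    also have "\<dots> \<le> (\<Sum>i. SUP k\<in>K. \<integral>\<^sup>+x. F i x * k x \<partial>\<nu>)"
      using k by (intro suminf_le SUP_upper) auto
    finally show "(\<integral>\<^sup>+x. (\<Sum>i. F i x) * k x \<partial>\<nu>) \<le> (\<Sum>i. SUP k\<in>K. \<integral>\<^sup>+x. F i x * k x \<partial>\<nu>)" .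
  qed
qed (use assms in auto)

lemma gauge_cong:
  assumes "gauge M N" and eq: "\<And>F. F \<in> borel_measurable M \<Longrightarrow> N' F = N F"
  shows "gauge M N'"
proof -
  interpret gauge M N by fact
  show ?thesis
  proof
    fix F :: "nat \<Rightarrow> 'a \<Rightarrow> ennreal" assume "\<And>i. F i \<in> borel_measurable M"
    then show "N' (\<lambda>x. \<Sum>i. F i x) \<le> (\<Sum>i. N' (F i))"
      using suminf[of F] by (simp add: eq)
  qed (use mono cmult finite_AE positive in \<open>auto simp: eq\<close>)
qed

lemma weightD:
  assumes "weight M w"
  shows "w \<in> borel_measurable M" "AE x in M. 0 < w x \<and> w x < \<infinity>"
  using assms by (auto simp: weight_def)

lemma AE_density_weight:
  assumes "weight M w"
  shows "(AE x in density M w. P x) \<longleftrightarrow> (AE x in M. P x)"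
proof -
  have "(AE x in density M w. P x) \<longleftrightarrow> (AE x in M. 0 < w x \<longrightarrow> P x)"
    using weightD[OF assms] by (intro AE_density)
  also have "\<dots> \<longleftrightarrow> (AE x in M. P x)"
    using weightD(2)[OF assms] by (auto elim: AE_mp)
  finally show ?thesis .
qed

lemma sigma_finite_density_weight:
  assumes "sigma_finite_measure M" "weight M w"
  shows "sigma_finite_measure (density M w)"
  using sigma_finite_measure.sigma_finite_iff_density_finite[OF assms(1)] weightD[OF assms(2)]
  by (auto elim: AE_mp)

lemma nn_integral_density_weight:
  assumes "weight M w" "F \<in> borel_measurable M"
  shows "(\<integral>\<^sup>+x. F x \<partial>density M w) = (\<integral>\<^sup>+x. F x * w x \<partial>M)"
  using weightD[OF assms(1)] assms(2) by (simp add: nn_integral_density mult.commute)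

lemma Lp_norm_density_weight:
  assumes "weight M w" "F \<in> borel_measurable M"
  shows "Lp_norm r (density M w) F = (\<integral>\<^sup>+x. F x epowr r * w x \<partial>M) epowr (1 / r)"
  unfolding Lp_norm_def using assms
  by (simp add: nn_integral_density_weight borel_measurable_epowr)

lemma Lp_norm_cong_AE:
  assumes "AE x in M. F x = G x"
  shows "Lp_norm r M F = Lp_norm r M G"
  unfolding Lp_norm_def using assms by (auto intro!: arg_cong2[where f=ennpowr] nn_integral_cong_AE elim: AE_mp)

text \<open>Countable subadditivity comes from duality; a positive function of finite norm exists because
  the weighted measure is \<open>\<sigma>\<close>-finite.\<close>
lemma gauge_Lp_norm:
  assumes "sigma_finite_measure M" "weight M w" "1 < r"
  shows "gauge M (Lp_norm r (density M w))"
proof (rule gauge_cong)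
  interpret D: sigma_finite_measure "density M w"
    using assms by (intro sigma_finite_density_weight)
  let ?K = "{k \<in> borel_measurable M. Lp_norm (conj_exp r) (density M w) k \<le> 1}"
  show eq: "Lp_norm r (density M w) F = dual_norm (density M w) ?K F"
    if "F \<in> borel_measurable M" for F
    using D.Lp_norm_eq_dual_norm[OF \<open>1 < r\<close>, of F] that by simp
  show "gauge M (dual_norm (density M w) ?K)"
  proof (rule gauge_dual_norm)
    fix F :: "'a \<Rightarrow> ennreal"
    assume F [measurable]: "F \<in> borel_measurable M" and "dual_norm (density M w) ?K F < \<infinity>"
    then have "Lp_norm r (density M w) F < \<infinity>" using eq[OF F] by simp
    then have "(\<integral>\<^sup>+x. F x epowr r \<partial>density M w) < \<infinity>"
      using \<open>1 < r\<close> epowr_less_top_iff[of "1/r"] by (simp add: Lp_norm_def)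
    then have "AE x in density M w. F x epowr r \<noteq> \<infinity>"
      by (intro nn_integral_PInf_AE) auto
    then show "AE x in M. F x < \<infinity>"
      unfolding AE_density_weight[OF assms(2)] using \<open>1 < r\<close>
      by (auto simp: epowr_eq_top_iff[simplified] less_top elim: AE_mp)
  next
    obtain h where [measurable]: "h \<in> borel_measurable M"
      and h: "\<And>x. x \<in> space M \<Longrightarrow> 0 < h x" "(\<integral>\<^sup>+x. h x \<partial>density M w) \<noteq> \<infinity>"
      using D.Ex_finite_integrable_function by auto
    have "Lp_norm r (density M w) (\<lambda>x. h x epowr (1/r)) < \<infinity>"
      using h(2) \<open>1 < r\<close> by (simp add: Lp_norm_def epowr_epowr epowr_less_top_iff[simplified] less_top)
    moreover have "AE x in M. 0 < h x epowr (1/r)"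
      using h(1) \<open>1 < r\<close> by (intro AE_I2) (simp add: zero_less_iff_neq_zero epowr_eq_0_iff)
    ultimately show "\<exists>h\<in>borel_measurable M. (AE x in M. 0 < h x) \<and> dual_norm (density M w) ?K h < \<infinity>"
      by (intro bexI[of _ "\<lambda>x. h x epowr (1/r)"]) (auto simp: eq)
  qed (auto simp: AE_density_weight[OF assms(2)])
qed

text \<open>The infimum in the outer norm need not be attained; the summand \<open>1\<close> leaves the room to choose
  a measurable majorant.\<close>
lemma outer_norm_majorant:
  assumes "outer_norm M \<rho> F \<le> ennreal C * a" "0 < a" "a < \<infinity>"
  obtains G where "G \<in> borel_measurable M" "AE x in M. F x \<le> G x"
    "\<rho> G \<le> ennreal (max 0 C + 1) * a"
proof -
  have "ennreal C * a < ennreal (max 0 C + 1) * a"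
    using assms(2,3)
    by (intro ennreal_mult_strict_right_mono) (auto simp: ennreal_less_iff max_def ennreal_neg)
  with assms(1) have "outer_norm M \<rho> F < ennreal (max 0 C + 1) * a" by simp
  then show ?thesis using that unfolding outer_norm_def INF_less_iff by (auto intro: less_imp_le)
qed

lemma maximal_AE_zero:
  assumes "AE x in M. F x = 0"
  shows "maximal M \<B> F x = 0"
proof -
  have "maximal M \<B> F x \<le> maximal M \<B> (\<lambda>x. 0) x"
    using assms by (intro maximal_mono_AE) auto
  also have "\<dots> = 0" by (auto simp: maximal_def avg_def bot_ennreal SUP_constant)
  finally show ?thesis by simp
qed

text \<open>If the norm of \<open>h\<close> is \<open>0\<close> there is no room for an almost optimal majorant, but then \<open>h = 0\<close>
  a.e. and the maximal function vanishes identically.\<close>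
lemma muckenhoupt_majorant:
  assumes sf: "sigma_finite_measure M" and mb: "muckenhoupt_basis M \<B>"
    and r: "1 < r" and w: "w \<in> A_class M \<B> r"
  obtains K where "\<And>h. h \<in> borel_measurable M \<Longrightarrow> Lp_norm r (density M w) h < \<infinity> \<Longrightarrow>
    \<exists>G\<in>borel_measurable M. Lp_norm r (density M w) G \<le> ennreal K * Lp_norm r (density M w) h \<and>
      (AE x in M. maximal M \<B> h x \<le> G x)"
proof -
  let ?L = "Lp_norm r (density M w)"
  have ww: "weight M w" using w by (simp add: A_class_def)
  interpret gauge M ?L by (rule gauge_Lp_norm[OF sf ww r])
  obtain C :: real where C: "\<And>f :: 'a \<Rightarrow> real. f \<in> borel_measurable M \<Longrightarrow>
      outer_norm M ?L (maximal M \<B> (\<lambda>x. ennreal \<bar>f x\<bar>)) \<le> ennreal C * ?L (\<lambda>x. ennreal \<bar>f x\<bar>)"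
    using mb r w unfolding muckenhoupt_basis_def by blast
  have "\<exists>G\<in>borel_measurable M. ?L G \<le> ennreal (max 0 C + 1) * ?L h \<and>
      (AE x in M. maximal M \<B> h x \<le> G x)"
    if h [measurable]: "h \<in> borel_measurable M" and fin: "?L h < \<infinity>" for h
  proof (cases "?L h = 0")
    case True
    then have "(\<integral>\<^sup>+x. h x epowr r \<partial>density M w) = 0"
      using r by (simp add: Lp_norm_def epowr_eq_0_iff)
    then have "AE x in density M w. h x epowr r = 0"
      by (subst (asm) nn_integral_0_iff_AE) auto
    then have "AE x in M. h x = 0"
      unfolding AE_density_weight[OF ww] using r by (auto simp: epowr_eq_0_iff elim: AE_mp)
    then show ?thesis
      by (intro bexI[of _ "\<lambda>x. 0"]) (auto simp: maximal_AE_zero N_zero)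
  next
    case False
    define f where "f x = enn2real (h x)" for x
    have [measurable]: "f \<in> borel_measurable M" unfolding f_def by measurable
    have fh: "AE x in M. ennreal \<bar>f x\<bar> = h x"
      using finite_AE[OF h fin] by (auto simp: f_def elim: AE_mp)
    then have "?L (\<lambda>x. ennreal \<bar>f x\<bar>) = ?L h"
      by (intro Lp_norm_cong_AE) (simp add: AE_density_weight[OF ww])
    with C[of f] False fin obtain G where G: "G \<in> borel_measurable M"
      "AE x in M. maximal M \<B> (\<lambda>x. ennreal \<bar>f x\<bar>) x \<le> G x" "?L G \<le> ennreal (max 0 C + 1) * ?L h"
      using outer_norm_majorant[of M ?L "maximal M \<B> (\<lambda>x. ennreal \<bar>f x\<bar>)" C "?L h"]
      by (auto simp: zero_less_iff_neq_zero)
    have "maximal M \<B> h x \<le> maximal M \<B> (\<lambda>x. ennreal \<bar>f x\<bar>) x" for x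
      using fh by (intro maximal_mono_AE) (auto elim: AE_mp)
    then have "AE x in M. maximal M \<B> h x \<le> G x"
      using G(2) by (auto elim!: eventually_mono intro: order_trans)
    with G(1,3) show ?thesis by blast
  qed
  then show ?thesis by (rule that)
qed

section \<open>Muckenhoupt classes\<close>

text \<open>This uses \<open>1 - q' = - 1 / (q - 1)\<close>.\<close>
lemma A_class_iff:
  assumes "1 < q"
  shows "w \<in> A_class M \<B> q \<longleftrightarrow> weight M w \<and> (\<exists>c<\<infinity>. \<forall>B\<in>\<B>.
    avg M B w * avg M B (\<lambda>x. w x epowr (- (1 / (q - 1)))) epowr (q - 1) \<le> c)"
proof -
  have e: "1 - conj_exp q = - (1 / (q - 1))" using assms by (simp add: conj_exp_def field_simps)
  have "A_const M \<B> q w < \<infinity> \<longleftrightarrow> (\<exists>c<\<infinity>. \<forall>B\<in>\<B>.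
    avg M B w * avg M B (\<lambda>x. w x epowr (- (1 / (q - 1)))) epowr (q - 1) \<le> c)" (is "_ \<longleftrightarrow> (\<exists>c<\<infinity>. \<forall>B\<in>\<B>. ?a B \<le> c)")
  proof -
    have "A_const M \<B> q w = (SUP B\<in>\<B>. ?a B)" using assms by (simp add: A_const_def e)
    moreover have "(SUP B\<in>\<B>. ?a B) < \<infinity> \<longleftrightarrow> (\<exists>c<\<infinity>. (SUP B\<in>\<B>. ?a B) \<le> c)"
      by (auto intro: le_less_trans)
    ultimately show ?thesis by (simp only: SUP_le_iff)
  qed
  then show ?thesis by (simp add: A_class_def)
qed

lemma mbasisD:
  assumes "mbasis M \<B>" "B \<in> \<B>"
  shows "B \<in> sets M" "0 < emeasure M B" "emeasure M B < \<infinity>"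
  using assms by (auto simp: mbasis_def)

lemma muckenhoupt_mbasis: "muckenhoupt_basis M \<B> \<Longrightarrow> mbasis M \<B>"
  by (simp add: muckenhoupt_basis_def)

text \<open>An average is an integral for a normalized measure, so that integral inequalities apply to it.\<close>
lemma avg_eq_nn_integral:
  assumes [measurable]: "B \<in> sets M" "F \<in> borel_measurable M"
  shows "avg M B F = (\<integral>\<^sup>+x. F x \<partial>density M (\<lambda>x. indicator B x / emeasure M B))"
proof -
  have "avg M B F = (\<integral>\<^sup>+x. F x * indicator B x / emeasure M B \<partial>M)"
    unfolding avg_def by (intro nn_integral_divide[symmetric]) measurable
  also have "\<dots> = (\<integral>\<^sup>+x. indicator B x / emeasure M B * F x \<partial>M)"
    by (intro nn_integral_cong) (simp add: divide_ennreal_def ac_simps)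
  finally show ?thesis by (simp add: nn_integral_density)
qed

lemma avg_Hoelder:
  assumes "B \<in> sets M" and [measurable]: "F \<in> borel_measurable M" "G \<in> borel_measurable M"
    and "0 < \<theta>" "\<theta> < 1"
  shows "avg M B (\<lambda>x. F x epowr \<theta> * G x epowr (1 - \<theta>)) \<le> avg M B F epowr \<theta> * avg M B G epowr (1 - \<theta>)"
  using assms by (simp add: avg_eq_nn_integral nn_integral_Hoelder)

lemma avg_const:
  assumes "mbasis M \<B>" "B \<in> \<B>"
  shows "avg M B (\<lambda>x. c) = c"
  using mbasisD[OF assms] by (simp add: avg_def nn_integral_cmult ennreal_mult_divide_eq)

lemma weight_epowr: "weight M w \<Longrightarrow> weight M (\<lambda>x. w x epowr a)"
  unfolding weight_def using epowr_pos_finite by (auto elim!: AE_mp)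

lemma weight_mult: "weight M w \<Longrightarrow> weight M w' \<Longrightarrow> weight M (\<lambda>x. w x * w' x)"
  unfolding weight_def by (auto simp: ennreal_zero_less_mult_iff ennreal_mult_less_top elim!: AE_mp)

lemma A1_weight_avg_le:
  assumes "A1_weight M \<B> w"
  obtains c where "c < \<infinity>" "\<And>B. B \<in> \<B> \<Longrightarrow> AE x in M. x \<in> B \<longrightarrow> avg M B w \<le> c * w x"
proof -
  obtain c where c: "c < \<infinity>" "AE x in M. maximal M \<B> w x \<le> c * w x"
    using assms by (auto simp: A1_weight_def)
  have "AE x in M. x \<in> B \<longrightarrow> avg M B w \<le> c * w x" if "B \<in> \<B>" for B
    using c(2) by eventually_elim (auto intro: order_trans[OF avg_le_maximal[OF that]])
  with c(1) show ?thesis by (rule that)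
qed

lemma A1_weight_const:
  assumes "mbasis M \<B>"
  shows "A1_weight M \<B> (\<lambda>x. 1)"
proof -
  have "maximal M \<B> (\<lambda>x. 1) x \<le> 1 * 1" for x
    unfolding maximal_def by (intro SUP_least) (simp add: avg_const[OF assms])
  then show ?thesis unfolding A1_weight_def weight_def by (auto intro!: exI[of _ 1])
qed

text \<open>On \<open>B\<close> the bound \<open>avg H \<le> c H\<close> gives \<open>(avg H)\<^sup>t H\<^bsup>-t\<^esup> \<le> c\<^sup>t\<close>, hence
  \<open>(avg H)\<^sup>t avg (w H\<^bsup>-t\<^esup>) \<le> c\<^sup>t avg w\<close>. The dual factor, with exponent \<open>- 1 / (q + t - 1)\<close>, splits by
  Hoelder's inequality into \<open>(avg w\<^bsup>-1/(q-1)\<^esup>)\<^bsup>q-1\<^esup> (avg H)\<^sup>t\<close>, and the powers of \<open>avg H\<close> match.\<close>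
lemma A_class_mult_A1_weight:
  assumes mb: "mbasis M \<B>" and q: "1 < q" "0 < t"
    and w: "w \<in> A_class M \<B> q" and H: "A1_weight M \<B> H"
  shows "(\<lambda>x. w x * H x epowr (- t)) \<in> A_class M \<B> (q + t)"
proof -
  let ?s = "q + t - 1"
  let ?W = "\<lambda>x. w x * H x epowr (- t)"
  have weights: "weight M w" "weight M H" using w H by (auto simp: A_class_def A1_weight_def)
  note weightD(1)[OF weights(1), measurable] weightD(1)[OF weights(2), measurable]
  obtain c where c: "c < \<infinity>" "\<And>B. B \<in> \<B> \<Longrightarrow> AE x in M. x \<in> B \<longrightarrow> avg M B H \<le> c * H x"
    using A1_weight_avg_le[OF H] by blast
  obtain d where d: "d < \<infinity>" "\<And>B. B \<in> \<B> \<Longrightarrow>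
      avg M B w * avg M B (\<lambda>x. w x epowr (- (1 / (q - 1)))) epowr (q - 1) \<le> d"
    using w q by (auto simp: A_class_iff)
  have "avg M B ?W * avg M B (\<lambda>x. ?W x epowr (- (1 / ?s))) epowr ?s \<le> c epowr t * d"
    if B: "B \<in> \<B>" for B
  proof -
    let ?\<sigma> = "\<lambda>x. w x epowr (- (1 / (q - 1)))"
    let ?\<theta> = "(q - 1) / ?s"
    have th: "0 < ?\<theta>" "?\<theta> < 1" "1 - ?\<theta> = t / ?s" using q by (auto simp: field_simps)
    note mbasisD(1)[OF mb B, measurable]
    have first: "avg M B H epowr t * avg M B ?W \<le> c epowr t * avg M B w"
    proof -
      have "avg M B (\<lambda>x. avg M B H epowr t * ?W x) \<le> avg M B (\<lambda>x. c epowr t * w x)"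
      proof (rule avg_mono_AE)
        show "AE x in M. x \<in> B \<longrightarrow> avg M B H epowr t * ?W x \<le> c epowr t * w x"
          using c(2)[OF B] weightD(2)[OF weights(2)]
        proof eventually_elim
          case (elim x)
          show ?case
          proof
            assume "x \<in> B"
            then have "avg M B H epowr t \<le> (c * H x) epowr t"
              using elim q by (intro epowr_mono) auto
            also have "\<dots> = c epowr t * H x epowr t" using q by (simp add: epowr_mult_distrib)
            finally have "avg M B H epowr t * ?W x \<le> c epowr t * H x epowr t * ?W x"
              by (rule mult_right_mono) simp
            also have "\<dots> = c epowr t * w x * (H x epowr t * H x epowr (- t))" by (simp add: ac_simps)
            also have "H x epowr t * H x epowr (- t) = 1"
              using elim epowr_add[of "H x" t "- t"] by simp
            finally show "avg M B H epowr t * ?W x \<le> c epowr t * w x" by simp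
          qed
        qed
      qed
      then show ?thesis by (simp add: avg_cmult)
    qed
    have "avg M B (\<lambda>x. ?W x epowr (- (1 / ?s))) \<le> avg M B (\<lambda>x. ?\<sigma> x epowr ?\<theta> * H x epowr (1 - ?\<theta>))"
    proof (rule avg_mono_AE)
      show "AE x in M. x \<in> B \<longrightarrow> ?W x epowr (- (1 / ?s)) \<le> ?\<sigma> x epowr ?\<theta> * H x epowr (1 - ?\<theta>)"
        using weightD(2)[OF weights(1)] weightD(2)[OF weights(2)]
      proof eventually_elim
        case (elim x)
        have "?W x epowr (- (1 / ?s)) = w x epowr (- (1 / ?s)) * H x epowr (t / ?s)"
          using elim epowr_pos_finite[of "H x" "- t"]
          by (subst epowr_mult_distrib_pos_finite) (auto simp: epowr_epowr)
        also have "w x epowr (- (1 / ?s)) = ?\<sigma> x epowr ?\<theta>" using q by (simp add: epowr_epowr)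
        finally show ?case using th by simp
      qed
    qed
    also have "\<dots> \<le> avg M B ?\<sigma> epowr ?\<theta> * avg M B H epowr (1 - ?\<theta>)"
      using th by (intro avg_Hoelder) auto
    finally have "avg M B (\<lambda>x. ?W x epowr (- (1 / ?s))) epowr ?s
      \<le> (avg M B ?\<sigma> epowr ?\<theta> * avg M B H epowr (1 - ?\<theta>)) epowr ?s"
      using q by (intro epowr_mono) auto
    also have "\<dots> = avg M B ?\<sigma> epowr (q - 1) * avg M B H epowr t"
      using q th by (simp add: epowr_mult_distrib epowr_epowr)
    finally have "avg M B ?W * avg M B (\<lambda>x. ?W x epowr (- (1 / ?s))) epowr ?s
      \<le> avg M B ?W * (avg M B ?\<sigma> epowr (q - 1) * avg M B H epowr t)"
      by (rule mult_left_mono) simp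
    also have "\<dots> = (avg M B H epowr t * avg M B ?W) * avg M B ?\<sigma> epowr (q - 1)" by (simp add: ac_simps)
    also have "\<dots> \<le> (c epowr t * avg M B w) * avg M B ?\<sigma> epowr (q - 1)"
      by (intro mult_right_mono first) auto
    also have "\<dots> \<le> c epowr t * d" using d(2)[OF B] by (simp add: mult.assoc mult_left_mono)
    finally show ?thesis .
  qed
  moreover have "c epowr t * d < \<infinity>"
    using c(1) d(1) q by (simp add: ennreal_mult_less_top epowr_less_top_iff[simplified])
  moreover have "weight M ?W" using weights by (intro weight_mult weight_epowr)
  ultimately show ?thesis using q by (subst A_class_iff) (auto intro!: exI[of _ "c epowr t * d"])
qed

text \<open>The case \<open>H = 1\<close> of the product rule.\<close>
lemma A_class_mono:
  assumes "mbasis M \<B>" "1 < q" "q < r" "w \<in> A_class M \<B> q"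
  shows "w \<in> A_class M \<B> r"
  using A_class_mult_A1_weight[OF assms(1,2) _ assms(4) A1_weight_const[OF assms(1)], of "r - q"] assms
  by simp

lemma A1_weight_A_class_2:
  assumes mb: "mbasis M \<B>" and w: "A1_weight M \<B> w"
  shows "w \<in> A_class M \<B> 2"
proof -
  have ww: "weight M w" using w by (simp add: A1_weight_def)
  note weightD(1)[OF ww, measurable]
  obtain c where c: "c < \<infinity>" "\<And>B. B \<in> \<B> \<Longrightarrow> AE x in M. x \<in> B \<longrightarrow> avg M B w \<le> c * w x"
    using A1_weight_avg_le[OF w] by blast
  have "avg M B w * avg M B (\<lambda>x. w x epowr (- 1)) \<le> c" if B: "B \<in> \<B>" for B
  proof -
    have "avg M B w * avg M B (\<lambda>x. w x epowr (- 1)) = avg M B (\<lambda>x. avg M B w * w x epowr (- 1))"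
      using mbasisD(1)[OF mb B] by (simp add: avg_cmult)
    also have "\<dots> \<le> avg M B (\<lambda>x. c)"
    proof (rule avg_mono_AE)
      show "AE x in M. x \<in> B \<longrightarrow> avg M B w * w x epowr (- 1) \<le> c"
        using c(2)[OF B] weightD(2)[OF ww]
      proof eventually_elim
        case (elim x)
        have "c * w x * w x epowr (- 1) = c"
          using elim epowr_add[of "w x" 1 "- 1"] by (simp add: mult.assoc)
        then show ?case using elim mult_right_mono[of "avg M B w" "c * w x" "w x epowr (- 1)"] by auto
      qed
    qed
    also have "\<dots> = c" using mb B by (rule avg_const)
    finally show ?thesis .
  qed
  then show ?thesis using c(1) ww by (subst A_class_iff) (auto intro!: exI[of _ c])
qed

lemma A_class_dual:
  assumes q: "1 < q" and w: "w \<in> A_class M \<B> q"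
  shows "(\<lambda>x. w x epowr (1 - conj_exp q)) \<in> A_class M \<B> (conj_exp q)"
proof -
  have e: "1 - conj_exp q = - (1 / (q - 1))" "conj_exp q - 1 = 1 / (q - 1)"
    "(1 - q) / (q - 1) = - 1"
    using q by (auto simp: conj_exp_def field_simps)
  obtain d where d: "d < \<infinity>" "\<And>B. B \<in> \<B> \<Longrightarrow>
      avg M B w * avg M B (\<lambda>x. w x epowr (- (1 / (q - 1)))) epowr (q - 1) \<le> d"
    and ww: "weight M w"
    using w q by (auto simp: A_class_iff)
  have "avg M B (\<lambda>x. w x epowr (- (1 / (q - 1)))) * avg M B w epowr (1 / (q - 1)) \<le> d epowr (1 / (q - 1))"
    if B: "B \<in> \<B>" for B
    using epowr_mono[OF _ d(2)[OF B], of "1 / (q - 1)"] q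
    by (simp add: epowr_mult_distrib epowr_epowr mult.commute)
  moreover have "d epowr (1 / (q - 1)) < \<infinity>" using d(1) q by (simp add: epowr_less_top_iff[simplified])
  ultimately show ?thesis
    using q weight_epowr[OF ww] conj_exp_gt_1[OF q]
    by (subst A_class_iff) (auto simp: e epowr_epowr)
qed

section \<open>Extrapolation between exponents\<close>

text \<open>The constant may depend on the weight in any way. This form is stable under the change of
  exponents and under \<open>\<ell>\<^sup>q\<close> sums of pairs.\<close>
definition weighted_bound ::
    "'a measure \<Rightarrow> 'a set set \<Rightarrow> (('a \<Rightarrow> ennreal) \<times> ('a \<Rightarrow> ennreal)) set \<Rightarrow> real \<Rightarrow> bool" where
  "weighted_bound M \<B> \<F> p \<longleftrightarrow> (\<forall>q>1. \<forall>w\<in>A_class M \<B> q. \<exists>C<\<infinity>. \<forall>(f, g)\<in>\<F>.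
    (\<integral>\<^sup>+x. f x epowr p * w x \<partial>M) \<le> C * (\<integral>\<^sup>+x. g x epowr p * w x \<partial>M))"

lemma weighted_boundD:
  assumes "weighted_bound M \<B> \<F> p" "1 < q" "w \<in> A_class M \<B> q"
  obtains C where "C < \<infinity>" "\<And>f g. (f, g) \<in> \<F> \<Longrightarrow>
    (\<integral>\<^sup>+x. f x epowr p * w x \<partial>M) \<le> C * (\<integral>\<^sup>+x. g x epowr p * w x \<partial>M)"
  using assms unfolding weighted_bound_def by blast

lemma nn_integral_epowr_weight_eq_0:
  assumes w: "weight M w" and [measurable]: "f \<in> borel_measurable M" and "0 < p"
  shows "(\<integral>\<^sup>+x. f x epowr p * w x \<partial>M) = 0 \<longleftrightarrow> (AE x in M. f x = 0)"
proof -
  note weightD(1)[OF w, measurable]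
  have "(\<integral>\<^sup>+x. f x epowr p * w x \<partial>M) = 0 \<longleftrightarrow> (AE x in M. f x epowr p * w x = 0)"
    by (subst nn_integral_0_iff_AE) auto
  also have "\<dots> \<longleftrightarrow> (AE x in M. f x = 0)"
    using weightD(2)[OF w] \<open>0 < p\<close>
    by (intro eventually_subst) (auto simp: epowr_eq_0_iff elim!: eventually_mono)
  finally show ?thesis .
qed

text \<open>Put \<open>\<theta> = p / p\<^sub>0\<close> and \<open>t = q (p\<^sub>0 - p) / p\<close>, so that \<open>q / \<theta> - t = q\<close>. For \<open>H\<close> with finite norm in
  \<open>L\<^sup>q(w)\<close> and \<open>H \<in> A\<^sub>1\<close> the weight \<open>V = w H\<^bsup>-t\<^esup>\<close> belongs to \<open>A\<^bsub>q+t\<^esub>\<close>, and Hoelder's inequality gives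
  \<open>\<integral> f\<^sup>p w \<le> (\<integral> f\<^bsup>p\<^sub>0\<^esup> V)\<^bsup>\<theta>\<^esup> (\<integral> H\<^sup>q w)\<^bsup>1-\<theta>\<^esup>\<close>. The known inequality replaces \<open>f\<close> by \<open>g\<close> in the first factor,
  and if \<open>g\<^bsup>p/q\<^esup> \<le> A H\<close> then \<open>g\<^bsup>p\<^sub>0\<^esup> V \<le> A\<^bsup>q/\<theta>\<^esup> H\<^sup>q w\<close>. Applied to \<open>g\<^bsup>p/q\<^esup>\<close> normalized in \<open>L\<^sup>q(w)\<close> this is a
  bound of the kind required by the gliding hump, with homogeneity \<open>q\<close>. Working with \<open>g\<close> alone
  avoids any a priori finiteness of \<open>\<integral> f\<^sup>p w\<close>.\<close>
lemma weighted_bound_decrease: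
  assumes sf: "sigma_finite_measure M" and mb: "muckenhoupt_basis M \<B>"
    and \<F>: "extrapolation_family M \<F>" and p: "0 < p" "p < p0" and wb: "weighted_bound M \<B> \<F> p0"
  shows "weighted_bound M \<B> \<F> p"
  unfolding weighted_bound_def
proof (intro allI impI ballI)
  fix q w assume q: "1 < (q::real)" and w: "w \<in> A_class M \<B> q"
  note basis = muckenhoupt_mbasis[OF mb]
  have ww: "weight M w" using w by (simp add: A_class_def)
  note wm = weightD(1)[OF ww, measurable]
  let ?L = "Lp_norm q (density M w)"
  interpret gauge M ?L by (rule gauge_Lp_norm[OF sf ww q])
  obtain K where maj: "\<And>h. h \<in> borel_measurable M \<Longrightarrow> ?L h < \<infinity> \<Longrightarrow>
    \<exists>G\<in>borel_measurable M. ?L G \<le> ennreal K * ?L h \<and> (AE x in M. maximal M \<B> h x \<le> G x)"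
    using muckenhoupt_majorant[OF sf mb q w] by blast
  have L: "?L h = (\<integral>\<^sup>+x. h x epowr q * w x \<partial>M) epowr (1/q)" if "h \<in> borel_measurable M" for h
    by (rule Lp_norm_density_weight[OF ww that])
  define c where "c g = (\<integral>\<^sup>+x. g x epowr p * w x \<partial>M)" for g :: "'a \<Rightarrow> ennreal"
  \<comment> \<open>the pairs for which \<open>g\<^bsup>p/q\<^esup>\<close> can be normalized; the others are trivial\<close>
  define S where "S = {(f, g) \<in> \<F>. 0 < c g \<and> c g < \<infinity>}"
  define h where "h i x = snd i x epowr (p/q) * c (snd i) epowr (- (1/q))"
    for i :: "('a \<Rightarrow> ennreal) \<times> ('a \<Rightarrow> ennreal)" and x
  define t where "t = q * (p0 - p) / p"
  define \<theta> where "\<theta> = p / p0"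
  have t: "0 < t" "q / \<theta> - t = q" using p q by (auto simp: t_def \<theta>_def field_simps)
  have \<theta>: "0 < \<theta>" "\<theta> < 1" using p by (auto simp: \<theta>_def)
  have \<theta>t: "t * \<theta> = q * (1 - \<theta>)" using p by (auto simp: \<theta>_def t_def field_simps)
  have "\<exists>C<\<infinity>. \<forall>i\<in>S. c (fst i) \<le> C * c (snd i)"
  proof (rule gliding_hump[where h=h and D="2 epowr q"])
    show "2 epowr q < \<infinity>" using epowr_ennreal[of 2 q] by simp
  next
    fix i assume i: "i \<in> S"
    then have [measurable]: "snd i \<in> borel_measurable M"
      using \<F> by (auto simp: S_def extrapolation_family_def)
    show hm: "h i \<in> borel_measurable M" unfolding h_def by measurable
    have ci: "0 < c (snd i)" "c (snd i) < \<infinity>" using i by (auto simp: S_def)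
    have "(\<integral>\<^sup>+x. h i x epowr q * w x \<partial>M)
      = (\<integral>\<^sup>+x. snd i x epowr p * w x * c (snd i) epowr (- 1) \<partial>M)"
      using q unfolding h_def by (simp add: epowr_mult_distrib epowr_epowr ac_simps)
    also have "\<dots> = c (snd i) * c (snd i) epowr (- 1)"
      unfolding c_def by (intro nn_integral_multc) measurable
    also have "\<dots> = 1" using epowr_add[OF ci, of 1 "- 1"] by simp
    finally show "?L (h i) \<le> 1" using L[OF hm] by simp
  next
    fix H0 assume H0: "H0 \<in> borel_measurable M" "?L H0 < \<infinity>"
    obtain H where H: "H \<in> borel_measurable M" "?L H < \<infinity>" "\<And>x. H0 x \<le> H x"
      "AE x in M. 0 < H x \<and> H x < \<infinity>" "A1_weight M \<B> (\<lambda>x. H x * 1)"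
      by (rule rubio_de_francia[where v="\<lambda>x. 1" and K=K, OF mbasisD(1)[OF basis] _ _ H0])
        (use maj in \<open>auto simp: weight_def\<close>)
    note H(1)[measurable]
    define V where "V x = w x * H x epowr (- t)" for x
    have V: "V \<in> A_class M \<B> (q + t)"
      unfolding V_def using H(5) w basis q t by (intro A_class_mult_A1_weight) auto
    have [measurable]: "V \<in> borel_measurable M" unfolding V_def by measurable
    obtain C0 where C0: "C0 < \<infinity>" "\<And>f g. (f, g) \<in> \<F> \<Longrightarrow>
      (\<integral>\<^sup>+x. f x epowr p0 * V x \<partial>M) \<le> C0 * (\<integral>\<^sup>+x. g x epowr p0 * V x \<partial>M)"
      using weighted_boundD[OF wb _ V] q t by auto
    define I where "I = (\<integral>\<^sup>+x. H x epowr q * w x \<partial>M)"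
    have I: "I < \<infinity>" using H(2) L[OF H(1)] epowr_less_top_iff[of "1/q"] q by (simp add: I_def)
    have "c f \<le> (C0 epowr \<theta> * I) * (2 epowr q) ^ k * c g"
      if S: "(f, g) \<in> S" and le: "\<forall>x. h (f, g) x \<le> ennreal (2 ^ k) * H0 x" for f g and k :: nat
    proof -
      have fg: "(f, g) \<in> \<F>" "0 < c g" "c g < \<infinity>" using S by (auto simp: S_def)
      have [measurable]: "f \<in> borel_measurable M" "g \<in> borel_measurable M"
        using \<F> fg by (auto simp: extrapolation_family_def)
      define A where "A = ennreal (2 ^ k) * c g epowr (1/q)"
      have gH: "g x epowr (p/q) \<le> A * H x" for x
      proof -
        have "c g epowr (1/q) * h (f, g) x \<le> c g epowr (1/q) * (ennreal (2 ^ k) * H x)"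
          using le[rule_format, of x] mult_left_mono[OF H(3)[of x], of "ennreal (2 ^ k)"]
          by (intro mult_left_mono) (auto intro: order_trans)
        moreover have "c g epowr (1/q) * h (f, g) x = g x epowr (p/q)"
        proof -
          have "c g epowr (1/q) * h (f, g) x
            = g x epowr (p/q) * (c g epowr (1/q) * c g epowr (- (1/q)))"
            by (simp add: h_def ac_simps)
          then show ?thesis using epowr_add[OF fg(2,3), of "1/q" "- (1/q)"] by simp
        qed
        ultimately show ?thesis by (simp add: A_def ac_simps)
      qed
      have "AE x in M. g x epowr p0 * V x \<le> A epowr (q / \<theta>) * (H x epowr q * w x)"
        using H(4)
      proof eventually_elim
        case (elim x)
        have "g x epowr p0 = (g x epowr (p/q)) epowr (q / \<theta>)"
          using p q by (simp add: epowr_epowr \<theta>_def)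
        also have "\<dots> \<le> (A * H x) epowr (q / \<theta>)" using gH q \<theta> by (intro epowr_mono) auto
        also have "\<dots> = A epowr (q / \<theta>) * H x epowr (q / \<theta>)"
          using q \<theta> by (simp add: epowr_mult_distrib)
        finally have "g x epowr p0 * V x \<le> A epowr (q / \<theta>) * H x epowr (q / \<theta>) * V x"
          by (rule mult_right_mono) simp
        also have "\<dots> = A epowr (q / \<theta>) * ((H x epowr (q / \<theta>) * H x epowr (- t)) * w x)"
          by (simp add: V_def ac_simps)
        also have "H x epowr (q / \<theta>) * H x epowr (- t) = H x epowr q"
          using elim epowr_add[of "H x" "q / \<theta>" "- t"] t by simp
        finally show ?case .
      qed
      then have gI: "(\<integral>\<^sup>+x. g x epowr p0 * V x \<partial>M) \<le> A epowr (q / \<theta>) * I"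
        unfolding I_def by (subst nn_integral_cmult[symmetric]) (auto intro: nn_integral_mono_AE)
      have "c f \<le> (\<integral>\<^sup>+x. (f x epowr p0 * V x) epowr \<theta> * (H x epowr q * w x) epowr (1 - \<theta>) \<partial>M)"
        unfolding c_def
      proof (rule nn_integral_mono_AE)
        show "AE x in M. f x epowr p * w x \<le> (f x epowr p0 * V x) epowr \<theta> * (H x epowr q * w x) epowr (1 - \<theta>)"
          using H(4) weightD(2)[OF ww]
        proof eventually_elim
          case (elim x)
          have "(f x epowr p0 * V x) epowr \<theta> * (H x epowr q * w x) epowr (1 - \<theta>)
            = f x epowr p * (w x epowr \<theta> * w x epowr (1 - \<theta>))
              * (H x epowr (- t * \<theta>) * H x epowr (q * (1 - \<theta>)))"
            using \<theta> p by (simp add: V_def epowr_mult_distrib epowr_epowr \<theta>_def ac_simps)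
          also have "w x epowr \<theta> * w x epowr (1 - \<theta>) = w x"
            using elim epowr_add[of "w x" \<theta> "1 - \<theta>"] by simp
          also have "H x epowr (- t * \<theta>) * H x epowr (q * (1 - \<theta>)) = 1"
            using elim epowr_add[of "H x" "- t * \<theta>" "q * (1 - \<theta>)"] \<theta>t by simp
          finally show ?case by simp
        qed
      qed
      also have "\<dots> \<le> (\<integral>\<^sup>+x. f x epowr p0 * V x \<partial>M) epowr \<theta> * I epowr (1 - \<theta>)"
        unfolding I_def using \<theta> by (intro nn_integral_Hoelder) auto
      also have "\<dots> \<le> (C0 * (A epowr (q / \<theta>) * I)) epowr \<theta> * I epowr (1 - \<theta>)"
        using \<theta> order_trans[OF C0(2)[OF fg(1)] mult_left_mono[OF gI]]
        by (intro mult_right_mono epowr_mono) auto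
      also have "\<dots> = C0 epowr \<theta> * A epowr q * (I epowr \<theta> * I epowr (1 - \<theta>))"
        using \<theta> by (simp add: epowr_mult_distrib epowr_epowr ac_simps)
      also have "I epowr \<theta> * I epowr (1 - \<theta>) = I"
        using \<theta> epowr_add_same_sign[of \<theta> "1 - \<theta>" I] by simp
      also have "A epowr q = (2 epowr q) ^ k * c g"
      proof -
        have "ennreal (2 ^ k) epowr q = ennreal ((2 ^ k) powr q)" by (rule epowr_ennreal) simp
        also have "(2 ^ k :: real) powr q = (2 powr q) ^ k"
          by (simp add: powr_powr powr_realpow[symmetric] mult.commute)
        also have "ennreal \<dots> = (2 epowr q) ^ k"
          using epowr_ennreal[of 2 q] by (simp add: ennreal_power)
        finally show ?thesis using q by (simp add: A_def epowr_mult_distrib epowr_epowr)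
      qed
      finally show ?thesis by (simp add: ac_simps)
    qed
    moreover have "C0 epowr \<theta> * I < \<infinity>"
      using C0(1) I \<theta> epowr_less_top_iff[of \<theta> C0] by (simp add: ennreal_mult_less_top)
    ultimately show "\<exists>C<\<infinity>. \<forall>i\<in>S. \<forall>k::nat. (\<forall>x. h i x \<le> ennreal (2 ^ k) * H0 x) \<longrightarrow>
        c (fst i) \<le> C * (2 epowr q) ^ k * c (snd i)"
      by (intro exI[of _ "C0 epowr \<theta> * I"]) auto
  qed
  then obtain C where "C < \<infinity>" and bound: "\<forall>i\<in>S. c (fst i) \<le> C * c (snd i)" by blast
  have C: "C < \<infinity>" "\<And>f g. (f, g) \<in> S \<Longrightarrow> c f \<le> C * c g"
    using \<open>C < \<infinity>\<close> bspec[OF bound] by auto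
  obtain C1 where "C1 < \<infinity>" and C1: "\<And>f g. (f, g) \<in> \<F> \<Longrightarrow>
      (\<integral>\<^sup>+x. f x epowr p0 * w x \<partial>M) \<le> C1 * (\<integral>\<^sup>+x. g x epowr p0 * w x \<partial>M)"
    by (rule weighted_boundD[OF wb q w]) (rule that)
  have "c f \<le> (C + 1) * c g" if fg: "(f, g) \<in> \<F>" for f g
  proof -
    have m: "f \<in> borel_measurable M" "g \<in> borel_measurable M"
      using \<F> fg by (auto simp: extrapolation_family_def)
    show ?thesis
    proof (cases "c g = 0 \<or> c g = \<infinity>")
      case False
      then have "(f, g) \<in> S"
        using fg by (simp add: S_def zero_less_iff_neq_zero less_top)
      moreover have "C * c g \<le> (C + 1) * c g" by (intro mult_right_mono) auto
      ultimately show ?thesis using C(2) order_trans by blast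
    next
      case True
      moreover have "c f = 0" if "c g = 0"
      proof -
        from that have "AE x in M. g x = 0"
          unfolding c_def using nn_integral_epowr_weight_eq_0[OF ww m(2) p(1)] by simp
        then have "(\<integral>\<^sup>+x. g x epowr p0 * w x \<partial>M) = 0"
          using nn_integral_epowr_weight_eq_0[OF ww m(2)] p by simp
        with C1[OF fg] have "(\<integral>\<^sup>+x. f x epowr p0 * w x \<partial>M) = 0" by simp
        then have "AE x in M. f x = 0"
          using nn_integral_epowr_weight_eq_0[OF ww m(1)] p by simp
        then show "c f = 0"
          unfolding c_def using nn_integral_epowr_weight_eq_0[OF ww m(1) p(1)] by simp
      qed
      ultimately show ?thesis by (auto simp: ennreal_mult_top)
    qed
  qed
  moreover have "C + 1 < \<infinity>" using C(1) by simp
  ultimately show "\<exists>C<\<infinity>. \<forall>(f, g)\<in>\<F>.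
      (\<integral>\<^sup>+x. f x epowr p * w x \<partial>M) \<le> C * (\<integral>\<^sup>+x. g x epowr p * w x \<partial>M)"
    unfolding c_def by (intro exI[of _ "C + 1"]) auto
qed

text \<open>The dual operator \<open>h \<mapsto> M(h w) / w\<close> on \<open>L\<^bsup>s'\<^esup>(w)\<close> is the maximal operator on \<open>L\<^bsup>s'\<^esup>(\<sigma>)\<close> with
  \<open>\<sigma> = w\<^bsup>1-s'\<^esup> \<in> A\<^bsub>s'\<^esub>\<close>, transported by the isometry \<open>h \<mapsto> h w\<close>.\<close>
lemma muckenhoupt_dual_majorant:
  assumes sf: "sigma_finite_measure M" and mb: "muckenhoupt_basis M \<B>"
    and s: "1 < s" and w: "w \<in> A_class M \<B> s"
  obtains K where "\<And>h. h \<in> borel_measurable M \<Longrightarrow> Lp_norm (conj_exp s) (density M w) h < \<infinity> \<Longrightarrow>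
    \<exists>G\<in>borel_measurable M. Lp_norm (conj_exp s) (density M w) G \<le> ennreal K * Lp_norm (conj_exp s) (density M w) h \<and>
      (AE x in M. maximal M \<B> (\<lambda>y. h y * w y) x \<le> G x * w x)"
proof -
  let ?s = "conj_exp s"
  define \<sigma> where "\<sigma> x = w x epowr (1 - ?s)" for x
  have ww: "weight M w" using w by (simp add: A_class_def)
  note weightD(1)[OF ww, measurable]
  have \<sigma>: "\<sigma> \<in> A_class M \<B> ?s" unfolding \<sigma>_def[abs_def] using s w by (rule A_class_dual)
  then have w\<sigma>: "weight M \<sigma>" by (simp add: A_class_def)
  have s': "1 < ?s" using s by (rule conj_exp_gt_1)
  have eq: "Lp_norm ?s (density M w) h = Lp_norm ?s (density M \<sigma>) (\<lambda>x. h x * w x)"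
    if [measurable]: "h \<in> borel_measurable M" for h
  proof -
    have "AE x in M. h x epowr ?s * w x = (h x * w x) epowr ?s * \<sigma> x"
      using weightD(2)[OF ww]
    proof eventually_elim
      case (elim x)
      then have "w x epowr ?s * w x epowr (1 - ?s) = w x" using epowr_add[of "w x" ?s "1 - ?s"] by simp
      then show ?case using s' by (simp add: \<sigma>_def epowr_mult_distrib mult.assoc)
    qed
    then have "(\<integral>\<^sup>+x. h x epowr ?s * w x \<partial>M) = (\<integral>\<^sup>+x. (h x * w x) epowr ?s * \<sigma> x \<partial>M)"
      by (rule nn_integral_cong_AE)
    then show ?thesis by (simp add: Lp_norm_density_weight[OF ww] Lp_norm_density_weight[OF w\<sigma>])
  qed
  obtain K where K: "\<And>h. h \<in> borel_measurable M \<Longrightarrow> Lp_norm ?s (density M \<sigma>) h < \<infinity> \<Longrightarrow>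
    \<exists>G\<in>borel_measurable M. Lp_norm ?s (density M \<sigma>) G \<le> ennreal K * Lp_norm ?s (density M \<sigma>) h \<and>
      (AE x in M. maximal M \<B> h x \<le> G x)"
    using muckenhoupt_majorant[OF sf mb s' \<sigma>] by blast
  show ?thesis
  proof (rule that[of K])
    fix h assume [measurable]: "h \<in> borel_measurable M" and "Lp_norm ?s (density M w) h < \<infinity>"
    then obtain G where [measurable]: "G \<in> borel_measurable M"
      and G: "Lp_norm ?s (density M \<sigma>) G \<le> ennreal K * Lp_norm ?s (density M w) h"
        "AE x in M. maximal M \<B> (\<lambda>y. h y * w y) x \<le> G x"
      using K[of "\<lambda>x. h x * w x"] by (auto simp: eq)
    have Gw: "AE x in M. G x * w x epowr (- 1) * w x = G x"
      using weightD(2)[OF ww]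
    proof eventually_elim
      case (elim x)
      then have "w x epowr (- 1) * w x = 1" using epowr_add[of "w x" "- 1" 1] by simp
      then show ?case by (simp add: mult.assoc)
    qed
    have "Lp_norm ?s (density M w) (\<lambda>x. G x * w x epowr (- 1))
      = Lp_norm ?s (density M \<sigma>) (\<lambda>x. G x * w x epowr (- 1) * w x)" by (rule eq) measurable
    also have "\<dots> = Lp_norm ?s (density M \<sigma>) G"
      using Gw by (intro Lp_norm_cong_AE) (simp add: AE_density_weight[OF w\<sigma>])
    finally have "Lp_norm ?s (density M w) (\<lambda>x. G x * w x epowr (- 1)) \<le> ennreal K * Lp_norm ?s (density M w) h"
      using G(1) by simp
    moreover have "AE x in M. maximal M \<B> (\<lambda>y. h y * w y) x \<le> G x * w x epowr (- 1) * w x"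
      using Gw G(2) by eventually_elim simp
    ultimately show "\<exists>G\<in>borel_measurable M.
        Lp_norm ?s (density M w) G \<le> ennreal K * Lp_norm ?s (density M w) h \<and>
        (AE x in M. maximal M \<B> (\<lambda>y. h y * w y) x \<le> G x * w x)"
      by (intro bexI[of _ "\<lambda>x. G x * w x epowr (- 1)"]) auto
  qed
qed

lemma weighted_bound_A1:
  assumes "mbasis M \<B>" "weighted_bound M \<B> \<F> p" "A1_weight M \<B> w"
  shows "\<exists>C<\<infinity>. \<forall>(f, g)\<in>(\<lambda>(f, g). (\<lambda>x. f x epowr p, \<lambda>x. g x epowr p)) ` \<F>.
    (\<integral>\<^sup>+x. f x * w x \<partial>M) \<le> C * (\<integral>\<^sup>+x. g x * w x \<partial>M)"
proof -
  obtain C where "C < \<infinity>" "\<And>f g. (f, g) \<in> \<F> \<Longrightarrow>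
    (\<integral>\<^sup>+x. f x epowr p * w x \<partial>M) \<le> C * (\<integral>\<^sup>+x. g x epowr p * w x \<partial>M)"
    using weighted_boundD[OF assms(2) _ A1_weight_A_class_2[OF assms(1,3)]] by auto
  then show ?thesis by (intro exI[of _ C]) auto
qed

text \<open>With \<open>s = p / p\<^sub>1\<close>, the norm of \<open>f\<^bsup>p\<^sub>1\<^esup>\<close> in \<open>L\<^sup>s(w)\<close> is tested against the unit ball of
  \<open>L\<^bsup>s'\<^esup>(w)\<close>, where \<open>w \<in> A\<^sub>s\<close> bounds the dual maximal operator.\<close>
lemma weighted_bound_increase:
  assumes sf: "sigma_finite_measure M" and mb: "muckenhoupt_basis M \<B>"
    and \<F>: "extrapolation_family M \<F>" and p: "0 < p1" "p1 < p" and wb: "weighted_bound M \<B> \<F> p1"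
    and w: "w \<in> A_class M \<B> (p / p1)"
  shows "\<exists>C<\<infinity>. \<forall>(f, g)\<in>\<F>.
    (\<integral>\<^sup>+x. f x epowr p * w x \<partial>M) \<le> C * (\<integral>\<^sup>+x. g x epowr p * w x \<partial>M)"
proof -
  define s where "s = p / p1"
  have s: "1 < s" "p1 * s = p" using p by (auto simp: s_def)
  have w: "w \<in> A_class M \<B> s" using w by (simp add: s_def)
  note basis = muckenhoupt_mbasis[OF mb]
  have ww: "weight M w" using w by (simp add: A_class_def)
  note wm = weightD(1)[OF ww, measurable]
  let ?L = "Lp_norm (conj_exp s) (density M w)" and ?P = "(\<lambda>(f, g). (\<lambda>x. f x epowr p1, \<lambda>x. g x epowr p1)) ` \<F>"
  have s': "1 < conj_exp s" using s(1) by (rule conj_exp_gt_1)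
  interpret gauge M ?L by (rule gauge_Lp_norm[OF sf ww s'])
  interpret D: sigma_finite_measure "density M w"
    using sf ww by (intro sigma_finite_density_weight)
  obtain K where maj: "\<And>h. h \<in> borel_measurable M \<Longrightarrow> ?L h < \<infinity> \<Longrightarrow>
    \<exists>G\<in>borel_measurable M. ?L G \<le> ennreal K * ?L h \<and>
      (AE x in M. maximal M \<B> (\<lambda>y. h y * w y) x \<le> G x * w x)"
    using muckenhoupt_dual_majorant[OF sf mb s(1) w] by blast
  have "\<exists>C<\<infinity>. \<forall>(f,g)\<in>?P. \<forall>h\<in>borel_measurable M.
    ?L h \<le> 1 \<longrightarrow> (\<integral>\<^sup>+x. f x * (h x * w x) \<partial>M) \<le> C * Lp_norm s (density M w) g"
  proof (rule A1_bound_imp_test_bound[OF mbasisD(1)[OF basis] ww maj])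
    fix f g H :: "'a \<Rightarrow> ennreal" assume "(f, g) \<in> ?P" and [measurable]: "H \<in> borel_measurable M"
    then have [measurable]: "g \<in> borel_measurable M"
      using \<F> by (auto simp: extrapolation_family_def)
    have "(\<integral>\<^sup>+x. g x * (H x * w x) \<partial>M) = (\<integral>\<^sup>+x. g x * H x \<partial>density M w)"
      using ww by (subst nn_integral_density_weight) (auto simp: mult.assoc)
    also have "\<dots> \<le> Lp_norm s (density M w) g * ?L H"
      using s by (intro Lp_norm_Hoelder) auto
    finally show "(\<integral>\<^sup>+x. g x * (H x * w x) \<partial>M) \<le> Lp_norm s (density M w) g * ?L H" .
  qed (use \<F> weighted_bound_A1[OF basis wb] in \<open>auto simp: extrapolation_family_def\<close>)
  then obtain C where C: "C < \<infinity>" "\<And>f g h. (f, g) \<in> \<F> \<Longrightarrow> h \<in> borel_measurable M \<Longrightarrow> ?L h \<le> 1 \<Longrightarrow>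
    (\<integral>\<^sup>+x. f x epowr p1 * (h x * w x) \<partial>M) \<le> C * Lp_norm s (density M w) (\<lambda>x. g x epowr p1)"
    by fastforce
  have "(\<integral>\<^sup>+x. f x epowr p * w x \<partial>M) \<le> C epowr s * (\<integral>\<^sup>+x. g x epowr p * w x \<partial>M)"
    if fg: "(f, g) \<in> \<F>" for f g
  proof -
    have [measurable]: "f \<in> borel_measurable M" "g \<in> borel_measurable M"
      using \<F> fg by (auto simp: extrapolation_family_def)
    have "Lp_norm s (density M w) (\<lambda>x. f x epowr p1) \<le> C * Lp_norm s (density M w) (\<lambda>x. g x epowr p1)"
    proof (subst D.Lp_norm_eq_dual_norm[OF s(1)], simp, unfold dual_norm_def, intro SUP_least)
      fix k assume "k \<in> {k \<in> borel_measurable (density M w). ?L k \<le> 1}"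
      then have [measurable]: "k \<in> borel_measurable M" and k: "?L k \<le> 1" by auto
      have "(\<integral>\<^sup>+x. f x epowr p1 * k x \<partial>density M w) = (\<integral>\<^sup>+x. f x epowr p1 * (k x * w x) \<partial>M)"
        using ww by (subst nn_integral_density_weight) (auto simp: mult.assoc)
      also have "\<dots> \<le> C * Lp_norm s (density M w) (\<lambda>x. g x epowr p1)"
        using C(2)[OF fg _ k] by simp
      finally show "(\<integral>\<^sup>+x. f x epowr p1 * k x \<partial>density M w)
        \<le> C * Lp_norm s (density M w) (\<lambda>x. g x epowr p1)" .
    qed
    then have "Lp_norm s (density M w) (\<lambda>x. f x epowr p1) epowr s
      \<le> (C * Lp_norm s (density M w) (\<lambda>x. g x epowr p1)) epowr s"
      using s by (intro epowr_mono) auto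
    then show ?thesis
      using s by (simp add: Lp_norm_density_weight[OF ww] epowr_mult_distrib epowr_epowr)
  qed
  moreover have "C epowr s < \<infinity>" using C(1) s epowr_less_top_iff[of s C] by simp
  ultimately show ?thesis by (intro exI[of _ "C epowr s"]) auto
qed

lemma weighted_bound_all_exponents:
  assumes sf: "sigma_finite_measure M" and mb: "muckenhoupt_basis M \<B>"
    and \<F>: "extrapolation_family M \<F>" and p: "0 < p0" "0 < p" and wb: "weighted_bound M \<B> \<F> p0"
  shows "weighted_bound M \<B> \<F> p"
  unfolding weighted_bound_def
proof (intro allI impI ballI)
  fix q w assume q: "1 < (q::real)" and w: "w \<in> A_class M \<B> q"
  \<comment> \<open>below \<open>p0\<close>, and so small that \<open>w \<in> A\<^sub>q \<subseteq> A\<^bsub>p/p1\<^esub>\<close>\<close>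
  define p1 where "p1 = min p0 (p / q) / 2"
  have p1: "0 < p1" "p1 < p0" "p1 * q < p"
    using p q by (auto simp: p1_def min_def field_simps)
  have "p1 * 1 < p1 * q" using p1 q by (intro mult_strict_left_mono) auto
  with p1(3) have "p1 < p" by linarith
  have "w \<in> A_class M \<B> (p / p1)"
    using p1 by (intro A_class_mono[OF muckenhoupt_mbasis[OF mb] q _ w]) (simp add: field_simps)
  with weighted_bound_increase[OF sf mb \<F> p1(1) \<open>p1 < p\<close> weighted_bound_decrease[OF sf mb \<F> p1(1,2) wb]]
  show "\<exists>C<\<infinity>. \<forall>(f, g)\<in>\<F>.
    (\<integral>\<^sup>+x. f x epowr p * w x \<partial>M) \<le> C * (\<integral>\<^sup>+x. g x epowr p * w x \<partial>M)" by blast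
qed

section \<open>Associate spaces and the Lorentz--Luxemburg theorem\<close>

text \<open>The absolute values turn the members of the unit ball into test functions for \<open>dual_norm\<close>.\<close>
definition unit_ball :: "'a measure \<Rightarrow> (('a \<Rightarrow> real) \<Rightarrow> ennreal) \<Rightarrow> ('a \<Rightarrow> ennreal) set" where
  "unit_ball M X = (\<lambda>g x. ennreal \<bar>g x\<bar>) ` {g \<in> borel_measurable M. X g \<le> 1}"

locale banach_function_norm = sigma_finite_measure M for M :: "'a measure" +
  fixes X :: "('a \<Rightarrow> real) \<Rightarrow> ennreal"
  assumes function_norm: "function_norm M X"
begin

lemma
  assumes "f \<in> borel_measurable M"
  shows X_eq_0_iff: "X f = 0 \<longleftrightarrow> (AE x in M. f x = 0)"
    and X_scale: "X (\<lambda>x. c * f x) = ennreal \<bar>c\<bar> * X f"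
    and X_add: "g \<in> borel_measurable M \<Longrightarrow> X (\<lambda>x. f x + g x) \<le> X f + X g"
    and X_mono: "g \<in> borel_measurable M \<Longrightarrow> AE x in M. \<bar>f x\<bar> \<le> \<bar>g x\<bar> \<Longrightarrow> X f \<le> X g"
  using function_norm assms unfolding function_norm_def by blast+

lemma X_monotone_convergence:
  assumes "\<And>j::nat. f j \<in> borel_measurable M" "F \<in> borel_measurable M"
    and "AE x in M. incseq (\<lambda>j. \<bar>f j x\<bar>) \<and> (\<lambda>j. \<bar>f j x\<bar>) \<longlonglongrightarrow> \<bar>F x\<bar>"
  shows "(\<lambda>j. X (f j)) \<longlonglongrightarrow> X F"
  using function_norm assms unfolding function_norm_def by blast

lemma X_indicator_finite:
  assumes "E \<in> sets M" "emeasure M E < \<infinity>"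
  shows "X (indicator E) < \<infinity>"
  using function_norm assms unfolding function_norm_def by blast

lemma X_local_integral:
  assumes "E \<in> sets M" "emeasure M E < \<infinity>"
  shows "\<exists>C>0. \<forall>f\<in>borel_measurable M. (\<integral>\<^sup>+x\<in>E. ennreal \<bar>f x\<bar> \<partial>M) \<le> ennreal C * X f"
  using function_norm assms unfolding function_norm_def by blast

abbreviation associate :: "('a \<Rightarrow> ennreal) \<Rightarrow> ennreal" where
  "associate \<equiv> dual_norm M (unit_ball M X)"

lemma associate_upper:
  assumes "g \<in> borel_measurable M" "X g \<le> 1"
  shows "(\<integral>\<^sup>+x. F x * ennreal \<bar>g x\<bar> \<partial>M) \<le> associate F"
  unfolding dual_norm_def unit_ball_def using assms by (intro SUP_upper) auto

lemma associate_leI: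
  assumes "\<And>g. g \<in> borel_measurable M \<Longrightarrow> X g \<le> 1 \<Longrightarrow> (\<integral>\<^sup>+x. F x * ennreal \<bar>g x\<bar> \<partial>M) \<le> c"
  shows "associate F \<le> c"
  unfolding dual_norm_def unit_ball_def using assms by (intro SUP_least) auto

lemma associate_cong_AE:
  assumes "AE x in M. F x = G x"
  shows "associate F = associate G"
  unfolding dual_norm_def using assms by (intro SUP_cong refl nn_integral_cong_AE) (auto elim: AE_mp)

lemma ennreal_enn2real_min: "ennreal (enn2real (min x (of_nat n))) = min x (of_nat n)"
  by (intro ennreal_enn2real) (auto simp: min_less_iff_disj of_nat_less_top)

lemma ext_norm_assoc_norm:
  assumes [measurable]: "F \<in> borel_measurable M"
  shows "ext_norm (assoc_norm M X) F = associate F"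
proof -
  let ?B = "{g \<in> borel_measurable M. X g \<le> 1}"
  have "ext_norm (assoc_norm M X) F
    = (SUP n. SUP g\<in>?B. \<integral>\<^sup>+x. min (F x) (of_nat n) * ennreal \<bar>g x\<bar> \<partial>M)"
    unfolding ext_norm_def assoc_norm_def abs_mult
    by (simp add: ennreal_mult ennreal_enn2real_min)
  also have "\<dots> = (SUP g\<in>?B. SUP n. \<integral>\<^sup>+x. min (F x) (of_nat n) * ennreal \<bar>g x\<bar> \<partial>M)"
    by (rule SUP_commute)
  also have "\<dots> = (SUP g\<in>?B. \<integral>\<^sup>+x. F x * ennreal \<bar>g x\<bar> \<partial>M)"
  proof (intro SUP_cong refl)
    fix g assume "g \<in> ?B"
    then have [measurable]: "g \<in> borel_measurable M" by simp
    show "(SUP n. \<integral>\<^sup>+x. min (F x) (of_nat n) * ennreal \<bar>g x\<bar> \<partial>M) = (\<integral>\<^sup>+x. F x * ennreal \<bar>g x\<bar> \<partial>M)"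
      using nn_integral_SUP_truncate[of "\<lambda>_. space M" M F "\<lambda>x. ennreal \<bar>g x\<bar>"]
      by (simp add: truncate_def incseq_def cong: nn_integral_cong_simp)
  qed
  finally show ?thesis by (simp add: dual_norm_def unit_ball_def image_image)
qed

text \<open>A suitable multiple of the indicator of \<open>E\<close> lies in the unit ball. Hence the associate norm
  controls integrals over sets of finite measure, and with them finiteness and vanishing a.e.\<close>
lemma nn_integral_le_associate:
  assumes [measurable]: "E \<in> sets M" and "emeasure M E < \<infinity>"
  obtains C where "C < \<infinity>"
    "\<And>F. F \<in> borel_measurable M \<Longrightarrow> (\<integral>\<^sup>+x. F x * indicator E x \<partial>M) \<le> C * associate F"
proof -
  define r where "r = enn2real (X (indicator E)) + 1"
  have r: "0 < r" unfolding r_def by (simp add: add_nonneg_pos)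
  have "X (indicator E) = ennreal (enn2real (X (indicator E)))"
    using X_indicator_finite[OF assms] by simp
  also have "\<dots> \<le> ennreal r" unfolding r_def by (intro ennreal_leI) simp
  finally have "ennreal (1/r) * X (indicator E) \<le> ennreal (1/r) * ennreal r"
    by (rule mult_left_mono) simp
  then have ball: "X (\<lambda>x. 1/r * indicator E x) \<le> 1"
    using r by (subst X_scale) (auto simp flip: ennreal_mult)
  show ?thesis
  proof (rule that[of "ennreal r"])
    fix F :: "'a \<Rightarrow> ennreal" assume [measurable]: "F \<in> borel_measurable M"
    have "(\<integral>\<^sup>+x. F x * indicator E x \<partial>M)
      = (\<integral>\<^sup>+x. ennreal r * (F x * ennreal \<bar>1/r * indicator E x\<bar>) \<partial>M)"
    proof (rule nn_integral_cong)
      fix x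
      have "ennreal r * ennreal (1/r) = 1" using r by (simp flip: ennreal_mult)
      then show "F x * indicator E x = ennreal r * (F x * ennreal \<bar>1/r * indicator E x\<bar>)"
        using r by (simp add: indicator_def mult.left_commute[of "ennreal r"])
    qed
    also have "\<dots> = ennreal r * (\<integral>\<^sup>+x. F x * ennreal \<bar>1/r * indicator E x\<bar> \<partial>M)"
      by (intro nn_integral_cmult) measurable
    also have "\<dots> \<le> ennreal r * associate F"
      using ball by (intro mult_left_mono associate_upper) auto
    finally show "(\<integral>\<^sup>+x. F x * indicator E x \<partial>M) \<le> ennreal r * associate F" .
  qed simp
qed

lemma AE_exhaustion:
  fixes E :: "nat \<Rightarrow> 'a set"
  assumes "(\<Union>n. E n) = space M" "\<And>n. AE x in M. x \<in> E n \<longrightarrow> P x"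
  shows "AE x in M. P x"
proof -
  have "AE x in M. \<forall>n. x \<in> E n \<longrightarrow> P x" unfolding AE_all_countable using assms(2) by blast
  then show ?thesis using AE_space by eventually_elim (use assms(1) in auto)
qed

lemma associate_finite_AE:
  assumes [measurable]: "F \<in> borel_measurable M" and "associate F < \<infinity>"
  shows "AE x in M. F x < \<infinity>"
proof -
  obtain E where E: "incseq E" "\<And>n. E n \<in> sets M" "(\<Union>n. E n) = space M"
    "\<And>n. emeasure M (E n) < \<infinity>" using finite_exhaustion by blast
  show ?thesis
  proof (rule AE_exhaustion[OF E(3)])
    fix n
    note E(2)[of n, measurable]
    obtain C where C: "C < \<infinity>" "(\<integral>\<^sup>+x. F x * indicator (E n) x \<partial>M) \<le> C * associate F"
      using nn_integral_le_associate[OF E(2,4)] assms(1) by metis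
    then have "(\<integral>\<^sup>+x. F x * indicator (E n) x \<partial>M) \<noteq> \<infinity>"
      using assms(2) by (auto simp: top_unique ennreal_mult_eq_top_iff)
    then have "AE x in M. F x * indicator (E n) x \<noteq> \<infinity>" by (intro nn_integral_PInf_AE) auto
    then show "AE x in M. x \<in> E n \<longrightarrow> F x < \<infinity>" by (auto simp: less_top elim: AE_mp)
  qed
qed

lemma associate_eq_0_AE:
  assumes [measurable]: "F \<in> borel_measurable M" and "associate F = 0"
  shows "AE x in M. F x = 0"
proof -
  obtain E where E: "incseq E" "\<And>n. E n \<in> sets M" "(\<Union>n. E n) = space M"
    "\<And>n. emeasure M (E n) < \<infinity>" using finite_exhaustion by blast
  show ?thesis
  proof (rule AE_exhaustion[OF E(3)])
    fix n
    note E(2)[of n, measurable]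
    obtain C where C: "C < \<infinity>" "(\<integral>\<^sup>+x. F x * indicator (E n) x \<partial>M) \<le> C * associate F"
      using nn_integral_le_associate[OF E(2,4)] assms(1) by metis
    then have "(\<integral>\<^sup>+x. F x * indicator (E n) x \<partial>M) = 0" using assms(2) by simp
    then have "AE x in M. F x * indicator (E n) x = 0" by (subst (asm) nn_integral_0_iff_AE) auto
    then show "AE x in M. x \<in> E n \<longrightarrow> F x = 0" by (auto elim: AE_mp)
  qed
qed

text \<open>The local integrability axiom bounds the associate norm of \<open>1\<^bsub>E n\<^esub>\<close> by some \<open>C n\<close>, so the series
  of the functions \<open>2\<^bsup>-n\<^esup> / C n\<close> times \<open>1\<^bsub>E n\<^esub>\<close> has norm at most \<open>2\<close>.\<close>
lemma associate_positive:
  "\<exists>h\<in>borel_measurable M. (AE x in M. 0 < h x) \<and> associate h < \<infinity>"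
proof -
  obtain E where E: "incseq E" "\<And>n. E n \<in> sets M" "(\<Union>n. E n) = space M"
    "\<And>n. emeasure M (E n) < \<infinity>" using finite_exhaustion by blast
  note E(2)[measurable]
  have "\<forall>n. \<exists>C>0. \<forall>f\<in>borel_measurable M. (\<integral>\<^sup>+x\<in>E n. ennreal \<bar>f x\<bar> \<partial>M) \<le> ennreal C * X f"
    using X_local_integral[OF E(2,4)] by simp
  then obtain C where C: "\<And>n. C n > 0"
    "\<And>n f. f \<in> borel_measurable M \<Longrightarrow> (\<integral>\<^sup>+x\<in>E n. ennreal \<bar>f x\<bar> \<partial>M) \<le> ennreal (C n) * X f"
    by metis
  define h where "h x = (\<Sum>n. ennreal ((1/2) ^ n / C n) * indicator (E n) x)" for x
  have [measurable]: "h \<in> borel_measurable M" unfolding h_def by measurable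
  have "AE x in M. 0 < h x"
  proof (rule AE_exhaustion[OF E(3)], rule AE_I2, rule impI)
    fix n x assume "x \<in> E n"
    then have "0 < ennreal ((1/2) ^ n / C n) * indicator (E n) x" using C(1) by simp
    also have "\<dots> \<le> h x" unfolding h_def by (rule term_le_suminf_ennreal)
    finally show "0 < h x" .
  qed
  moreover have "associate h \<le> ennreal 2"
  proof (rule associate_leI)
    fix g :: "'a \<Rightarrow> real" assume [measurable]: "g \<in> borel_measurable M" and g: "X g \<le> 1"
    have "(\<integral>\<^sup>+x. h x * ennreal \<bar>g x\<bar> \<partial>M)
      = (\<integral>\<^sup>+x. (\<Sum>n. ennreal ((1/2) ^ n / C n) * (ennreal \<bar>g x\<bar> * indicator (E n) x)) \<partial>M)"
      unfolding h_def by (simp add: mult.assoc mult.commute[of "ennreal \<bar>g _\<bar>"] flip: ennreal_suminf_multc)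
    also have "\<dots> = (\<Sum>n. ennreal ((1/2) ^ n / C n) * (\<integral>\<^sup>+x\<in>E n. ennreal \<bar>g x\<bar> \<partial>M))"
      by (simp add: nn_integral_suminf nn_integral_cmult)
    also have "\<dots> \<le> (\<Sum>n. ennreal ((1/2) ^ n))"
    proof (intro suminf_le)
      fix n
      have "(\<integral>\<^sup>+x\<in>E n. ennreal \<bar>g x\<bar> \<partial>M) \<le> ennreal (C n) * X g" by (intro C) auto
      also have "\<dots> \<le> ennreal (C n) * 1" using g by (intro mult_left_mono) auto
      finally have "ennreal ((1/2) ^ n / C n) * (\<integral>\<^sup>+x\<in>E n. ennreal \<bar>g x\<bar> \<partial>M)
        \<le> ennreal ((1/2) ^ n / C n) * ennreal (C n)" by (intro mult_left_mono) auto
      also have "\<dots> = ennreal ((1/2) ^ n)" using C(1)[of n] by (simp flip: ennreal_mult)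
      finally show "ennreal ((1/2) ^ n / C n) * (\<integral>\<^sup>+x\<in>E n. ennreal \<bar>g x\<bar> \<partial>M) \<le> ennreal ((1/2) ^ n)" .
    qed auto
    also have "\<dots> = ennreal 2" by (subst suminf_ennreal2) (auto simp: suminf_geometric)
    finally show "(\<integral>\<^sup>+x. h x * ennreal \<bar>g x\<bar> \<partial>M) \<le> ennreal 2" .
  qed
  then have "associate h < \<infinity>" by (rule le_less_trans) simp
  ultimately show ?thesis by (intro bexI[of _ h]) auto
qed

lemma Hoelder_associate_real:
  assumes [measurable]: "f \<in> borel_measurable M" "h \<in> borel_measurable M"
  shows "(\<integral>\<^sup>+x. ennreal \<bar>f x\<bar> * h x \<partial>M) \<le> X f * associate h"
proof -
  consider (zero) "X f = 0" | (top) "X f = \<infinity>" | (pos) r where "r > 0" "X f = ennreal r"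
    by (rule ennreal_zero_pos_top_cases)
  then show ?thesis
  proof cases
    case zero
    then have "AE x in M. ennreal \<bar>f x\<bar> * h x = 0" using X_eq_0_iff[OF assms(1)] by (auto elim: AE_mp)
    then have "(\<integral>\<^sup>+x. ennreal \<bar>f x\<bar> * h x \<partial>M) = 0" by (subst nn_integral_0_iff_AE) auto
    then show ?thesis by simp
  next
    case top
    show ?thesis
    proof (cases "associate h = 0")
      case True
      then have "AE x in M. ennreal \<bar>f x\<bar> * h x = 0"
        using associate_eq_0_AE[OF assms(2)] by (auto elim: AE_mp)
      then have "(\<integral>\<^sup>+x. ennreal \<bar>f x\<bar> * h x \<partial>M) = 0" by (subst nn_integral_0_iff_AE) auto
      then show ?thesis by simp
    qed (use top in \<open>simp add: ennreal_top_mult\<close>)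
  next
    case pos
    have "X (\<lambda>x. 1/r * f x) \<le> 1"
      using pos by (subst X_scale) (auto simp flip: ennreal_mult)
    then have "(\<integral>\<^sup>+x. h x * ennreal \<bar>1/r * f x\<bar> \<partial>M) \<le> associate h"
      by (intro associate_upper) auto
    then have "ennreal r * (\<integral>\<^sup>+x. h x * ennreal \<bar>1/r * f x\<bar> \<partial>M) \<le> X f * associate h"
      using pos by (simp add: mult_left_mono)
    moreover have "ennreal r * (\<integral>\<^sup>+x. h x * ennreal \<bar>1/r * f x\<bar> \<partial>M) = (\<integral>\<^sup>+x. ennreal \<bar>f x\<bar> * h x \<partial>M)"
    proof (subst nn_integral_cmult[symmetric], measurable, rule nn_integral_cong)
      fix x
      have "ennreal r * ennreal \<bar>1/r * f x\<bar> = ennreal \<bar>f x\<bar>"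
        using pos by (simp add: abs_mult flip: ennreal_mult)
      then show "ennreal r * (h x * ennreal \<bar>1/r * f x\<bar>) = ennreal \<bar>f x\<bar> * h x"
        by (metis mult.commute mult.left_commute)
    qed
    ultimately show ?thesis by simp
  qed
qed

lemma Hoelder_associate:
  assumes [measurable]: "F \<in> borel_measurable M" "h \<in> borel_measurable M"
  shows "(\<integral>\<^sup>+x. F x * h x \<partial>M) \<le> ext_norm X F * associate h"
proof -
  have "(\<integral>\<^sup>+x. F x * h x \<partial>M) = (SUP n. \<integral>\<^sup>+x. min (F x) (of_nat n) * h x \<partial>M)"
    using nn_integral_SUP_truncate[of "\<lambda>_. space M" M F h]
    by (simp add: truncate_def incseq_def cong: nn_integral_cong_simp)
  also have "\<dots> \<le> ext_norm X F * associate h"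
  proof (rule SUP_least)
    fix n
    have "(\<integral>\<^sup>+x. min (F x) (of_nat n) * h x \<partial>M)
      = (\<integral>\<^sup>+x. ennreal \<bar>enn2real (min (F x) (of_nat n))\<bar> * h x \<partial>M)"
      by (simp add: ennreal_enn2real_min)
    also have "\<dots> \<le> X (\<lambda>x. enn2real (min (F x) (of_nat n))) * associate h"
      by (intro Hoelder_associate_real) measurable
    also have "\<dots> \<le> ext_norm X F * associate h"
      unfolding ext_norm_def by (intro mult_right_mono SUP_upper) auto
    finally show "(\<integral>\<^sup>+x. min (F x) (of_nat n) * h x \<partial>M) \<le> ext_norm X F * associate h" .
  qed
  finally show ?thesis .
qed

lemma integrable_bounded_on_finite:
  fixes f :: "'a \<Rightarrow> real"
  assumes [measurable]: "f \<in> borel_measurable M" "E \<in> sets M" and "emeasure M E < \<infinity>"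
    and b: "\<And>x. x \<in> space M \<Longrightarrow> \<bar>f x\<bar> \<le> b * indicator E x"
  shows "integrable M f"
proof (rule Bochner_Integration.integrable_bound)
  show "integrable M (\<lambda>x. b * indicator E x)"
    using assms(3) by (intro integrable_mult_right integrable_real_indicator) auto
  show "AE x in M. norm (f x) \<le> norm (b * indicator E x)"
    unfolding real_norm_def by (intro AE_I2 order_trans[OF b abs_ge_self])
qed measurable

text \<open>Fatou's lemma for the norm: the infima \<open>inf {g j | j \<ge> k}\<close> increase to the limit.\<close>
lemma X_liminf_le:
  fixes g :: "nat \<Rightarrow> 'a \<Rightarrow> real"
  assumes [measurable]: "\<And>k. g k \<in> borel_measurable M" "g0 \<in> borel_measurable M"
    and nonneg: "\<And>k x. x \<in> space M \<Longrightarrow> 0 \<le> g k x"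
    and lim: "AE x in M. (\<lambda>k. g k x) \<longlonglongrightarrow> g0 x"
    and le: "\<And>k. X (g k) \<le> c"
  shows "X g0 \<le> c"
proof -
  define a where "a k x = (INF j\<in>{k..}. g j x)" for k x
  have bdd: "bdd_below ((\<lambda>j. g j x) ` A)" if "x \<in> space M" for x A
    by (intro bdd_belowI[of _ 0]) (use nonneg[OF that] in auto)
  have am [measurable]: "a k \<in> borel_measurable M" for k
    unfolding a_def by (intro borel_measurable_cINF) (auto intro: bdd)
  have a: "0 \<le> a k x" "a k x \<le> g k x" if "x \<in> space M" for k x
    unfolding a_def using nonneg[OF that] bdd[OF that]
    by (auto intro!: cINF_greatest cINF_lower)
  have inc: "incseq (\<lambda>k. a k x)" if "x \<in> space M" for x
    unfolding a_def by (intro incseq_SucI cINF_superset_mono bdd that) auto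
  have "AE x in M. incseq (\<lambda>k. \<bar>a k x\<bar>) \<and> (\<lambda>k. \<bar>a k x\<bar>) \<longlonglongrightarrow> \<bar>g0 x\<bar>"
    using lim AE_space
  proof eventually_elim
    case (elim x)
    have "(\<lambda>k. a k x) \<longlonglongrightarrow> g0 x"
    proof (rule LIMSEQ_I)
      fix e :: real assume e: "0 < e"
      obtain n where n: "\<And>k. k \<ge> n \<Longrightarrow> \<bar>g k x - g0 x\<bar> < e / 2"
        using LIMSEQ_D[OF elim(1), of "e/2"] e by auto
      have "\<bar>a k x - g0 x\<bar> < e" if k: "k \<ge> n" for k
      proof -
        have "g0 x - e / 2 \<le> a k x"
          unfolding a_def
        proof (rule cINF_greatest)
          fix j assume "j \<in> {k..}"
          then have "\<bar>g j x - g0 x\<bar> < e / 2" using n k by auto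
          then show "g0 x - e / 2 \<le> g j x" unfolding abs_less_iff by linarith
        qed auto
        moreover have "a k x \<le> g0 x + e / 2" using a(2)[OF elim(2), of k] n[OF k]
          unfolding abs_less_iff by linarith
        ultimately show ?thesis using e by (simp add: abs_less_iff)
      qed
      then show "\<exists>n. \<forall>k\<ge>n. norm (a k x - g0 x) < e" by auto
    qed
    then have "(\<lambda>k. \<bar>a k x\<bar>) \<longlonglongrightarrow> \<bar>g0 x\<bar>" by (rule tendsto_rabs)
    then show ?case using inc[OF elim(2)] a(1)[OF elim(2)] by simp
  qed
  then have "(\<lambda>k. X (a k)) \<longlonglongrightarrow> X g0" by (intro X_monotone_convergence) auto
  moreover have "X (a k) \<le> c" for k
    by (intro order_trans[OF X_mono le[of k]] AE_I2) (use a in \<open>auto intro: order_trans[OF _ abs_ge_self]\<close>)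
  ultimately show ?thesis by (intro LIMSEQ_le_const2) auto
qed

lemma X_convex_combination_le_1:
  assumes [measurable]: "g \<in> borel_measurable M" "g' \<in> borel_measurable M"
    and "X g \<le> 1" "X g' \<le> 1" "0 \<le> t" "t \<le> 1"
  shows "X (\<lambda>x. (1 - t) * g x + t * g' x) \<le> 1"
proof -
  have "X (\<lambda>x. (1 - t) * g x + t * g' x) \<le> X (\<lambda>x. (1 - t) * g x) + X (\<lambda>x. t * g' x)"
    by (intro X_add) measurable
  also have "\<dots> = ennreal (1 - t) * X g + ennreal t * X g'"
    using assms by (simp add: X_scale)
  also have "\<dots> \<le> ennreal (1 - t) * 1 + ennreal t * 1"
    using assms by (intro add_mono mult_left_mono) auto
  also have "\<dots> = 1" using assms by (simp flip: ennreal_plus)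
  finally show ?thesis .
qed

text \<open>The set of all \<open>g\<close> with \<open>0 \<le> g \<le> f\<close> in the unit ball has an element closest to \<open>f\<close> in the mean
  square sense. It is convex, so the parallelogram identity makes a minimizing sequence Cauchy; the
  rate \<open>8\<^bsup>-k\<^esup>\<close> makes it convergent a.e., and the Fatou property keeps the limit in the unit ball.
  The majorant \<open>f\<close>, bounded and supported in \<open>E\<close>, makes all integrals finite.\<close>
lemma nearest_point:
  fixes f :: "'a \<Rightarrow> real"
  assumes f [measurable]: "f \<in> borel_measurable M" "E \<in> sets M" and E: "emeasure M E < \<infinity>"
    and fb: "\<And>x. x \<in> space M \<Longrightarrow> 0 \<le> f x \<and> f x \<le> b * indicator E x"
  defines "U \<equiv> {g \<in> borel_measurable M. (\<forall>x\<in>space M. 0 \<le> g x \<and> g x \<le> f x) \<and> X g \<le> 1}"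
  obtains g0 where "g0 \<in> U" "\<And>g. g \<in> U \<Longrightarrow> (\<integral>x. (f x - g0 x)\<^sup>2 \<partial>M) \<le> (\<integral>x. (f x - g x)\<^sup>2 \<partial>M)"
proof -
  define D where "D g = (\<integral>x. (f x - g x)\<^sup>2 \<partial>M)" for g
  have f0: "f x = 0" if "x \<in> space M" "x \<notin> E" for x using fb[OF that(1)] that(2) by simp
  have int2: "integrable M (\<lambda>x. (g x - g' x)\<^sup>2)"
    if [measurable]: "g \<in> borel_measurable M" "g' \<in> borel_measurable M"
    and "\<And>x. x \<in> space M \<Longrightarrow> 0 \<le> g x \<and> g x \<le> f x" "\<And>x. x \<in> space M \<Longrightarrow> 0 \<le> g' x \<and> g' x \<le> f x" for g g'
  proof (rule integrable_bounded_on_finite[OF _ f(2) E, where b="b\<^sup>2"])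
    fix x assume x: "x \<in> space M"
    have "\<bar>g x - g' x\<bar> \<le> b * indicator E x" using that(3,4)[OF x] fb[OF x] by linarith
    then have "(g x - g' x)\<^sup>2 \<le> (b * indicator E x)\<^sup>2" by (metis abs_ge_zero power2_abs power_mono)
    then show "\<bar>(g x - g' x)\<^sup>2\<bar> \<le> b\<^sup>2 * indicator E x" by (cases "x \<in> E") auto
  qed measurable
  have UD: "g \<in> borel_measurable M" "\<And>x. x \<in> space M \<Longrightarrow> 0 \<le> g x \<and> g x \<le> f x" "X g \<le> 1" if "g \<in> U" for g
    using that by (auto simp: U_def)
  have ff: "\<And>x. x \<in> space M \<Longrightarrow> 0 \<le> f x \<and> f x \<le> f x" using fb by auto
  have intU: "integrable M (\<lambda>x. (f x - g x)\<^sup>2)" if "g \<in> U" for g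
    by (rule int2[OF f(1) UD(1)[OF that] ff UD(2)[OF that]])
  have D0: "0 \<le> D g" for g unfolding D_def by (intro integral_nonneg_AE) auto
  have "X (\<lambda>x. 0) = 0" by (subst X_eq_0_iff) auto
  then have zero: "(\<lambda>x. 0) \<in> U" using fb by (auto simp: U_def)
  define d where "d = (INF g\<in>U. D g)"
  have bdd: "bdd_below (D ` U)" by (intro bdd_belowI[of _ 0]) (use D0 in auto)
  have dD: "d \<le> D g" if "g \<in> U" for g unfolding d_def using bdd that by (rule cINF_lower)
  have "\<exists>g\<in>U. D g < d + (1/8) ^ k" for k :: nat
  proof -
    have "(INF g\<in>U. D g) < d + (1/8) ^ k" unfolding d_def by simp
    then show ?thesis using zero bdd by (subst (asm) cINF_less_iff) auto
  qed
  then obtain g where g: "\<And>k. g k \<in> U" "\<And>k. D (g k) < d + (1/8) ^ k" by metis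
  have [measurable]: "g k \<in> borel_measurable M" for k using g(1) UD(1) by blast
  have cauchy: "(\<integral>x. (g k x - g (Suc k) x)\<^sup>2 \<partial>M) \<le> 4 * (1/8) ^ k" for k
  proof -
    define m where "m x = (1 - 1/2) * g k x + 1/2 * g (Suc k) x" for x
    have mU: "m \<in> U"
      unfolding m_def[abs_def]
      using X_convex_combination_le_1[of "g k" "g (Suc k)" "1/2"] UD[OF g(1)[of k]] UD[OF g(1)[of "Suc k"]]
      by (fastforce simp: U_def)
    have "(\<integral>x. (g k x - g (Suc k) x)\<^sup>2 \<partial>M)
      = (\<integral>x. 2 * (f x - g k x)\<^sup>2 + 2 * (f x - g (Suc k) x)\<^sup>2 - 4 * (f x - m x)\<^sup>2 \<partial>M)"
      by (intro Bochner_Integration.integral_cong) (auto simp: m_def power2_eq_square field_simps)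
    also have "\<dots> = 2 * D (g k) + 2 * D (g (Suc k)) - 4 * D m"
      unfolding D_def using intU[OF g(1)[of k]] intU[OF g(1)[of "Suc k"]] intU[OF mU]
      by simp
    also have "\<dots> \<le> 2 * (d + (1/8) ^ k) + 2 * (d + (1/8) ^ Suc k) - 4 * d"
      by (intro diff_mono add_mono mult_left_mono less_imp_le[OF g(2)] dD[OF mU]) auto
    also have "\<dots> \<le> 4 * (1/8) ^ k" by simp
    finally show ?thesis .
  qed
  have L1: "(\<integral>\<^sup>+x. ennreal \<bar>g (Suc k) x - g k x\<bar> \<partial>M) \<le> ennreal ((1/2) ^ k * (measure M E + 4))" for k
  proof -
    have i2: "integrable M (\<lambda>x. (g k x - g (Suc k) x)\<^sup>2)" by (intro int2 UD g)
    have i1: "integrable M (\<lambda>x. (1/2) ^ k * indicator E x + 2 ^ k * (g k x - g (Suc k) x)\<^sup>2 :: real)"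
      using i2 E by (intro Bochner_Integration.integrable_add integrable_mult_right integrable_real_indicator) auto
    have "(\<integral>\<^sup>+x. ennreal \<bar>g (Suc k) x - g k x\<bar> \<partial>M)
      \<le> (\<integral>\<^sup>+x. ennreal ((1/2) ^ k * indicator E x + 2 ^ k * (g k x - g (Suc k) x)\<^sup>2) \<partial>M)"
    proof (intro nn_integral_mono ennreal_leI)
      fix x assume x: "x \<in> space M"
      show "\<bar>g (Suc k) x - g k x\<bar> \<le> (1/2) ^ k * indicator E x + 2 ^ k * (g k x - g (Suc k) x)\<^sup>2"
      proof (cases "x \<in> E")
        case False
        then have "g j x = 0" for j using UD(2)[OF g(1)[of j] x] f0[OF x] by simp
        then show ?thesis by simp
      next
        case True
        define y where "y = \<bar>g (Suc k) x - g k x\<bar>"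
        \<comment> \<open>\<open>y \<le> 2\<^bsup>-k\<^esup> + 2\<^sup>k y\<^sup>2\<close> passes from square to absolute integrals; both terms are summable\<close>
        have "0 \<le> (1/2) ^ k * (1 - 2 ^ k * y)\<^sup>2 + y" by (simp add: y_def)
        also have "\<dots> = (1/2) ^ k - 2 * ((1/2) ^ k * 2 ^ k) * y + ((1/2) ^ k * 2 ^ k) * 2 ^ k * y\<^sup>2 + y"
          by (simp add: power2_eq_square algebra_simps)
        also have "(1/2) ^ k * 2 ^ k = (1::real)" by (simp add: power_divide)
        finally have "y \<le> (1/2) ^ k + 2 ^ k * y\<^sup>2" by simp
        moreover have "y\<^sup>2 = (g k x - g (Suc k) x)\<^sup>2" by (simp add: y_def power2_commute)
        ultimately show ?thesis using True by (simp add: y_def)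
      qed
    qed
    also have "\<dots> = ennreal (\<integral>x. (1/2) ^ k * indicator E x + 2 ^ k * (g k x - g (Suc k) x)\<^sup>2 \<partial>M)"
      using i1 by (intro nn_integral_eq_integral) auto
    also have "(\<integral>x. (1/2) ^ k * indicator E x + 2 ^ k * (g k x - g (Suc k) x)\<^sup>2 \<partial>M)
      = (1/2) ^ k * measure M E + 2 ^ k * (\<integral>x. (g k x - g (Suc k) x)\<^sup>2 \<partial>M)"
      using i2 E by (subst Bochner_Integration.integral_add) auto
    also have "\<dots> \<le> (1/2) ^ k * measure M E + 2 ^ k * (4 * (1/8) ^ k)"
      using cauchy[of k] by (intro add_left_mono mult_left_mono) auto
    also have "2 ^ k * (4 * (1/8) ^ k) = 4 * ((1/4) ^ k :: real)"
      by (simp add: power_mult_distrib[symmetric] mult.left_commute)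
    also have "(1/2) ^ k * measure M E + 4 * (1/4) ^ k \<le> (1/2) ^ k * (measure M E + 4)"
      using power_mono[of "1/4::real" "1/2" k] by (simp add: distrib_left)
    finally show ?thesis by (simp add: ennreal_leI)
  qed
  have "(\<integral>\<^sup>+x. (\<Sum>k. ennreal \<bar>g (Suc k) x - g k x\<bar>) \<partial>M) = (\<Sum>k. \<integral>\<^sup>+x. ennreal \<bar>g (Suc k) x - g k x\<bar> \<partial>M)"
    by (intro nn_integral_suminf) measurable
  also have "\<dots> \<le> (\<Sum>k. ennreal ((1/2) ^ k * (measure M E + 4)))" by (intro suminf_le L1) auto
  also have "\<dots> = ennreal (\<Sum>k. (1/2) ^ k * (measure M E + 4))"
    by (intro suminf_ennreal2 summable_mult2) auto
  finally have "(\<integral>\<^sup>+x. (\<Sum>k. ennreal \<bar>g (Suc k) x - g k x\<bar>) \<partial>M) \<noteq> \<infinity>" by (auto simp: top_unique)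
  then have "AE x in M. (\<Sum>k. ennreal \<bar>g (Suc k) x - g k x\<bar>) \<noteq> \<infinity>"
    by (intro nn_integral_PInf_AE) auto
  then have conv: "AE x in M. convergent (\<lambda>k. g k x)"
  proof eventually_elim
    case (elim x)
    then have "summable (\<lambda>k. \<bar>g (Suc k) x - g k x\<bar>)" by (intro summable_suminf_not_top) auto
    then have "summable (\<lambda>k. g (Suc k) x - g k x)" by (rule summable_rabs_cancel)
    then have "convergent (\<lambda>n. \<Sum>k<n. g (Suc k) x - g k x)" by (simp add: summable_iff_convergent)
    then have "convergent (\<lambda>n. g n x - g 0 x)" by (simp only: sum_lessThan_telescope[of "\<lambda>k. g k x"])
    then have "convergent (\<lambda>n. (g n x - g 0 x) + g 0 x)" by (intro convergent_add convergent_const)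
    then show ?case by simp
  qed
  \<comment> \<open>clamped, so that the bounds hold also where the sequence diverges\<close>
  define g0 where "g0 x = max 0 (min (f x) (lim (\<lambda>k. g k x)))" for x
  have [measurable]: "g0 \<in> borel_measurable M" unfolding g0_def by measurable
  have lim: "AE x in M. (\<lambda>k. g k x) \<longlonglongrightarrow> g0 x"
    using conv AE_space
  proof eventually_elim
    case (elim x)
    then have l: "(\<lambda>k. g k x) \<longlonglongrightarrow> lim (\<lambda>k. g k x)" by (simp add: convergent_LIMSEQ_iff)
    have "0 \<le> lim (\<lambda>k. g k x)" "lim (\<lambda>k. g k x) \<le> f x"
      using UD(2)[OF g(1) elim(2)] by (auto intro: LIMSEQ_le_const[OF l] LIMSEQ_le_const2[OF l])
    then show ?case using l by (simp add: g0_def)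
  qed
  have "X g0 \<le> 1"
    by (rule X_liminf_le[OF _ _ _ lim]) (use g(1) UD in auto)
  then have g0U: "g0 \<in> U" using fb by (auto simp: U_def g0_def)
  have "(\<lambda>k. D (g k)) \<longlonglongrightarrow> D g0"
    unfolding D_def
  proof (rule integral_dominated_convergence[where w="\<lambda>x. (f x - 0)\<^sup>2"])
    show "integrable M (\<lambda>x. (f x - 0)\<^sup>2)" using zero UD[OF zero] ff by (intro int2) auto
    show "AE x in M. (\<lambda>k. (f x - g k x)\<^sup>2) \<longlonglongrightarrow> (f x - g0 x)\<^sup>2"
      using lim by eventually_elim (intro tendsto_intros)
    show "AE x in M. norm ((f x - g k x)\<^sup>2) \<le> (f x - 0)\<^sup>2" for k
      using UD(2)[OF g(1)] by (intro AE_I2) (auto intro!: power_mono)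
  qed measurable
  moreover have "(\<lambda>k. d + (1/8) ^ k) \<longlonglongrightarrow> d + 0" by (intro tendsto_intros LIMSEQ_power_zero) auto
  ultimately have "D g0 \<le> d + 0" using g(2) by (intro LIMSEQ_le) (auto intro: less_imp_le)
  then have "D g0 \<le> D g" if "g \<in> U" for g using dD[OF that] by simp
  with g0U show ?thesis unfolding D_def by (rule that)
qed

text \<open>Hilbert space separation of \<open>f\<close> from the unit ball. If \<open>g0\<close> is the nearest point and \<open>h = f - g0\<close>,
  then \<open>\<integral> h k \<le> \<integral> h g0\<close> for bounded \<open>k \<ge> 0\<close> in the ball that vanish off \<open>E\<close>, and hence, by
  truncation, for all \<open>\<bar>g\<bar>\<close> with \<open>g\<close> in the ball, whereas \<open>\<integral> h f = \<integral> h g0 + \<integral> h\<^sup>2\<close> is strictly larger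
  because \<open>f\<close> is outside the ball. Dividing \<open>h\<close> by a number between the two values gives the
  functional.\<close>
lemma separation:
  fixes f :: "'a \<Rightarrow> real"
  assumes f [measurable]: "f \<in> borel_measurable M" "E \<in> sets M" and E: "emeasure M E < \<infinity>"
    and fb: "\<And>x. x \<in> space M \<Longrightarrow> 0 \<le> f x \<and> f x \<le> b * indicator E x" and Xf: "1 < X f"
  obtains h where "h \<in> borel_measurable M" "associate h \<le> 1" "1 < (\<integral>\<^sup>+x. ennreal (f x) * h x \<partial>M)"
proof -
  obtain g0 where g0: "g0 \<in> borel_measurable M" "\<And>x. x \<in> space M \<Longrightarrow> 0 \<le> g0 x \<and> g0 x \<le> f x" "X g0 \<le> 1"
    and near: "\<And>g. g \<in> borel_measurable M \<Longrightarrow> (\<And>x. x \<in> space M \<Longrightarrow> 0 \<le> g x \<and> g x \<le> f x) \<Longrightarrow> X g \<le> 1 \<Longrightarrow>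
      (\<integral>x. (f x - g0 x)\<^sup>2 \<partial>M) \<le> (\<integral>x. (f x - g x)\<^sup>2 \<partial>M)"
    by (rule nearest_point[OF f E fb]) blast+
  note g0(1)[measurable]
  define h where "h x = f x - g0 x" for x
  have [measurable]: "h \<in> borel_measurable M" unfolding h_def by measurable
  have h: "0 \<le> h x" "h x \<le> b * indicator E x" if "x \<in> space M" for x
    using g0(2)[OF that] fb[OF that] by (auto simp: h_def)
  \<comment> \<open>products of functions that are bounded and vanish off \<open>E\<close>\<close>
  have intp: "integrable M (\<lambda>x. y x * z x)"
    if [measurable]: "y \<in> borel_measurable M" "z \<in> borel_measurable M"
      and y: "\<And>x. x \<in> space M \<Longrightarrow> \<bar>y x\<bar> \<le> c * indicator E x"
      and z: "\<And>x. x \<in> space M \<Longrightarrow> \<bar>z x\<bar> \<le> c' * indicator E x" for y z and c c' :: real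
  proof (rule integrable_bounded_on_finite[OF _ f(2) E, where b="c * c'"])
    fix x assume x: "x \<in> space M"
    have "\<bar>y x * z x\<bar> \<le> (c * indicator E x) * (c' * indicator E x)"
      unfolding abs_mult using y[OF x] z[OF x] by (intro mult_mono) (auto intro: order_trans[OF abs_ge_zero])
    then show "\<bar>y x * z x\<bar> \<le> c * c' * indicator E x" by (cases "x \<in> E") auto
  qed measurable
  have hb: "\<bar>h x\<bar> \<le> b * indicator E x" "\<bar>g0 x\<bar> \<le> b * indicator E x" "\<bar>f x\<bar> \<le> b * indicator E x"
    if "x \<in> space M" for x using h[OF that] g0(2)[OF that] fb[OF that] by auto
  have variation: "(\<integral>x. h x * k x \<partial>M) \<le> (\<integral>x. h x * g0 x \<partial>M)"
    if [measurable]: "k \<in> borel_measurable M" and k: "\<And>x. x \<in> space M \<Longrightarrow> 0 \<le> k x \<and> k x \<le> c * indicator E x"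
      and Xk: "X k \<le> 1" for k c
  proof -
    define e where "e x = k x - g0 x" for x
    have [measurable]: "e \<in> borel_measurable M" unfolding e_def by measurable
    have eb: "\<bar>e x\<bar> \<le> (b + c) * indicator E x" if "x \<in> space M" for x
      using k[OF that] hb(2)[OF that] by (cases "x \<in> E") (auto simp: e_def)
    have ihh: "integrable M (\<lambda>x. h x * h x)" using hb(1) hb(1) by (intro intp) auto
    have ihe: "integrable M (\<lambda>x. h x * e x)" using hb(1) eb by (intro intp) auto
    have iee: "integrable M (\<lambda>x. e x * e x)" using eb eb by (intro intp) auto
    have ihk: "integrable M (\<lambda>x. h x * k x)" using hb(1) k by (intro intp) auto
    have ihg: "integrable M (\<lambda>x. h x * g0 x)" using hb(1) hb(2) by (intro intp) auto
    let ?A = "\<integral>x. h x * e x \<partial>M" and ?B = "\<integral>x. e x * e x \<partial>M"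
    have step: "2 * ?A \<le> t * ?B" if t: "0 < t" "t \<le> 1" for t
    proof -
      \<comment> \<open>the competitor must stay below \<open>f\<close>; cutting it off there only brings it closer to \<open>f\<close>\<close>
      define y where "y x = min (f x) ((1 - t) * g0 x + t * k x)" for x
      have [measurable]: "y \<in> borel_measurable M" unfolding y_def by measurable
      have y0: "0 \<le> (1 - t) * g0 x + t * k x" if "x \<in> space M" for x
        using g0(2)[OF that] k[OF that] t by (intro add_nonneg_nonneg mult_nonneg_nonneg) auto
      have y: "0 \<le> y x \<and> y x \<le> f x" if "x \<in> space M" for x
        using y0[OF that] fb[OF that] by (auto simp: y_def)
      have "X y \<le> X (\<lambda>x. (1 - t) * g0 x + t * k x)"
        using y0 fb by (intro X_mono AE_I2) (auto simp: y_def)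
      also have "\<dots> \<le> 1" using g0 Xk t by (intro X_convex_combination_le_1) auto
      finally have "(\<integral>x. (f x - g0 x)\<^sup>2 \<partial>M) \<le> (\<integral>x. (f x - y x)\<^sup>2 \<partial>M)" using y by (intro near) auto
      also have "\<dots> \<le> (\<integral>x. (h x * h x - 2 * t * (h x * e x)) + t * t * (e x * e x) \<partial>M)"
      proof (rule integral_mono)
        show "integrable M (\<lambda>x. (h x * h x - 2 * t * (h x * e x)) + t * t * (e x * e x))"
          using ihh ihe iee by (intro Bochner_Integration.integrable_add Bochner_Integration.integrable_diff integrable_mult_right)
        have yb: "\<bar>f x - y x\<bar> \<le> b * indicator E x" if "x \<in> space M" for x
          using y[OF that] fb[OF that] by auto
        show "integrable M (\<lambda>x. (f x - y x)\<^sup>2)"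
          unfolding power2_eq_square using yb yb by (intro intp) auto
        fix x assume x: "x \<in> space M"
        define z where "z = (1 - t) * g0 x + t * k x"
        have "(f x - y x)\<^sup>2 \<le> (f x - z)\<^sup>2" unfolding y_def z_def[symmetric] by (auto simp: min_def)
        also have "f x - z = h x - t * e x" by (simp add: h_def e_def z_def algebra_simps)
        finally show "(f x - y x)\<^sup>2 \<le> (h x * h x - 2 * t * (h x * e x)) + t * t * (e x * e x)"
          by (simp add: power2_eq_square algebra_simps)
      qed
      also have "\<dots> = (\<integral>x. h x * h x \<partial>M) - 2 * t * ?A + t * t * ?B"
        using ihh ihe iee by simp
      finally have "t * (2 * ?A) \<le> t * (t * ?B)"
        by (simp add: h_def[symmetric] power2_eq_square mult.assoc)
      then show ?thesis using t by simp
    qed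
    have "2 * ?A \<le> 0"
    proof (rule tendsto_lowerbound)
      show "((\<lambda>t. t * ?B) \<longlongrightarrow> 0) (at_right 0)" by (auto intro!: tendsto_eq_intros)
      have "eventually (\<lambda>t::real. 0 < t \<and> t \<le> 1) (at_right 0)"
        using eventually_at_right_less[of 0] eventually_at_right_real[of 0 1]
        by (auto elim!: eventually_elim2)
      then show "eventually (\<lambda>t. 2 * ?A \<le> t * ?B) (at_right 0)"
        by (rule eventually_mono) (use step in auto)
    qed simp
    moreover have "?A = (\<integral>x. h x * k x \<partial>M) - (\<integral>x. h x * g0 x \<partial>M)"
      unfolding e_def right_diff_distrib by (intro Bochner_Integration.integral_diff ihk ihg)
    ultimately show ?thesis by simp
  qed
  have ihf: "integrable M (\<lambda>x. h x * f x)" using hb(1) hb(3) by (intro intp) auto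
  have ihg: "integrable M (\<lambda>x. h x * g0 x)" using hb(1) hb(2) by (intro intp) auto
  have ihh: "integrable M (\<lambda>x. h x * h x)" using hb(1) hb(1) by (intro intp) auto
  define c where "c = (\<integral>x. h x * g0 x \<partial>M)"
  define B where "B = (\<integral>x. h x * f x \<partial>M)"
  have c0: "0 \<le> c" unfolding c_def using h(1) g0(2) by (intro integral_nonneg_AE AE_I2) auto
  have "B - c = (\<integral>x. h x * h x \<partial>M)"
    unfolding B_def c_def using ihf ihg
    by (subst Bochner_Integration.integral_diff[symmetric]) (auto simp: h_def algebra_simps)
  moreover have "0 < (\<integral>x. h x * h x \<partial>M)"
  proof (rule ccontr)
    assume "\<not> ?thesis"
    moreover have "0 \<le> (\<integral>x. h x * h x \<partial>M)" by (intro integral_nonneg_AE) auto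
    ultimately have "(\<integral>x. h x * h x \<partial>M) = 0" by simp
    then have "AE x in M. h x * h x = 0"
      by (subst (asm) integral_nonneg_eq_0_iff_AE[OF ihh]) auto
    then have "AE x in M. \<bar>f x\<bar> \<le> \<bar>g0 x\<bar>" by (auto simp: h_def elim: AE_mp)
    then have "X f \<le> X g0" by (intro X_mono) auto
    with g0(3) Xf show False by (auto dest: order_trans)
  qed
  ultimately have "c < B" by simp
  \<comment> \<open>strictly above \<open>c\<close>, since \<open>c\<close> itself may vanish\<close>
  then obtain l where l: "c < l" "l < B" using dense by blast
  with c0 have l0: "0 < l" by simp
  define H where "H x = ennreal (h x / l)" for x
  show ?thesis
  proof (rule that[of H])
    show [measurable]: "H \<in> borel_measurable M" unfolding H_def by measurable
    show "associate H \<le> 1"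
    proof (rule associate_leI)
      fix g :: "'a \<Rightarrow> real" assume [measurable]: "g \<in> borel_measurable M" and Xg: "X g \<le> 1"
      have "(\<integral>\<^sup>+x. H x * ennreal \<bar>g x\<bar> \<partial>M) = (\<integral>\<^sup>+x. ennreal \<bar>g x\<bar> * H x \<partial>M)" by (simp add: mult.commute)
      also have "\<dots> = (SUP n. \<integral>\<^sup>+x. min (ennreal \<bar>g x\<bar>) (of_nat n) * H x \<partial>M)"
        using nn_integral_SUP_truncate[of "\<lambda>_. space M" M "\<lambda>x. ennreal \<bar>g x\<bar>" H]
        by (simp add: truncate_def incseq_def cong: nn_integral_cong_simp)
      also have "\<dots> \<le> 1"
      proof (rule SUP_least)
        fix n :: nat
        define k where "k x = min \<bar>g x\<bar> (real n) * indicator E x" for x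
        have [measurable]: "k \<in> borel_measurable M" unfolding k_def by measurable
        have k: "0 \<le> k x \<and> k x \<le> real n * indicator E x" for x by (auto simp: k_def indicator_def)
        have "X k \<le> X g" by (intro X_mono AE_I2) (auto simp: k_def indicator_def)
        with Xg have Xk: "X k \<le> 1" by simp
        have ihk: "integrable M (\<lambda>x. h x * k x)" using hb(1) k by (intro intp) auto
        have "(\<integral>\<^sup>+x. min (ennreal \<bar>g x\<bar>) (of_nat n) * H x \<partial>M) = (\<integral>\<^sup>+x. ennreal (h x * k x / l) \<partial>M)"
        proof (rule nn_integral_cong)
          fix x assume x: "x \<in> space M"
          show "min (ennreal \<bar>g x\<bar>) (of_nat n) * H x = ennreal (h x * k x / l)"
          proof (cases "x \<in> E")
            case True
            then have "min (ennreal \<bar>g x\<bar>) (of_nat n) = ennreal (k x)"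
              by (simp add: k_def ennreal_of_nat_eq_real_of_nat min_def)
            then show ?thesis using h[OF x] l0 k[of x] by (simp add: H_def mult.commute flip: ennreal_mult)
          next
            case False
            then have "h x = 0" using h[OF x] by simp
            then show ?thesis by (simp add: H_def)
          qed
        qed
        also have "\<dots> = ennreal (\<integral>x. h x * k x / l \<partial>M)"
          using ihk h(1) k l0 by (intro nn_integral_eq_integral AE_I2) auto
        also have "\<dots> \<le> ennreal (c / l)"
          using variation[OF _ k Xk] l0 by (intro ennreal_leI) (simp add: c_def divide_right_mono)
        also have "\<dots> \<le> 1" using l l0 by simp
        finally show "(\<integral>\<^sup>+x. min (ennreal \<bar>g x\<bar>) (of_nat n) * H x \<partial>M) \<le> 1" .
      qed
      finally show "(\<integral>\<^sup>+x. H x * ennreal \<bar>g x\<bar> \<partial>M) \<le> 1" .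
    qed
    have "(\<integral>\<^sup>+x. ennreal (f x) * H x \<partial>M) = (\<integral>\<^sup>+x. ennreal (h x * f x / l) \<partial>M)"
      using fb h l0 by (intro nn_integral_cong) (simp add: H_def mult.commute flip: ennreal_mult)
    also have "\<dots> = ennreal (\<integral>x. h x * f x / l \<partial>M)"
      using ihf h(1) fb l0 by (intro nn_integral_eq_integral AE_I2) auto
    also have "\<dots> = ennreal (B / l)" by (simp add: B_def)
    finally show "1 < (\<integral>\<^sup>+x. ennreal (f x) * H x \<partial>M)" using l l0 by simp
  qed
qed

text \<open>\<open>X'' = X\<close> in the direction that matters: an upper bound for all pairings with the unit ball of
  the associate space is an upper bound for the norm. By the monotone convergence axiom it is enough
  to consider bounded functions on sets of finite measure, to which \<open>separation\<close> applies.\<close>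
lemma Lorentz_Luxemburg:
  assumes [measurable]: "F \<in> borel_measurable M"
    and le: "\<And>h. h \<in> borel_measurable M \<Longrightarrow> associate h \<le> 1 \<Longrightarrow> (\<integral>\<^sup>+x. F x * h x \<partial>M) \<le> c"
  shows "ext_norm X F \<le> c"
  unfolding ext_norm_def
proof (rule SUP_least)
  fix n
  define f where "f x = enn2real (min (F x) (of_nat n))" for x
  have [measurable]: "f \<in> borel_measurable M" unfolding f_def by measurable
  have ff: "ennreal (f x) = min (F x) (of_nat n)" for x by (simp add: f_def ennreal_enn2real_min)
  have fn: "0 \<le> f x" "f x \<le> real n" for x
  proof -
    show "0 \<le> f x" by (simp add: f_def)
    have "ennreal (f x) \<le> ennreal (real n)" by (simp add: ff flip: ennreal_of_nat_eq_real_of_nat)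
    then show "f x \<le> real n" by simp
  qed
  obtain E where E: "incseq E" "\<And>n. E n \<in> sets M" "(\<Union>n. E n) = space M"
    "\<And>n. emeasure M (E n) < \<infinity>" using finite_exhaustion by blast
  note E(2)[measurable]
  have bound: "X (\<lambda>x. f x * indicator (E j) x) \<le> c" for j
  proof (rule ccontr)
    assume "\<not> ?thesis"
    then have "c < X (\<lambda>x. f x * indicator (E j) x)" by simp
    then obtain r' where r': "c < r'" "r' < X (\<lambda>x. f x * indicator (E j) x)" using dense by blast
    then obtain r where r: "0 < r" "r' = ennreal r"
      by (cases r' rule: ennreal_zero_pos_top_cases) auto
    let ?\<phi> = "\<lambda>x. 1/r * (f x * indicator (E j) x)"
    have "ennreal (1/r) * ennreal r < ennreal (1/r) * X (\<lambda>x. f x * indicator (E j) x)"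
      using r' r by (intro ennreal_mult_strict_left_mono) auto
    moreover have "ennreal (1/r) * ennreal r = 1" using r by (simp flip: ennreal_mult)
    moreover have "X ?\<phi> = ennreal (1/r) * X (\<lambda>x. f x * indicator (E j) x)"
      using r by (subst X_scale) auto
    ultimately have "1 < X ?\<phi>" by simp
    then obtain h where [measurable]: "h \<in> borel_measurable M" and h: "associate h \<le> 1"
      and gt: "1 < (\<integral>\<^sup>+x. ennreal (?\<phi> x) * h x \<partial>M)"
      using separation[of ?\<phi> "E j" "real n / r"] E(4) fn r
      by (auto simp: indicator_def divide_right_mono)
    have "ennreal r * (\<integral>\<^sup>+x. ennreal (?\<phi> x) * h x \<partial>M) = (\<integral>\<^sup>+x. ennreal r * (ennreal (?\<phi> x) * h x) \<partial>M)"
      by (intro nn_integral_cmult[symmetric]) measurable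
    also have "\<dots> \<le> (\<integral>\<^sup>+x. F x * h x \<partial>M)"
    proof (rule nn_integral_mono)
      fix x
      have "ennreal r * ennreal (?\<phi> x) = ennreal (f x * indicator (E j) x)"
        using r fn[of x] by (simp flip: ennreal_mult)
      also have "\<dots> \<le> F x" using ff[of x] by (simp add: indicator_def)
      finally show "ennreal r * (ennreal (?\<phi> x) * h x) \<le> F x * h x"
        by (simp add: mult.assoc[symmetric] mult_right_mono)
    qed
    also have "\<dots> \<le> c" using h by (intro le) auto
    also have "c < ennreal r" using r' r by simp
    finally have "ennreal r * (\<integral>\<^sup>+x. ennreal (?\<phi> x) * h x \<partial>M) < ennreal r" .
    moreover have "ennreal r * 1 \<le> ennreal r * (\<integral>\<^sup>+x. ennreal (?\<phi> x) * h x \<partial>M)"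
      using gt by (intro mult_left_mono) auto
    ultimately show False by (simp add: leD)
  qed
  have "(\<lambda>j. X (\<lambda>x. f x * indicator (E j) x)) \<longlonglongrightarrow> X f"
  proof (rule X_monotone_convergence)
    show "AE x in M. incseq (\<lambda>j. \<bar>f x * indicator (E j) x\<bar>) \<and>
      (\<lambda>j. \<bar>f x * indicator (E j) x\<bar>) \<longlonglongrightarrow> \<bar>f x\<bar>"
    proof (intro AE_I2 conjI)
      fix x assume x: "x \<in> space M"
      show "incseq (\<lambda>j. \<bar>f x * indicator (E j) x\<bar>)"
        using E(1) fn[of x] by (auto simp: incseq_def indicator_def)
      obtain j0 where "x \<in> E j0" using E(3) x by auto
      then have "x \<in> E j" if "j \<ge> j0" for j using E(1) that by (auto simp: incseq_def)
      then have "\<bar>f x * indicator (E j) x\<bar> = \<bar>f x\<bar>" if "j \<ge> j0" for j using that by simp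
      then show "(\<lambda>j. \<bar>f x * indicator (E j) x\<bar>) \<longlonglongrightarrow> \<bar>f x\<bar>"
        by (intro tendsto_eventually eventually_sequentiallyI)
    qed
  qed measurable
  then show "X (\<lambda>x. enn2real (min (F x) (of_nat n))) \<le> c"
    unfolding f_def[symmetric] using bound by (intro LIMSEQ_le_const2) auto
qed

end

section \<open>Vector-valued inequalities and function spaces\<close>

text \<open>Turns the sum over an index set into a series, for which monotone convergence is available.\<close>
lemma infsum_ennreal_eq_suminf:
  fixes a :: "nat \<Rightarrow> ennreal"
  shows "(\<Sum>\<^sub>\<infinity>j\<in>J. a j) = (\<Sum>j. if j \<in> J then a j else 0)"
proof -
  have "(\<Sum>\<^sub>\<infinity>j\<in>J. a j) = (\<Sum>\<^sub>\<infinity>j. if j \<in> J then a j else 0)"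
    by (intro infsum_cong_neutral) auto
  moreover have "((\<lambda>j. if j \<in> J then a j else 0) has_sum (\<Sum>\<^sub>\<infinity>j. if j \<in> J then a j else 0)) UNIV"
    by (intro has_sum_infsum nonneg_summable_on_complete) simp
  then have "(\<lambda>j. if j \<in> J then a j else 0) sums (\<Sum>\<^sub>\<infinity>j. if j \<in> J then a j else 0)"
    by (rule has_sum_imp_sums)
  ultimately show ?thesis by (simp add: sums_iff)
qed

lemma nn_integral_infsum_mult:
  assumes "\<And>j. j \<in> J \<Longrightarrow> a j \<in> borel_measurable M" and [measurable]: "w \<in> borel_measurable M"
  shows "(\<integral>\<^sup>+x. (\<Sum>\<^sub>\<infinity>j\<in>(J::nat set). a j x) * w x \<partial>M) = (\<Sum>j. if j \<in> J then \<integral>\<^sup>+x. a j x * w x \<partial>M else 0)"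
proof -
  have [measurable]: "(\<lambda>x. if j \<in> J then a j x else 0) \<in> borel_measurable M" for j
    using assms(1) by (cases "j \<in> J") auto
  have "(\<integral>\<^sup>+x. (\<Sum>\<^sub>\<infinity>j\<in>J. a j x) * w x \<partial>M) = (\<integral>\<^sup>+x. (\<Sum>j. (if j \<in> J then a j x else 0) * w x) \<partial>M)"
    by (simp add: infsum_ennreal_eq_suminf ennreal_suminf_multc)
  also have "\<dots> = (\<Sum>j. \<integral>\<^sup>+x. (if j \<in> J then a j x else 0) * w x \<partial>M)"
    by (intro nn_integral_suminf) measurable
  also have "\<dots> = (\<Sum>j. if j \<in> J then \<integral>\<^sup>+x. a j x * w x \<partial>M else 0)"
    by (intro arg_cong[where f=suminf] ext) simp
  finally show ?thesis .
qed

lemma borel_measurable_infsum_ennreal: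
  assumes "\<And>j. j \<in> J \<Longrightarrow> a j \<in> borel_measurable M"
  shows "(\<lambda>x. \<Sum>\<^sub>\<infinity>j\<in>(J::nat set). a j x :: ennreal) \<in> borel_measurable M"
proof -
  have [measurable]: "(\<lambda>x. if j \<in> J then a j x else 0) \<in> borel_measurable M" for j
    using assms by (cases "j \<in> J") auto
  show ?thesis unfolding infsum_ennreal_eq_suminf by measurable
qed

definition lq_family ::
    "real \<Rightarrow> (('a \<Rightarrow> ennreal) \<times> ('a \<Rightarrow> ennreal)) set \<Rightarrow> (('a \<Rightarrow> ennreal) \<times> ('a \<Rightarrow> ennreal)) set" where
  "lq_family q \<F> = {(\<lambda>x. (\<Sum>\<^sub>\<infinity>j\<in>J. f j x epowr q) epowr (1/q),
      \<lambda>x. (\<Sum>\<^sub>\<infinity>j\<in>J. g j x epowr q) epowr (1/q))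
    | (J::nat set) f g. \<forall>j\<in>J. (f j, g j) \<in> \<F>}"

lemma extrapolation_family_lq:
  assumes "extrapolation_family M \<F>"
  shows "extrapolation_family M (lq_family q \<F>)"
  using assms unfolding extrapolation_family_def lq_family_def
  by (fastforce intro!: borel_measurable_epowr borel_measurable_infsum_ennreal)

lemma weighted_bound_lq:
  assumes \<F>: "extrapolation_family M \<F>" and q: "0 < q" and wb: "weighted_bound M \<B> \<F> q"
  shows "weighted_bound M \<B> (lq_family q \<F>) q"
  unfolding weighted_bound_def
proof (intro allI impI ballI)
  fix r w assume r: "1 < (r::real)" and w: "w \<in> A_class M \<B> r"
  have [measurable]: "w \<in> borel_measurable M" using w by (simp add: A_class_def weight_def)
  obtain C where C: "C < \<infinity>" "\<And>f g. (f, g) \<in> \<F> \<Longrightarrow>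
    (\<integral>\<^sup>+x. f x epowr q * w x \<partial>M) \<le> C * (\<integral>\<^sup>+x. g x epowr q * w x \<partial>M)"
    by (rule weighted_boundD[OF wb r w]) (rule that)
  have "(\<integral>\<^sup>+x. (\<Sum>\<^sub>\<infinity>j\<in>J. f j x epowr q) * w x \<partial>M) \<le> C * (\<integral>\<^sup>+x. (\<Sum>\<^sub>\<infinity>j\<in>J. g j x epowr q) * w x \<partial>M)"
    if J: "\<forall>j\<in>J. (f j, g j) \<in> \<F>" for J :: "nat set" and f g
  proof -
    have m: "f j \<in> borel_measurable M" "g j \<in> borel_measurable M" if "j \<in> J" for j
      using \<F> J that by (auto simp: extrapolation_family_def)
    have "(\<Sum>j. if j \<in> J then \<integral>\<^sup>+x. f j x epowr q * w x \<partial>M else 0)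
      \<le> (\<Sum>j. C * (if j \<in> J then \<integral>\<^sup>+x. g j x epowr q * w x \<partial>M else 0))"
      using C(2) J by (intro suminf_le) auto
    then show ?thesis using m by (simp add: nn_integral_infsum_mult borel_measurable_epowr)
  qed
  then show "\<exists>C<\<infinity>. \<forall>(f, g)\<in>lq_family q \<F>.
      (\<integral>\<^sup>+x. f x epowr q * w x \<partial>M) \<le> C * (\<integral>\<^sup>+x. g x epowr q * w x \<partial>M)"
    using C(1) q by (intro exI[of _ C]) (auto simp: lq_family_def epowr_epowr)
qed

lemma ennreal_divide_mult_cancel:
  assumes "0 < y" "y < \<infinity>"
  shows "x / y * y = (x::ennreal)" "x * y / y = x"
  using assms by (auto simp: ennreal_divide_times ennreal_mult_divide_eq ennreal_times_divide[symmetric] divide_self)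

text \<open>The extrapolation argument for \<open>N h = X'(h u\<^bsup>-1\<^esup>)\<close>. The hypothesis on the dual maximal operator,
  stated for real functions, provides the majorants for \<open>[0,\<infinity>]\<close>-valued \<open>h\<close> since functions of finite
  norm are finite a.e. Hoelder's inequality for \<open>X\<close> and \<open>X'\<close> bounds \<open>\<integral> g H v\<close>, and the
  Lorentz--Luxemburg theorem turns the tested inequality into one for \<open>X\<close>.\<close>
lemma weighted_bound_imp_function_norm_bound:
  fixes u v :: "'a \<Rightarrow> ennreal" and X :: "('a \<Rightarrow> real) \<Rightarrow> ennreal" and K :: real
  assumes sf: "sigma_finite_measure M" and basis: "mbasis M \<B>"
    and \<F>: "extrapolation_family M \<F>" and u: "weight M u" and v: "weight M v"
    and X: "function_norm (density M v) X"
    and maj: "\<And>h :: 'a \<Rightarrow> real. h \<in> borel_measurable M \<Longrightarrow>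
           outer_norm M (ext_norm (assoc_norm (density M v) X)) (\<lambda>x. dual_maximal M \<B> v h x / u x)
             \<le> ennreal K * ext_norm (assoc_norm (density M v) X) (\<lambda>x. ennreal \<bar>h x\<bar> / u x)"
    and wb: "weighted_bound M \<B> \<F> p"
  shows "\<exists>C::real. \<forall>(f, g)\<in>\<F>.
    ext_norm X (\<lambda>x. f x epowr p * u x) \<le> ennreal C * ext_norm X (\<lambda>x. g x epowr p * u x)"
proof -
  let ?\<nu> = "density M v"
  interpret D: sigma_finite_measure ?\<nu>
    using sf v by (rule sigma_finite_density_weight)
  interpret D: banach_function_norm ?\<nu> X
    using X by unfold_locales
  note weightD(1)[OF u, measurable] weightD(1)[OF v, measurable]
  note AE_v = AE_density_weight[OF v]
  have u_AE: "AE x in M. 0 < u x \<and> u x < \<infinity>" and v_AE: "AE x in M. 0 < v x \<and> v x < \<infinity>"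
    using weightD(2) u v by auto
  define N where "N = dual_norm ?\<nu> ((\<lambda>k x. k x / u x) ` unit_ball ?\<nu> X)"
  have N: "N h = D.associate (\<lambda>x. h x / u x)" for h
    by (simp add: N_def dual_norm_def image_image divide_ennreal_def ac_simps)
  have gauge: "gauge M N"
    unfolding N_def
  proof (rule gauge_dual_norm)
    fix F :: "'a \<Rightarrow> ennreal" assume [measurable]: "F \<in> borel_measurable M"
      and "dual_norm ?\<nu> ((\<lambda>k x. k x / u x) ` unit_ball ?\<nu> X) F < \<infinity>"
    then have "AE x in M. F x / u x < \<infinity>"
      using D.associate_finite_AE[of "\<lambda>x. F x / u x"] by (simp add: AE_v flip: N_def N)
    with u_AE show "AE x in M. F x < \<infinity>"
      by eventually_elim (auto simp: less_top[symmetric] ennreal_top_divide)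
  next
    obtain h where [measurable]: "h \<in> borel_measurable M"
      and h: "AE x in M. 0 < h x" "D.associate h < \<infinity>"
      using D.associate_positive by (auto simp: AE_v)
    have "D.associate (\<lambda>x. h x * u x / u x) = D.associate h"
    proof (rule D.associate_cong_AE)
      show "AE x in ?\<nu>. h x * u x / u x = h x"
        unfolding AE_v using u_AE by eventually_elim (simp add: ennreal_divide_mult_cancel)
    qed
    then have "N (\<lambda>x. h x * u x) < \<infinity>" using h by (simp add: N)
    moreover have "AE x in M. 0 < h x * u x"
      using h(1) u_AE by eventually_elim (simp add: ennreal_zero_less_mult_iff)
    ultimately show "\<exists>h\<in>borel_measurable M. (AE x in M. 0 < h x) \<and>
      dual_norm ?\<nu> ((\<lambda>k x. k x / u x) ` unit_ball ?\<nu> X) h < \<infinity>"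
      unfolding N_def[symmetric] by (intro bexI[of _ "\<lambda>x. h x * u x"]) auto
  qed (auto simp: AE_v unit_ball_def)
  interpret gauge M N by (rule gauge)
  have majorant: "\<exists>G\<in>borel_measurable M. N G \<le> ennreal (max 0 K + 1) * N h \<and>
      (AE x in M. maximal M \<B> (\<lambda>y. h y * v y) x \<le> G x * v x)"
    if [measurable]: "h \<in> borel_measurable M" and fin: "N h < \<infinity>" for h
  proof (cases "N h = 0")
    case True
    then have "AE x in M. h x / u x = 0"
      using D.associate_eq_0_AE[of "\<lambda>x. h x / u x"] by (simp add: N AE_v)
    with u_AE have "AE x in M. h x * v x = 0" by eventually_elim (auto simp: ennreal_divide_eq_0_iff)
    then show ?thesis
      by (intro bexI[of _ "\<lambda>x. 0"]) (auto simp: maximal_AE_zero N_zero)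
  next
    case False
    define f where "f x = enn2real (h x)" for x
    have [measurable]: "f \<in> borel_measurable M" unfolding f_def by measurable
    have fh: "AE x in M. ennreal \<bar>f x\<bar> = h x"
      using finite_AE[OF that] by (auto simp: f_def elim: AE_mp)
    have ext: "ext_norm (assoc_norm ?\<nu> X) F = D.associate F" if "F \<in> borel_measurable M" for F
      using that by (intro D.ext_norm_assoc_norm) simp
    have "D.associate (\<lambda>x. ennreal \<bar>f x\<bar> / u x) = N h"
      unfolding N using fh by (intro D.associate_cong_AE) (auto simp: AE_v elim: AE_mp)
    with maj[of f] have "outer_norm M (ext_norm (assoc_norm ?\<nu> X)) (\<lambda>x. dual_maximal M \<B> v f x / u x)
        \<le> ennreal K * N h"
      by (simp add: ext)
    then obtain G where G [measurable]: "G \<in> borel_measurable M"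
      and G': "AE x in M. dual_maximal M \<B> v f x / u x \<le> G x"
        "ext_norm (assoc_norm ?\<nu> X) G \<le> ennreal (max 0 K + 1) * N h"
      by (rule outer_norm_majorant) (use False fin in \<open>auto simp: zero_less_iff_neq_zero\<close>)
    have "N (\<lambda>x. G x * u x) = D.associate G"
      unfolding N
    proof (rule D.associate_cong_AE)
      show "AE x in ?\<nu>. G x * u x / u x = G x"
        unfolding AE_v using u_AE by eventually_elim (simp add: ennreal_divide_mult_cancel)
    qed
    moreover have "AE x in M. maximal M \<B> (\<lambda>y. h y * v y) x \<le> G x * u x * v x"
      using G'(1) u_AE v_AE
    proof eventually_elim
      case (elim x)
      have "maximal M \<B> (\<lambda>y. h y * v y) x \<le> maximal M \<B> (\<lambda>y. ennreal \<bar>f y\<bar> * v y) x"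
        using fh by (intro maximal_mono_AE) (auto elim: AE_mp)
      also have "\<dots> = dual_maximal M \<B> v f x / u x * u x * v x"
        using elim by (simp add: dual_maximal_def ennreal_divide_mult_cancel)
      also have "\<dots> \<le> G x * u x * v x" using elim by (intro mult_right_mono) auto
      finally show ?case .
    qed
    ultimately show ?thesis using G'(2) by (intro bexI[of _ "\<lambda>x. G x * u x"]) (auto simp: ext)
  qed
  let ?P = "(\<lambda>(f, g). (\<lambda>x. f x epowr p, \<lambda>x. g x epowr p)) ` \<F>"
  have nu: "(\<integral>\<^sup>+x. g x * (H x * v x) \<partial>M) = (\<integral>\<^sup>+x. (g x * u x) * (H x / u x) \<partial>?\<nu>)"
    if [measurable]: "g \<in> borel_measurable M" "H \<in> borel_measurable M" for g H
  proof -
    have "(\<integral>\<^sup>+x. (g x * u x) * (H x / u x) \<partial>?\<nu>) = (\<integral>\<^sup>+x. (g x * u x) * (H x / u x) * v x \<partial>M)"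
      using v by (intro nn_integral_density_weight) measurable
    also have "\<dots> = (\<integral>\<^sup>+x. g x * (H x * v x) \<partial>M)"
    proof (rule nn_integral_cong_AE)
      show "AE x in M. (g x * u x) * (H x / u x) * v x = g x * (H x * v x)"
        using u_AE
      proof eventually_elim
        case (elim x)
        have "(g x * u x) * (H x / u x) * v x = g x * ((H x / u x * u x) * v x)" by (simp add: ac_simps)
        then show ?case using elim by (simp add: ennreal_divide_mult_cancel)
      qed
    qed
    finally show ?thesis by simp
  qed
  have "\<exists>C<\<infinity>. \<forall>(f,g)\<in>?P. \<forall>h\<in>borel_measurable M.
    N h \<le> 1 \<longrightarrow> (\<integral>\<^sup>+x. f x * (h x * v x) \<partial>M) \<le> C * ext_norm X (\<lambda>x. g x * u x)"
  proof (rule A1_bound_imp_test_bound[OF mbasisD(1)[OF basis] v majorant])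
    fix f g H :: "'a \<Rightarrow> ennreal" assume "(f, g) \<in> ?P" and [measurable]: "H \<in> borel_measurable M"
    then have [measurable]: "g \<in> borel_measurable M"
      using \<F> by (auto simp: extrapolation_family_def)
    have "(\<integral>\<^sup>+x. (g x * u x) * (H x / u x) \<partial>?\<nu>) \<le> ext_norm X (\<lambda>x. g x * u x) * N H"
      unfolding N by (intro D.Hoelder_associate) auto
    then show "(\<integral>\<^sup>+x. g x * (H x * v x) \<partial>M) \<le> ext_norm X (\<lambda>x. g x * u x) * N H" by (simp add: nu)
  qed (use \<F> weighted_bound_A1[OF basis wb] in \<open>auto simp: extrapolation_family_def\<close>)
  then obtain C where C: "C < \<infinity>" "\<And>f g h. (f, g) \<in> \<F> \<Longrightarrow> h \<in> borel_measurable M \<Longrightarrow> N h \<le> 1 \<Longrightarrow>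
    (\<integral>\<^sup>+x. f x epowr p * (h x * v x) \<partial>M) \<le> C * ext_norm X (\<lambda>x. g x epowr p * u x)"
    by fastforce
  have "ext_norm X (\<lambda>x. f x epowr p * u x) \<le> C * ext_norm X (\<lambda>x. g x epowr p * u x)"
    if fg: "(f, g) \<in> \<F>" for f g
  proof (rule D.Lorentz_Luxemburg)
    have [measurable]: "f \<in> borel_measurable M" using \<F> fg by (auto simp: extrapolation_family_def)
    show "(\<lambda>x. f x epowr p * u x) \<in> borel_measurable ?\<nu>" by measurable
    fix h assume "h \<in> borel_measurable ?\<nu>" and h: "D.associate h \<le> 1"
    then have [measurable]: "h \<in> borel_measurable M" by simp
    have eq: "AE x in ?\<nu>. h x * u x / u x = h x"
      unfolding AE_v using u_AE by eventually_elim (simp add: ennreal_divide_mult_cancel)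
    then have "N (\<lambda>x. h x * u x) = D.associate h" unfolding N by (rule D.associate_cong_AE)
    with h have "(\<integral>\<^sup>+x. f x epowr p * (h x * u x * v x) \<partial>M) \<le> C * ext_norm X (\<lambda>x. g x epowr p * u x)"
      by (intro C(2)[OF fg]) auto
    moreover have "(\<integral>\<^sup>+x. (f x epowr p * u x) * h x \<partial>?\<nu>) = (\<integral>\<^sup>+x. f x epowr p * (h x * u x * v x) \<partial>M)"
      using v by (subst nn_integral_density_weight) (auto simp: ac_simps)
    ultimately show "(\<integral>\<^sup>+x. (f x epowr p * u x) * h x \<partial>?\<nu>) \<le> C * ext_norm X (\<lambda>x. g x epowr p * u x)"
      by simp
  qed
  moreover have "C = ennreal (enn2real C)" using C(1) by simp
  ultimately have "\<forall>(f, g)\<in>\<F>. ext_norm X (\<lambda>x. f x epowr p * u x)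
    \<le> ennreal (enn2real C) * ext_norm X (\<lambda>x. g x epowr p * u x)" by auto
  then show ?thesis by (rule exI)
qed

lemma Lp_bound_imp_weighted_bound:
  assumes \<F>: "extrapolation_family M \<F>" and p0: "0 < p0"
    and bound: "\<And>w f g. w \<in> A_inf M \<B> \<Longrightarrow> (f, g) \<in> \<F> \<Longrightarrow>
      Lp_norm p0 (density M w) f \<le> ennreal (c w) * Lp_norm p0 (density M w) g"
  shows "weighted_bound M \<B> \<F> p0"
  unfolding weighted_bound_def
proof (intro allI impI ballI)
  fix q w assume q: "1 < (q::real)" and w: "w \<in> A_class M \<B> q"
  have ww: "weight M w" using w by (simp add: A_class_def)
  have wi: "w \<in> A_inf M \<B>" using w q by (auto simp: A_inf_def)
  have "(\<integral>\<^sup>+x. f x epowr p0 * w x \<partial>M) \<le> ennreal (c w) epowr p0 * (\<integral>\<^sup>+x. g x epowr p0 * w x \<partial>M)"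
    if fg: "(f, g) \<in> \<F>" for f g
  proof -
    have [measurable]: "f \<in> borel_measurable M" "g \<in> borel_measurable M"
      using \<F> fg by (auto simp: extrapolation_family_def)
    have "Lp_norm p0 (density M w) f epowr p0 \<le> (ennreal (c w) * Lp_norm p0 (density M w) g) epowr p0"
      using p0 bound[OF wi fg] by (intro epowr_mono) auto
    then show ?thesis
      using p0 by (simp add: Lp_norm_density_weight[OF ww] epowr_mult_distrib epowr_epowr)
  qed
  moreover have "ennreal (c w) epowr p0 < \<infinity>" using p0 by (simp add: epowr_less_top_iff[simplified])
  ultimately show "\<exists>C<\<infinity>. \<forall>(f, g)\<in>\<F>.
      (\<integral>\<^sup>+x. f x epowr p0 * w x \<partial>M) \<le> C * (\<integral>\<^sup>+x. g x epowr p0 * w x \<partial>M)"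
    by (intro exI[of _ "ennreal (c w) epowr p0"]) auto
qed

theorem theorem3p34:
  fixes M :: "'a measure"
    and \<B> :: "'a set set"
    and \<F> :: "(('a \<Rightarrow> ennreal) \<times> ('a \<Rightarrow> ennreal)) set"
    and u v :: "'a \<Rightarrow> ennreal"
    and X :: "('a \<Rightarrow> real) \<Rightarrow> ennreal"
    and N :: real
    and p0 :: real
    and \<Psi> :: "real \<Rightarrow> real"
  assumes "sigma_finite_measure M"
    and "nonatomic M"
    and "emeasure M (space M) > 0"
    and "muckenhoupt_basis M \<B>"
    and "extrapolation_family M \<F>"
    and "weight M u"
    and "weight M v"
    and "\<And>B. B \<in> \<B> \<Longrightarrow> emeasure (density M v) B < \<infinity>"
    and "function_norm (density M v) X"
    and "\<And>h :: 'a \<Rightarrow> real. h \<in> borel_measurable M \<Longrightarrow>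
           outer_norm M (ext_norm (assoc_norm (density M v) X)) (\<lambda>x. dual_maximal M \<B> v h x / u x)
             \<le> ennreal N * ext_norm (assoc_norm (density M v) X) (\<lambda>x. ennreal \<bar>h x\<bar> / u x)"
    and "0 < p0"
    and "\<Psi> ` {1..} \<subseteq> {1..}"
    and "mono_on {1..} \<Psi>"
    and "\<And>w f g. w \<in> A_inf M \<B> \<Longrightarrow> (f, g) \<in> \<F> \<Longrightarrow>
           Lp_norm p0 (density M w) f
             \<le> ennreal (\<Psi> (enn2real (A_inf_const M \<B> w))) * Lp_norm p0 (density M w) g"
  shows "(\<forall>p>0. \<exists>C::real. \<forall>(f, g)\<in>\<F>.
            ext_norm X (\<lambda>x. f x epowr p * u x) \<le> ennreal C * ext_norm X (\<lambda>x. g x epowr p * u x)) \<and>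
         (\<forall>p>0. \<forall>q>0. \<exists>C::real. \<forall>(J::nat set) f g. (\<forall>j\<in>J. (f j, g j) \<in> \<F>) \<longrightarrow>
            ext_norm X (\<lambda>x. (\<Sum>\<^sub>\<infinity>j\<in>J. f j x epowr q) epowr (p / q) * u x)
              \<le> ennreal C * ext_norm X (\<lambda>x. (\<Sum>\<^sub>\<infinity>j\<in>J. g j x epowr q) epowr (p / q) * u x))"
proof -
  note sf = assms(1) and mb = assms(4) and \<F> = assms(5)
  have wb: "weighted_bound M \<B> \<F> p" if "0 < p" for p
    using weighted_bound_all_exponents[OF sf mb \<F> \<open>0 < p0\<close> that
        Lp_bound_imp_weighted_bound[OF \<F> \<open>0 < p0\<close> assms(14)]] .
  have conclusion: "\<exists>C::real. \<forall>(f, g)\<in>\<G>.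
      ext_norm X (\<lambda>x. f x epowr p * u x) \<le> ennreal C * ext_norm X (\<lambda>x. g x epowr p * u x)"
    if "extrapolation_family M \<G>" "weighted_bound M \<B> \<G> p" for \<G> p
    by (rule weighted_bound_imp_function_norm_bound[OF sf muckenhoupt_mbasis[OF mb] that(1) assms(6,7,9,10) that(2)])
  have vector: "\<exists>C::real. \<forall>(J::nat set) f g. (\<forall>j\<in>J. (f j, g j) \<in> \<F>) \<longrightarrow>
      ext_norm X (\<lambda>x. (\<Sum>\<^sub>\<infinity>j\<in>J. f j x epowr q) epowr (p / q) * u x)
        \<le> ennreal C * ext_norm X (\<lambda>x. (\<Sum>\<^sub>\<infinity>j\<in>J. g j x epowr q) epowr (p / q) * u x)"
    if p: "0 < p" and q: "0 < q" for p q
  proof -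
    note \<F>q = extrapolation_family_lq[OF \<F>, of q]
    have "weighted_bound M \<B> (lq_family q \<F>) p"
      using weighted_bound_all_exponents[OF sf mb \<F>q q p weighted_bound_lq[OF \<F> q wb[OF q]]] .
    from conclusion[OF \<F>q this] obtain C :: real where C: "\<forall>(f, g)\<in>lq_family q \<F>.
      ext_norm X (\<lambda>x. f x epowr p * u x) \<le> ennreal C * ext_norm X (\<lambda>x. g x epowr p * u x)" ..
    show ?thesis
    proof (intro exI[of _ C] allI impI)
      fix J :: "nat set" and f g assume "\<forall>j\<in>J. (f j, g j) \<in> \<F>"
      then have "(\<lambda>x. (\<Sum>\<^sub>\<infinity>j\<in>J. f j x epowr q) epowr (1/q), \<lambda>x. (\<Sum>\<^sub>\<infinity>j\<in>J. g j x epowr q) epowr (1/q))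
        \<in> lq_family q \<F>" unfolding lq_family_def by blast
      from bspec[OF C this] show "ext_norm X (\<lambda>x. (\<Sum>\<^sub>\<infinity>j\<in>J. f j x epowr q) epowr (p / q) * u x)
        \<le> ennreal C * ext_norm X (\<lambda>x. (\<Sum>\<^sub>\<infinity>j\<in>J. g j x epowr q) epowr (p / q) * u x)"
        by (simp add: epowr_epowr)
    qed
  qed
  show ?thesis using conclusion[OF \<F> wb] vector by simp
qed

end
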